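(* Let $\Gamma$ be one of the following groups: \begin{itemize} \item $\Gamma=\mathrm{IET}^{+}(\mathbf{S})$; \item $\Gamma$ is any subgroup of $\mathrm{PC}^{+}(\mathbf{S})$ that includes $\mathrm{IET}^{+}(\mathbf{S})$; \item $\Gamma=\mathrm{IET}^{+}_{\Lambda}$, for some subgroup $\Lambda$ of $\mathbf{R}/\mathbf{Z}$ (viewed as a group of rotations) of $\mathbf{Q}$-rank $\ge 2$. \end{itemize} Then, modulo conjugation by finitely supported permutations of $\mathbf{S}$, the only subgroups of $\widehat{\mathrm{PC}^{\bowtie}}(\mathbf{S})$ lifting $\Gamma$ are $\Gamma_{\mathrm{left}}$ and $\Gamma_{\mathrm{right}}$.
   Context: Let $\mathbf{S}=\mathbf{R}/\mathbf{Z}$. Let $\widehat{\mathrm{PC}^{\bowtie}}(\mathbf{S})$ be the group of permutations of $\mathbf{S}$ that are continuous outside a finite subset; let $\mathfrak{S}_{\mathrm{fin}}(\mathbf{S})$ be its normal subgroup of finitely supported permutations; let $\mathrm{PC}^{\bowtie}(\mathbf{S})=\widehat{\mathrm{PC}^{\bowtie}}(\mathbf{S})/\mathfrak{S}_{\mathrm{fin}}(\mathbf{S})$ with quotient homomorphism $\pi$. A subgroup $\tilde\Gamma$ of $\widehat{\mathrm{PC}^{\bowtie}}(\mathbf{S})$ lifts a subgroup $\Gamma$ of $\mathrm{PC}^{\bowtie}(\mathbf{S})$ if $\pi$ restricts to a bijection $\tilde\Gamma\to\Gamma$. $\mathrm{PC}^{+}(\mathbf{S})$ is the subgroup of $\mathrm{PC}^{\bowtie}(\mathbf{S})$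 of piecewise orientation-preserving elements, and $\mathrm{IET}^{+}=\mathrm{IET}^{+}(\mathbf{S})$ is its subgroup of piecewise translations (interval exchanges). For a subgroup $\Lambda$ of $\mathbf{R}/\mathbf{Z}$, $\mathrm{IET}^{+}_{\Lambda}$ is the subgroup of elements of $\mathrm{IET}^{+}$ with all discontinuities in $\Lambda$ and which are locally (outside a finite set) of the form $x\mapsto x+\lambda$ with $\lambda\in\Lambda$. Each element of $\mathrm{PC}^{+}(\mathbf{S})$ has a unique left-continuous (resp. right-continuous) representative in $\widehat{\mathrm{PC}^{\bowtie}}(\mathbf{S})$; for $\Gamma\le\mathrm{PC}^{+}(\mathbf{S})$, $\Gamma_{\mathrm{left}}$ (resp. $\Gamma_{\mathrm{right}}$) is the group of left-continuous (resp. right-continuous) representatives of elements of $\Gamma$. The $\mathbf{Q}$-rank of an abelian group $A$ is $\dim_{\mathbf{Q}}(A\otimes_{\mathbf{Z}}\mathbf{Q})$. *)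

theory Defs
  imports
    "HOL-Analysis.Analysis"
    "HOL-Algebra.Free_Abelian_Groups"
    "HOL-Library.Extended_Nat"
    "Jordan_Normal_Form.Missing_VectorSpace"
begin

section \<open>The circle \<open>\<real>/\<int>\<close>\<close>

quotient_type circle = real / "\<lambda>x y. x - y \<in> \<int>"
  morphisms rep_circle circle_of
proof (intro equivpI reflpI sympI transpI)
  show "x - x \<in> \<int>" for x :: real by simp
  show "y - x \<in> \<int>" if "x - y \<in> \<int>" for x y :: real
    using Ints_minus[OF that] by simp
  show "x - z \<in> \<int>" if "x - y \<in> \<int>" "y - z \<in> \<int>" for x y z :: real
    using Ints_add[OF that] by simp
qed

lemma circle_of_eq_iff: "circle_of s = circle_of t \<longleftrightarrow> s - t \<in> \<int>"
  by (rule circle.abs_eq_iff)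

lemma circle_of_surj: "\<exists>t. x = circle_of t"
  by (induct x rule: circle.abs_induct) auto

instantiation circle :: ab_group_add
begin

lift_definition zero_circle :: circle is 0 .

lift_definition plus_circle :: "circle \<Rightarrow> circle \<Rightarrow> circle" is "(+)"
  subgoal for a b c d using Ints_add[of "a - b" "c - d"] by (simp add: algebra_simps)
  done

lift_definition uminus_circle :: "circle \<Rightarrow> circle" is uminus
  subgoal for a b using Ints_minus[of "a - b"] by simp
  done

lift_definition minus_circle :: "circle \<Rightarrow> circle \<Rightarrow> circle" is "(-)"
  subgoal for a b c d using Ints_diff[of "a - b" "c - d"] by (simp add: algebra_simps)
  done

instance
  by standard (transfer; simp)+

end

text \<open>The topology is the quotient topology.\<close>

instantiation circle :: topological_space
begin

definition open_circle :: "circle set \<Rightarrow> bool" where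
  "open_circle U \<longleftrightarrow> open (circle_of -` U)"

instance
  by standard (auto simp: open_circle_def vimage_Union)

end

lemma open_circle_of_image:
  assumes "open A"
  shows "open (circle_of ` A)"
proof -
  have "circle_of -` (circle_of ` A) = (\<Union>k\<in>\<int>. (+) k ` A)"
  proof (intro equalityI subsetI)
    fix s assume "s \<in> circle_of -` (circle_of ` A)"
    then obtain a where a: "a \<in> A" "s - a \<in> \<int>" by (auto simp: circle_of_eq_iff)
    then have "s = (s - a) + a" by simp
    with a show "s \<in> (\<Union>k\<in>\<int>. (+) k ` A)" by blast
  next
    fix s assume "s \<in> (\<Union>k\<in>\<int>. (+) k ` A)"
    then obtain k a where "k \<in> \<int>" "a \<in> A" "s = k + a" by blast
    then have "circle_of s = circle_of a" by (simp add: circle_of_eq_iff)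
    with \<open>a \<in> A\<close> show "s \<in> circle_of -` (circle_of ` A)" by simp
  qed
  then show ?thesis
    using assms by (auto simp: open_circle_def intro!: open_translation)
qed

instance circle :: t2_space
proof
  fix x y :: circle
  assume "x \<noteq> y"
  obtain s t where st: "x = circle_of s" "y = circle_of t"
    using circle_of_surj by blast
  with \<open>x \<noteq> y\<close> have nI: "s - t \<notin> \<int>" by (simp add: circle_of_eq_iff)
  define r where "r = setdist {s - t} (\<int> :: real set)"
  have r: "r > 0"
    using nI closed_Ints by (auto simp: r_def setdist_gt_0_compact_closed)
  have disj: "circle_of ` ball s (r/2) \<inter> circle_of ` ball t (r/2) = {}"
  proof (rule ccontr)
    assume "\<not> ?thesis"
    then obtain a b where ab: "dist s a < r/2" "dist t b < r/2" "a - b \<in> \<int>"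
      by (auto simp: circle_of_eq_iff)
    have "r \<le> dist (s - t) (a - b)"
      unfolding r_def using ab(3) by (intro setdist_le_dist) auto
    with ab(1,2) show False unfolding dist_real_def by linarith
  qed
  show "\<exists>U V. open U \<and> open V \<and> x \<in> U \<and> y \<in> V \<and> U \<inter> V = {}"
    using disj r st
    by (intro exI[of _ "circle_of ` ball s (r/2)"] exI[of _ "circle_of ` ball t (r/2)"])
       (auto intro!: open_circle_of_image)
qed

definition circle_group :: "circle monoid" where
  "circle_group = \<lparr>carrier = UNIV, mult = (+), one = 0\<rparr>"


section \<open>Permutations of the circle that are continuous outside a finite set\<close>

definition PC_hat :: "(circle \<Rightarrow> circle) monoid" where
  "PC_hat = \<lparr>carrier = {f. bij f \<and> (\<exists>F. finite F \<and> (\<forall>x. x \<notin> F \<longrightarrow> isCont f x))},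
             mult = (\<circ>), one = id\<rparr>"

definition Sym_fin :: "(circle \<Rightarrow> circle) set" where
  "Sym_fin = {f. bij f \<and> finite {x. f x \<noteq> x}}"

text \<open>An element of the quotient group is the set of all its representatives in \<open>PC_hat\<close>.\<close>

definition PC :: "(circle \<Rightarrow> circle) set monoid" where
  "PC = PC_hat Mod Sym_fin"

definition PC_proj :: "(circle \<Rightarrow> circle) \<Rightarrow> (circle \<Rightarrow> circle) set" where
  "PC_proj f = Sym_fin #>\<^bsub>PC_hat\<^esub> f"

definition lifts :: "(circle \<Rightarrow> circle) set \<Rightarrow> (circle \<Rightarrow> circle) set set \<Rightarrow> bool" where
  "lifts H \<Gamma> \<longleftrightarrow> subgroup H PC_hat \<and> bij_betw PC_proj H \<Gamma>"


section \<open>Piecewise orientation-preserving elements and interval exchanges\<close>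

text \<open>\<open>g\<close> is a local lift of \<open>f\<close> to the universal cover \<open>\<real>\<close>.\<close>

definition orientation_preserving_at :: "(circle \<Rightarrow> circle) \<Rightarrow> circle \<Rightarrow> bool" where
  "orientation_preserving_at f x \<longleftrightarrow>
     (\<exists>t e g. x = circle_of t \<and> e > 0 \<and>
        continuous_on {t-e<..<t+e} g \<and> strict_mono_on {t-e<..<t+e} g \<and>
        (\<forall>s\<in>{t-e<..<t+e}. f (circle_of s) = circle_of (g s)))"

definition PC_plus :: "(circle \<Rightarrow> circle) set set" where
  "PC_plus = PC_proj ` {f \<in> carrier PC_hat.
     \<exists>F. finite F \<and> (\<forall>x. x \<notin> F \<longrightarrow> orientation_preserving_at f x)}"

definition piecewise_translation_by :: "circle set \<Rightarrow> (circle \<Rightarrow> circle) \<Rightarrow> bool" where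
  "piecewise_translation_by L f \<longleftrightarrow>
     (\<exists>F. finite F \<and> (\<forall>x. x \<notin> F \<longrightarrow> (\<exists>c\<in>L. \<forall>\<^sub>F y in nhds x. f y = y + c)))"

definition IET_plus :: "(circle \<Rightarrow> circle) set set" where
  "IET_plus = PC_proj ` {f \<in> carrier PC_hat. piecewise_translation_by UNIV f}"

text \<open>Whether a representative is continuous at \<open>x\<close> depends on the representative; a discontinuity
  of a class is a point that no choice of representative makes a continuity point.\<close>

definition discontinuity :: "(circle \<Rightarrow> circle) set \<Rightarrow> circle \<Rightarrow> bool" where
  "discontinuity \<phi> x \<longleftrightarrow> \<not> (\<exists>f\<in>\<phi>. isCont f x)"

definition IET_plus_on :: "circle set \<Rightarrow> (circle \<Rightarrow> circle) set set" where
  "IET_plus_on L = {\<phi> \<in> IET_plus.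
     (\<forall>x. discontinuity \<phi> x \<longrightarrow> x \<in> L) \<and> (\<exists>f\<in>\<phi>. piecewise_translation_by L f)}"


section \<open>One-sided continuous representatives\<close>

definition left_continuous :: "(circle \<Rightarrow> circle) \<Rightarrow> bool" where
  "left_continuous f \<longleftrightarrow> (\<forall>t. continuous (at_left t) (\<lambda>s. f (circle_of s)))"

definition right_continuous :: "(circle \<Rightarrow> circle) \<Rightarrow> bool" where
  "right_continuous f \<longleftrightarrow> (\<forall>t. continuous (at_right t) (\<lambda>s. f (circle_of s)))"

definition left_reps :: "(circle \<Rightarrow> circle) set set \<Rightarrow> (circle \<Rightarrow> circle) set" where
  "left_reps \<Gamma> = {f \<in> carrier PC_hat. left_continuous f \<and> PC_proj f \<in> \<Gamma>}"

definition right_reps :: "(circle \<Rightarrow> circle) set set \<Rightarrow> (circle \<Rightarrow> circle) set" where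
  "right_reps \<Gamma> = {f \<in> carrier PC_hat. right_continuous f \<and> PC_proj f \<in> \<Gamma>}"

definition conj_by :: "(circle \<Rightarrow> circle) \<Rightarrow> (circle \<Rightarrow> circle) set \<Rightarrow> (circle \<Rightarrow> circle) set" where
  "conj_by \<sigma> H = (\<lambda>h. \<sigma> \<circ> h \<circ> inv_into UNIV \<sigma>) ` H"


section \<open>The \<open>\<rat>\<close>-rank of an abelian group\<close>

definition rat_field :: "rat ring" where
  "rat_field = \<lparr>carrier = UNIV, mult = (*), one = 1, zero = 0, add = (+)\<rparr>"

text \<open>\<open>A \<otimes>\<^sub>\<int> \<rat>\<close> is the free abelian group on \<open>A \<times> \<rat>\<close> modulo the biadditivity relations, with
  \<open>q \<cdot> (a \<otimes> r) = a \<otimes> (q * r)\<close>. The group \<open>A\<close> is written multiplicatively.\<close>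

definition tensor_relations :: "('a, 'b) monoid_scheme \<Rightarrow> ('a \<times> rat \<Rightarrow>\<^sub>0 int) set" where
  "tensor_relations A =
     {frag_of (a \<otimes>\<^bsub>A\<^esub> b, q) - frag_of (a, q) - frag_of (b, q) |a b q.
        a \<in> carrier A \<and> b \<in> carrier A} \<union>
     {frag_of (a, q + r) - frag_of (a, q) - frag_of (a, r) |a q r. a \<in> carrier A}"

definition tensor_kernel :: "('a, 'b) monoid_scheme \<Rightarrow> ('a \<times> rat \<Rightarrow>\<^sub>0 int) set" where
  "tensor_kernel A =
     generate (free_Abelian_group (carrier A \<times> UNIV)) (tensor_relations A)"

definition tensor_scale :: "rat \<Rightarrow> ('a \<times> rat \<Rightarrow>\<^sub>0 int) \<Rightarrow> ('a \<times> rat \<Rightarrow>\<^sub>0 int)" where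
  "tensor_scale q = frag_extend (\<lambda>(a, r). frag_of (a, q * r))"

text \<open>The fields \<open>mult\<close> and \<open>one\<close> of a module record play no role.\<close>

definition tensor_rat ::
  "('a, 'b) monoid_scheme \<Rightarrow> (rat, ('a \<times> rat \<Rightarrow>\<^sub>0 int) set) module" where
  "tensor_rat A =
     (let G = free_Abelian_group (carrier A \<times> UNIV); N = tensor_kernel A in
      \<lparr>carrier = carrier (G Mod N), mult = undefined, one = undefined,
       zero = \<one>\<^bsub>G Mod N\<^esub>, add = (\<lambda>X Y. X \<otimes>\<^bsub>G Mod N\<^esub> Y),
       smult = (\<lambda>q X. \<Union>x\<in>X. N #>\<^bsub>G\<^esub> tensor_scale q x)\<rparr>)"

lemma tensor_relations_carrier:
  "tensor_relations A \<subseteq> carrier (free_Abelian_group (carrier A \<times> UNIV))" if "monoid A"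
proof -
  interpret monoid A by fact
  let ?C = "carrier (free_Abelian_group (carrier A \<times> (UNIV::rat set)))"
  have d: "x - y \<in> ?C" if "x \<in> ?C" "y \<in> ?C" for x y
    using that keys_diff[of x y] by (auto simp: free_Abelian_group_def)
  show ?thesis unfolding tensor_relations_def
    by (auto intro!: d)
qed

lemma tensor_scale_closed:
  assumes "x \<in> carrier (free_Abelian_group (S \<times> UNIV))"
  shows "tensor_scale q x \<in> carrier (free_Abelian_group (S \<times> UNIV))"
proof -
  have "Poly_Mapping.keys (tensor_scale q x) \<subseteq> (\<lambda>(a, r). (a, q * r)) ` Poly_Mapping.keys x"
    unfolding tensor_scale_def
    by (rule order_trans[OF keys_frag_extend]) (auto simp: keys_frag_of)
  with assms show ?thesis by (fastforce simp: free_Abelian_group_def)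
qed

lemma vectorspace_tensor_rat:
  fixes A :: "('a, 'b) monoid_scheme"
  assumes "comm_group A"
  shows "vectorspace rat_field (tensor_rat A)"
proof -
  interpret A: comm_group A by fact
  define G where "G = free_Abelian_group (carrier A \<times> (UNIV :: rat set))"
  define N where "N = tensor_kernel A"
  interpret G: comm_group G
    unfolding G_def by (rule abelian_free_Abelian_group)
  have Gs: "carrier G = {c. Poly_Mapping.keys c \<subseteq> carrier A \<times> UNIV}" "mult G = (+)" "one G = 0"
    by (auto simp: G_def free_Abelian_group_def)
  have Ginv: "inv\<^bsub>G\<^esub> x = - x" if "x \<in> carrier G" for x
    using that by (simp add: G_def)
  have R: "tensor_relations A \<subseteq> carrier G"
    unfolding G_def by (rule tensor_relations_carrier) (rule A.monoid_axioms)
  have N: "subgroup N G"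
    unfolding N_def tensor_kernel_def G_def[symmetric] by (rule G.generate_is_subgroup[OF R])
  interpret N: normal N G by (rule G.subgroup_imp_normal[OF N])
  have RN: "x \<in> N" if "x \<in> tensor_relations A" for x
    using that unfolding N_def tensor_kernel_def by (rule generate.incl)
  have Nz: "0 \<in> N" using N.one_closed by (simp add: Gs)
  have Na: "x + y \<in> N" if "x \<in> N" "y \<in> N" for x y
    using N.m_closed[OF that] by (simp add: Gs)
  have Nm: "- x \<in> N" if "x \<in> N" for x
    using N.m_inv_closed[OF that] Ginv[OF N.mem_carrier[OF that]] by simp
  have Nd: "x - y \<in> N" if "x \<in> N" "y \<in> N" for x y
    using Na[OF that(1) Nm[OF that(2)]] by simp
  have sc: "tensor_scale q x \<in> carrier G" if "x \<in> carrier G" for q x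
    using tensor_scale_closed that unfolding G_def by blast
  have sadd: "tensor_scale q (x + y) = tensor_scale q x + tensor_scale q y"
    and sdiff: "tensor_scale q (x - y) = tensor_scale q x - tensor_scale q y"
    and sminus: "tensor_scale q (- x) = - tensor_scale q x"
    and s0: "tensor_scale q 0 = 0"
    and sof: "tensor_scale q (frag_of (a, r)) = frag_of (a, q * r)" for q r x y and a :: 'a
    by (simp_all add: tensor_scale_def frag_extend_add frag_extend_diff frag_extend_minus)
  have rel1: "frag_of (a \<otimes>\<^bsub>A\<^esub> b, r) - frag_of (a, r) - frag_of (b, r) \<in> tensor_relations A"
    if "a \<in> carrier A" "b \<in> carrier A" for a b r
    using that unfolding tensor_relations_def by blast
  have rel2: "frag_of (a, r + s) - frag_of (a, r) - frag_of (a, s) \<in> tensor_relations A"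
    if "a \<in> carrier A" for a r s
    using that unfolding tensor_relations_def by blast
  have srel: "tensor_scale q h \<in> tensor_relations A" if h: "h \<in> tensor_relations A" for q h
    using h by (subst (asm) tensor_relations_def)
      (auto simp: sdiff sof distrib_left intro: rel1 rel2)
  have sN: "tensor_scale q x \<in> N" if "x \<in> N" for q x
  proof -
    have "x \<in> generate G (tensor_relations A)"
      using that by (simp add: N_def tensor_kernel_def G_def)
    then show ?thesis
    proof induct
      case one then show ?case by (simp add: Gs s0 Nz)
    next
      case (incl h)
      then show ?case by (intro RN srel)
    next
      case (inv h)
      then have "tensor_scale q h \<in> N"
        by (intro RN srel)
      then show ?case using Ginv[OF subsetD[OF R inv]] by (simp add: sminus Nm)
    next
      case (eng g h) then show ?case by (simp add: Gs sadd Na)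
    qed
  qed
  define cl where "cl = (\<lambda>x. N #>\<^bsub>G\<^esub> x)"
  have cl_eq: "cl x = cl y \<longleftrightarrow> x - y \<in> N" if "x \<in> carrier G" "y \<in> carrier G" for x y
  proof -
    have *: "x \<in> N #>\<^bsub>G\<^esub> y \<longleftrightarrow> x - y \<in> N" for x y
      by (auto simp: r_coset_def Gs intro: bexI[of _ "x - y"])
    show ?thesis
      using that G.repr_independence[OF _ that(2) N, of x] G.repr_independenceD[OF N that(1), of y] *
      unfolding cl_def by metis
  qed
  have cl_car: "carrier (G Mod N) = cl ` carrier G"
    by (auto simp: FactGroup_def RCOSETS_def cl_def)
  have cl_add: "cl x \<otimes>\<^bsub>G Mod N\<^esub> cl y = cl (x + y)" if "x \<in> carrier G" "y \<in> carrier G" for x y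
    using N.rcos_sum[OF that] by (simp add: FactGroup_def cl_def Gs)
  have cl_0: "\<one>\<^bsub>G Mod N\<^esub> = cl 0"
    using G.coset_mult_one[OF N.subset] by (simp add: FactGroup_def cl_def Gs)
  let ?T = "tensor_rat A"
  have T: "carrier ?T = carrier (G Mod N)" "zero ?T = \<one>\<^bsub>G Mod N\<^esub>"
    "add ?T = mult (G Mod N)"
    "smult ?T = (\<lambda>q X. \<Union>x\<in>X. cl (tensor_scale q x))"
    by (simp_all add: tensor_rat_def Let_def G_def N_def cl_def)
  have cl_addT: "cl x \<oplus>\<^bsub>?T\<^esub> cl y = cl (x + y)" if "x \<in> carrier G" "y \<in> carrier G" for x y
    using cl_add[OF that] unfolding T(3) .
  have sm: "q \<odot>\<^bsub>?T\<^esub> cl x = cl (tensor_scale q x)" if x: "x \<in> carrier G" for q x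
  proof -
    have "cl (tensor_scale q y) = cl (tensor_scale q x)" if "y \<in> cl x" for y
    proof -
      obtain n where n: "n \<in> N" "y = n + x" using \<open>y \<in> cl x\<close> by (auto simp: cl_def r_coset_def Gs)
      have "y \<in> carrier G" using n x N.mem_carrier G.m_closed by (fastforce simp: Gs(2))
      then have "cl (tensor_scale q y) = cl (tensor_scale q x) \<longleftrightarrow>
          tensor_scale q y - tensor_scale q x \<in> N"
        using x by (intro cl_eq sc)
      then show ?thesis using n sN by (simp add: sadd)
    qed
    moreover have "x \<in> cl x" using G.rcos_self[OF x N] by (simp add: cl_def)
    ultimately show ?thesis unfolding T by blast
  qed
  have add_closed: "x + y \<in> carrier G" if "x \<in> carrier G" "y \<in> carrier G" for x y
    using G.m_closed[OF that] by (simp add: Gs(2))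
  have diff_closed: "x - y \<in> carrier G" if "x \<in> carrier G" "y \<in> carrier G" for x y
    using add_closed[OF that(1) G.inv_closed[OF that(2)]] that by (simp add: Ginv)
  have comp: "tensor_scale (q * r) x = tensor_scale q (tensor_scale r x)"
    and one: "tensor_scale 1 x = x"
    and plus: "tensor_scale (q + r) x - tensor_scale q x - tensor_scale r x \<in> N"
    if "x \<in> carrier G" for q r x
  proof -
    have K: "Poly_Mapping.keys x \<subseteq> carrier A \<times> UNIV" using that by (simp add: Gs)
    show "tensor_scale (q * r) x = tensor_scale q (tensor_scale r x)"
      using K by (induct x rule: frag_induction) (auto simp: s0 sdiff sof mult.assoc)
    show "tensor_scale 1 x = x"
      using K by (induct x rule: frag_induction) (auto simp: s0 sdiff sof)
    show "tensor_scale (q + r) x - tensor_scale q x - tensor_scale r x \<in> N"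
      using K
    proof (induct x rule: frag_induction)
      case zero then show ?case by (simp add: s0 Nz)
    next
      case (one p)
      obtain a s where p: "p = (a, s)" by (cases p)
      show ?case using one unfolding p sof distrib_right
        by (intro RN rel2) auto
    next
      case (diff a b)
      then show ?case using Nd[OF diff(1) diff(2)] by (simp add: sdiff algebra_simps)
    qed
  qed
  have GN: "comm_group (G Mod N)" by (rule G.abelian_FactGroup[OF N])
  have "abelian_group ?T"
  proof (rule abelian_groupI)
    interpret GN: comm_group "G Mod N" by (rule GN)
    show "\<exists>y\<in>carrier ?T. y \<oplus>\<^bsub>?T\<^esub> x = \<zero>\<^bsub>?T\<^esub>" if "x \<in> carrier ?T" for x
      using that GN.l_inv_ex unfolding T by blast
  qed (unfold T, (rule comm_groupE[OF GN]; assumption?)+)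
  moreover have "field rat_field"
  proof (rule cring.cring_fieldI2)
    show "cring rat_field"
      by (rule cringI, rule abelian_groupI)
         (auto simp: rat_field_def algebra_simps intro!: comm_monoidI exI[of _ "- _"])
    show "\<zero>\<^bsub>rat_field\<^esub> \<noteq> \<one>\<^bsub>rat_field\<^esub>" by (simp add: rat_field_def)
    show "\<exists>b\<in>carrier rat_field. a \<otimes>\<^bsub>rat_field\<^esub> b = \<one>\<^bsub>rat_field\<^esub>"
      if "a \<in> carrier rat_field" "a \<noteq> \<zero>\<^bsub>rat_field\<^esub>" for a
      using that by (auto simp: rat_field_def intro!: exI[of _ "inverse a"])
  qed
  ultimately show ?thesis
    unfolding vectorspace_def
  proof (intro conjI moduleI)
    assume "field rat_field" "abelian_group ?T"
    then show "cring rat_field" by (simp add: fieldE)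
    show "a \<odot>\<^bsub>?T\<^esub> x \<in> carrier ?T" if "x \<in> carrier ?T" for a x
      using that by (auto simp: T(1) cl_car sm sc)
    show "(a \<oplus>\<^bsub>rat_field\<^esub> b) \<odot>\<^bsub>?T\<^esub> x = a \<odot>\<^bsub>?T\<^esub> x \<oplus>\<^bsub>?T\<^esub> b \<odot>\<^bsub>?T\<^esub> x"
      if "x \<in> carrier ?T" for a b x
    proof -
      from that obtain y where y: "y \<in> carrier G" "x = cl y" by (auto simp: T(1) cl_car)
      have "cl (tensor_scale (a + b) y) = cl (tensor_scale a y + tensor_scale b y)"
        by (subst cl_eq) (use y plus[OF y(1)] in \<open>auto intro: sc add_closed simp: diff_diff_eq\<close>)
      then show ?thesis using y by (simp add: sm sc cl_addT) (simp add: rat_field_def)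
    qed
    show "a \<odot>\<^bsub>?T\<^esub> (x \<oplus>\<^bsub>?T\<^esub> y) = a \<odot>\<^bsub>?T\<^esub> x \<oplus>\<^bsub>?T\<^esub> a \<odot>\<^bsub>?T\<^esub> y"
      if "x \<in> carrier ?T" "y \<in> carrier ?T" for a x y
      using that by (auto simp: T(1) cl_car sm sc cl_addT add_closed sadd)
    show "(a \<otimes>\<^bsub>rat_field\<^esub> b) \<odot>\<^bsub>?T\<^esub> x = a \<odot>\<^bsub>?T\<^esub> (b \<odot>\<^bsub>?T\<^esub> x)"
      if "x \<in> carrier ?T" for a b x
      using that by (auto simp: T(1) cl_car sm sc comp rat_field_def)
    show "\<one>\<^bsub>rat_field\<^esub> \<odot>\<^bsub>?T\<^esub> x = x" if "x \<in> carrier ?T" for x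
      using that by (auto simp: T(1) cl_car sm one rat_field_def)
  qed
qed

definition rat_rank :: "('a, 'b) monoid_scheme \<Rightarrow> enat" where
  "rat_rank A =
     (if vectorspace.fin_dim rat_field (tensor_rat A)
      then enat (vectorspace.dim rat_field (tensor_rat A)) else \<infinity>)"

end

theory Submission
  imports Defs
begin

text \<open>
  A map that is piecewise orientation-preserving has one-sided limits, and passing to one-sided
  germs is functorial; this makes the left and right representatives into groups lifting
  \<open>\<Gamma>\<close>.

  Conversely, let \<open>H\<close> lift \<open>\<Gamma>\<close>. The rotations in \<open>\<Gamma>\<close> contain a freely acting copy of \<open>\<int>\<^sup>2\<close>,
  and because \<open>\<int>\<^sup>2\<close> has one end, a finitely supported conjugation turns the lifts of the rotations
  into the rotations themselves. An element of \<open>H\<close> whose support is almost a short arc then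
  commutes with its rotated copies that are supported away from that arc, which confines its
  support to the closed arc. Conjugating swaps of two short adjacent intervals by \<open>k \<in> H\<close> shows
  that \<open>k\<close> takes the right value wherever it has a two-sided limit. At the remaining points the
  side is decided by which end of its support the lift of a short swap moves, and it is the same
  side everywhere because the rotations normalise the situation.
\<close>

section \<open>The circle\<close>

text \<open>The obstacle is that a class determines a permutation only up to finitely many unknown
  points, so every geometric fact about a lift starts out modulo a finite set. Exactness is
  recovered from injectivity of the projection: two elements of \<open>H\<close> that agree off a
  finite set are equal. This turns almost commuting into commuting, and almost multiplicative
  choices of lifts into homomorphisms. Two independent rotations are needed because Z has two ends:
  along a single cyclic group the values that define the conjugating permutation could differ at the
  two ends. Germs replace continuity since they ignore the value at the point. An element
  \<open>k\<close> therefore acts on short one-sided arcs in a known way before \<open>k x\<close>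
  itself is known; confinement of supports at ever smaller scales then pins \<open>k x\<close> down.
  All three cases are instances of one statement about a group \<open>L\<close> of rotations, which
  is the whole circle in the first two.\<close>

lemma circle_of_add: "circle_of (s + t) = circle_of s + circle_of t"
  by (simp add: plus_circle.abs_eq)

lemma circle_of_minus: "circle_of (- t) = - circle_of t"
  by (simp add: uminus_circle.abs_eq)

lemma circle_of_diff: "circle_of (s - t) = circle_of s - circle_of t"
  by (simp add: minus_circle.abs_eq)

lemma circle_of_0: "circle_of 0 = 0"
  by (simp add: zero_circle_def)

lemma circle_of_Ints: "circle_of t = 0 \<longleftrightarrow> t \<in> \<int>"
  using circle_of_eq_iff[of t 0] by (simp add: circle_of_0)

lemma circle_of_eq_close:
  assumes "circle_of s = circle_of t" "\<bar>s - t\<bar> < 1"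
  shows "s = t"
proof -
  obtain k where k: "s - t = of_int k"
    using assms(1) circle_of_eq_iff[of s t] by (auto elim!: Ints_cases)
  with assms(2) have "k = 0" by simp
  with k show ?thesis by simp
qed

lemma circle_of_rep:
  obtains s where "0 \<le> s" "s < 1" "x = y + circle_of s"
proof -
  obtain t where t: "x - y = circle_of t" using circle_of_surj by blast
  have "circle_of (frac t) = circle_of t"
    by (simp add: circle_of_eq_iff frac_def)
  then have "x = y + circle_of (frac t)" using t by (simp add: algebra_simps)
  then show ?thesis using that[of "frac t"] frac_lt_1[of t] by auto
qed

lemma continuous_on_circle_of: "continuous_on A circle_of"
proof (rule continuous_on_subset)
  show "continuous_on UNIV circle_of"
    by (auto simp: continuous_on_open_vimage open_circle_def)
qed auto

text \<open>\<open>circle_of\<close> is continuous and open, so \<open>x + circle_of s\<close> is a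
  chart that identifies neighbourhoods of \<open>x\<close> with those of 0. All limits on the circle
  are taken in this chart.\<close>

lemma nhds_circle: "nhds x = filtermap (\<lambda>s. x + circle_of s) (nhds 0)"
proof (rule antisym)
  obtain t where t: "x = circle_of t" using circle_of_surj by blast
  have e: "x + circle_of s = circle_of (t + s)" for s by (simp add: t circle_of_add)
  show "filtermap (\<lambda>s. x + circle_of s) (nhds 0) \<le> nhds x"
  proof -
    have "((\<lambda>s. circle_of (t + s)) \<longlongrightarrow> circle_of (t + 0)) (at 0)"
      by (rule isContD, rule continuous_on_interior[of UNIV])
        (auto intro!: continuous_on_compose2[OF continuous_on_circle_of[of UNIV]] continuous_intros)
    then have "((\<lambda>s. circle_of (t + s)) \<longlongrightarrow> circle_of (t + 0)) (nhds 0)"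
      unfolding tendsto_at_iff_tendsto_nhds[of "\<lambda>s. circle_of (t + s)"] .
    then show ?thesis unfolding e by (simp add: filterlim_def t)
  qed
  show "nhds x \<le> filtermap (\<lambda>s. x + circle_of s) (nhds 0)"
  proof (rule filter_leI)
    fix P assume "eventually P (filtermap (\<lambda>s. x + circle_of s) (nhds 0))"
    then have "eventually (\<lambda>s. P (x + circle_of s)) (nhds (0::real))"
      by (simp add: eventually_filtermap)
    then obtain S :: "real set" where S: "open S" "0 \<in> S" "\<And>s. s \<in> S \<Longrightarrow> P (x + circle_of s)"
      by (auto simp: eventually_nhds)
    have "open (circle_of ` ((+) t ` S))"
      by (intro open_circle_of_image open_translation S)
    moreover have "x \<in> circle_of ` ((+) t ` S)"
      using S(2) t by force
    moreover have "P y" if "y \<in> circle_of ` ((+) t ` S)" for y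
      using that S(3) by (auto simp: e)
    ultimately show "eventually P (nhds x)" by (auto simp: eventually_nhds)
  qed
qed

lemma eventually_nhds_circle:
  "eventually P (nhds x) \<longleftrightarrow> (\<exists>d>0. \<forall>s. \<bar>s\<bar> < d \<longrightarrow> P (x + circle_of s))"
  by (subst nhds_circle) (simp add: eventually_filtermap eventually_nhds_metric dist_real_def)

text \<open>\<open>x\<close> itself may lie in \<open>E\<close>. Finite sets are closed, which
  removes the other points, and a radius below 1 prevents \<open>x + circle_of s\<close> from
  returning to \<open>x\<close>.\<close>

lemma finite_circle_avoid:
  fixes x :: circle
  assumes "finite E"
  obtains d where "0 < d" "d < 1" "\<And>s. s \<noteq> 0 \<Longrightarrow> \<bar>s\<bar> < d \<Longrightarrow> x + circle_of s \<notin> E"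
proof -
  have "open (- (E - {x}))" using assms by (intro open_Compl finite_imp_closed) auto
  then have "eventually (\<lambda>y. y \<in> - (E - {x})) (nhds x)"
    by (intro eventually_nhds_in_open) auto
  then obtain d where d: "d > 0" "\<And>s. \<bar>s\<bar> < d \<Longrightarrow> x + circle_of s \<notin> E - {x}"
    unfolding eventually_nhds_circle by auto
  show ?thesis
  proof (rule that[of "min d (1/2)"])
    fix s :: real assume s: "s \<noteq> 0" "\<bar>s\<bar> < min d (1/2)"
    then have "circle_of s \<noteq> 0"
      using circle_of_eq_close[of s 0] by (auto simp: circle_of_0)
    with d(2)[of s] s show "x + circle_of s \<notin> E" by auto
  qed (use d in auto)
qed

lemma isCont_circle:
  fixes f :: "circle \<Rightarrow> circle"
  shows "isCont f x \<longleftrightarrow> ((\<lambda>s. f (x + circle_of s)) \<longlongrightarrow> f x) (nhds 0)"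
proof -
  have "isCont f x \<longleftrightarrow> (f \<longlongrightarrow> f x) (nhds x)"
    by (simp add: isCont_def tendsto_at_iff_tendsto_nhds)
  also have "\<dots> \<longleftrightarrow> ((\<lambda>s. f (x + circle_of s)) \<longlongrightarrow> f x) (nhds 0)"
    by (subst (2) nhds_circle) (simp add: filterlim_filtermap)
  finally show ?thesis .
qed

abbreviation finv :: "('a \<Rightarrow> 'b) \<Rightarrow> 'b \<Rightarrow> 'a" where
  "finv \<equiv> inv_into UNIV"

section \<open>One-sided germs\<close>

text \<open>A strictly increasing map onto an interval is automatically continuous, so this is an
  increasing homeomorphism in purely order-theoretic terms. Gluing, composing and inverting then
  need no topology.\<close>

definition mono_bij :: "(real \<Rightarrow> real) \<Rightarrow> real \<Rightarrow> real \<Rightarrow> bool" where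
  "mono_bij g a b \<longleftrightarrow> strict_mono_on {a..b} g \<and> g ` {a..b} = {g a..g b}"

lemma mono_bij_less: "mono_bij g a b \<Longrightarrow> a \<le> s \<Longrightarrow> s < t \<Longrightarrow> t \<le> b \<Longrightarrow> g s < g t"
  by (auto simp: mono_bij_def strict_mono_on_def)

lemma mono_bij_le: "mono_bij g a b \<Longrightarrow> a \<le> s \<Longrightarrow> s \<le> t \<Longrightarrow> t \<le> b \<Longrightarrow> g s \<le> g t"
  by (metis less_eq_real_def mono_bij_less)

lemma mono_bij_surj:
  assumes "mono_bij g a b" "g a \<le> v" "v \<le> g b"
  obtains s where "a \<le> s" "s \<le> b" "g s = v"
  using assms by (auto simp: mono_bij_def image_iff set_eq_iff) (metis atLeastAtMost_iff)

lemma mono_bij_less_iff: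
  "mono_bij g a b \<Longrightarrow> a \<le> s \<Longrightarrow> s \<le> b \<Longrightarrow> a \<le> t \<Longrightarrow> t \<le> b \<Longrightarrow> g s < g t \<longleftrightarrow> s < t"
  by (metis mono_bij_less mono_bij_le not_less)

lemma mono_bij_le_iff:
  "mono_bij g a b \<Longrightarrow> a \<le> s \<Longrightarrow> s \<le> b \<Longrightarrow> a \<le> t \<Longrightarrow> t \<le> b \<Longrightarrow> g s \<le> g t \<longleftrightarrow> s \<le> t"
  by (metis mono_bij_less_iff not_less)

lemma mono_bijI:
  assumes "\<And>s t. a \<le> s \<Longrightarrow> s < t \<Longrightarrow> t \<le> b \<Longrightarrow> g s < g t"
    and "\<And>v. g a \<le> v \<Longrightarrow> v \<le> g b \<Longrightarrow> \<exists>s. a \<le> s \<and> s \<le> b \<and> g s = v"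
  shows "mono_bij g a b"
  unfolding mono_bij_def
proof (intro conjI equalityI subsetI)
  show "strict_mono_on {a..b} g" using assms(1) by (auto simp: strict_mono_on_def)
  fix v assume "v \<in> g ` {a..b}"
  then obtain s where s: "a \<le> s" "s \<le> b" "v = g s" by auto
  have "g a \<le> g s" using assms(1)[of a s] s by (cases "a = s") auto
  moreover have "g s \<le> g b" using assms(1)[of s b] s by (cases "s = b") auto
  ultimately show "v \<in> {g a..g b}" using s by auto
next
  fix v assume "v \<in> {g a..g b}" then show "v \<in> g ` {a..b}" using assms(2)[of v] by force
qed

lemma mono_bij_subinterval:
  assumes "mono_bij g a b" "a \<le> c" "c \<le> d" "d \<le> b"
  shows "mono_bij g c d"
proof (rule mono_bijI)
  show "g s < g t" if "c \<le> s" "s < t" "t \<le> d" for s t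
    using mono_bij_less[OF assms(1)] that assms by auto
  fix v assume v: "g c \<le> v" "v \<le> g d"
  have "g a \<le> g c" "g d \<le> g b" using mono_bij_le[OF assms(1)] assms by auto
  then obtain s where s: "a \<le> s" "s \<le> b" "g s = v"
    using mono_bij_surj[OF assms(1), of v] v by (metis order_trans)
  then show "\<exists>s. c \<le> s \<and> s \<le> d \<and> g s = v"
    using mono_bij_le_iff[OF assms(1)] v assms by (intro exI[of _ s]) auto
qed

lemma mono_bij_comp:
  assumes "mono_bij g a b" "mono_bij h (g a) (g b)"
  shows "mono_bij (h \<circ> g) a b"
proof (rule mono_bijI)
  show "(h \<circ> g) s < (h \<circ> g) t" if "a \<le> s" "s < t" "t \<le> b" for s t
    using that by (auto intro!: mono_bij_less[OF assms(2)] mono_bij_less[OF assms(1)] mono_bij_le[OF assms(1)])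
  fix v assume "(h \<circ> g) a \<le> v" "v \<le> (h \<circ> g) b"
  then obtain u where u: "g a \<le> u" "u \<le> g b" "h u = v"
    using mono_bij_surj[OF assms(2), of v] by auto
  then show "\<exists>s. a \<le> s \<and> s \<le> b \<and> (h \<circ> g) s = v"
    using mono_bij_surj[OF assms(1), of u] by (metis comp_apply)
qed

lemma mono_bij_continuous:
  assumes "a \<le> b" "continuous_on {a..b} g" "strict_mono_on {a..b} g"
  shows "mono_bij g a b"
proof (rule mono_bijI)
  show "g s < g t" if "a \<le> s" "s < t" "t \<le> b" for s t
    using assms(3) that by (auto simp: strict_mono_on_def)
  show "\<exists>s. a \<le> s \<and> s \<le> b \<and> g s = v" if "g a \<le> v" "v \<le> g b" for v
    using IVT'[of g a v b] that assms by auto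
qed

text \<open>\<open>germ e f x w\<close>: on the side of \<open>x\<close> given by the sign \<open>e\<close>, the map \<open>f\<close> is an
  orientation-preserving homeomorphism onto a one-sided neighbourhood of \<open>w\<close>, which is
  therefore the one-sided limit of \<open>f\<close> at \<open>x\<close>. The value \<open>f x\<close> is irrelevant.\<close>

definition germ :: "real \<Rightarrow> (circle \<Rightarrow> circle) \<Rightarrow> circle \<Rightarrow> circle \<Rightarrow> bool" where
  "germ e f x w \<longleftrightarrow> (\<exists>d>0. \<exists>g. mono_bij g 0 d \<and> g 0 = 0 \<and>
     (\<forall>s. 0 < s \<and> s \<le> d \<longrightarrow> f (x + circle_of (e * s)) = w + circle_of (e * g s)))"

text \<open>Since \<open>g\<close> is onto an interval starting at 0, it takes arbitrarily small
  positive values; restricting it makes both source and target no longer than the prescribed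
  \<open>c\<close>.\<close>

lemma germE:
  assumes "germ e f x w" "0 < c"
  obtains d g where "0 < d" "d \<le> c" "g d \<le> c" "mono_bij g 0 d" "g 0 = 0" "0 < g d"
    "\<And>s. 0 < s \<Longrightarrow> s \<le> d \<Longrightarrow> f (x + circle_of (e * s)) = w + circle_of (e * g s)"
proof -
  obtain d g where d: "0 < d" "mono_bij g 0 d" "g 0 = 0"
    "\<And>s. 0 < s \<Longrightarrow> s \<le> d \<Longrightarrow> f (x + circle_of (e * s)) = w + circle_of (e * g s)"
    using assms by (auto simp: germ_def)
  have gd: "0 < g d" using mono_bij_less[OF d(2), of 0 d] d by auto
  obtain s where s: "0 \<le> s" "s \<le> d" "g s = min c (g d)"
    using mono_bij_surj[OF d(2), of "min c (g d)"] gd d assms by auto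
  have s0: "0 < s" using s d gd assms by (cases "s = 0") auto
  define r where "r = min s c"
  have r: "0 < r" "r \<le> d" "r \<le> c" "r \<le> s" using s0 s assms by (auto simp: r_def)
  show ?thesis
  proof (rule that[of r g])
    show "g r \<le> c" using mono_bij_le[OF d(2), of r s] r s by auto
    show "mono_bij g 0 r" using mono_bij_subinterval[OF d(2), of 0 r] r by auto
    show "0 < g r" using mono_bij_less[OF d(2), of 0 r] r d by auto
  qed (use r d in auto)
qed

lemma germI:
  assumes "0 < d" "mono_bij g 0 d" "g 0 = 0"
    "\<And>s. 0 < s \<Longrightarrow> s \<le> d \<Longrightarrow> f (x + circle_of (e * s)) = w + circle_of (e * g s)"
  shows "germ e f x w"
  using assms unfolding germ_def by blast

lemma mono_bij_id: "mono_bij (\<lambda>s. s) a b"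
  by (rule mono_bijI) auto

lemma germ_translation:
  assumes "0 < d" "\<And>s. 0 < s \<Longrightarrow> s \<le> d \<Longrightarrow> f (x + circle_of (e * s)) = w + circle_of (e * s)"
  shows "germ e f x w"
  by (rule germI[OF assms(1) mono_bij_id]) (use assms in auto)

lemma germ_id: "germ e id x x"
  by (rule germ_translation[of 1]) auto

lemma germ_comp:
  assumes "germ e f x w" "germ e h w z"
  shows "germ e (h \<circ> f) x z"
proof -
  obtain c h' where h: "0 < c" "mono_bij h' 0 c" "h' 0 = 0"
    "\<And>s. 0 < s \<Longrightarrow> s \<le> c \<Longrightarrow> h (w + circle_of (e * s)) = z + circle_of (e * h' s)"
    using assms(2) by (rule germE[of _ _ _ _ 1]) (simp, blast)
  obtain d g where g: "0 < d" "g d \<le> c" "mono_bij g 0 d" "g 0 = 0" "0 < g d"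
    "\<And>s. 0 < s \<Longrightarrow> s \<le> d \<Longrightarrow> f (x + circle_of (e * s)) = w + circle_of (e * g s)"
    using assms(1) h(1) by (rule germE) blast
  show ?thesis
  proof (rule germI[of d "h' \<circ> g"])
    show "mono_bij (h' \<circ> g) 0 d"
      using mono_bij_comp[OF g(3), of h'] mono_bij_subinterval[OF h(2), of 0 "g d"] g by auto
    fix s assume s: "0 < s" "s \<le> d"
    have "0 < g s" "g s \<le> c"
      using mono_bij_less[OF g(3), of 0 s] mono_bij_le[OF g(3), of s d] s g by auto
    then show "(h \<circ> f) (x + circle_of (e * s)) = z + circle_of (e * (h' \<circ> g) s)"
      using h(4) g(6) s by simp
  qed (use g h in auto)
qed

lemma germ_inverse:
  assumes "bij f" "germ e f x w"
  shows "germ e (finv f) w x"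
proof -
  obtain d g where g: "0 < d" "mono_bij g 0 d" "g 0 = 0" "0 < g d"
    "\<And>s. 0 < s \<Longrightarrow> s \<le> d \<Longrightarrow> f (x + circle_of (e * s)) = w + circle_of (e * g s)"
    using assms(2) by (rule germE[of _ _ _ _ 1]) (simp, blast)
  define h where "h = the_inv_into {0..d} g"
  have inj: "inj_on g {0..d}" and im: "g ` {0..d} = {0..g d}"
    using g(2,3) strict_mono_on_imp_inj_on by (auto simp: mono_bij_def)
  have hg: "h (g s) = s" if "0 \<le> s" "s \<le> d" for s
    using the_inv_into_f_f[OF inj] that by (simp add: h_def)
  have gh: "g (h v) = v" "0 \<le> h v" "h v \<le> d" if v: "0 \<le> v" "v \<le> g d" for v
    using f_the_inv_into_f[OF inj, of v] the_inv_into_into[OF inj, of v "{0..d}"] v im by (auto simp: h_def)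
  show ?thesis
  proof (rule germI[of "g d" h])
    show h0: "h 0 = 0" using hg[of 0] g by simp
    have hd: "h (g d) = d" using hg[of d] g by simp
    show "mono_bij h 0 (g d)"
    proof (rule mono_bijI)
      show "h s < h t" if "0 \<le> s" "s < t" "t \<le> g d" for s t
        using mono_bij_less_iff[OF g(2), of "h s" "h t"] gh[of s] gh[of t] that by auto
      show "\<exists>s. 0 \<le> s \<and> s \<le> g d \<and> h s = v" if "h 0 \<le> v" "v \<le> h (g d)" for v
        using that mono_bij_le[OF g(2), of 0 v] mono_bij_le[OF g(2), of v d] g hg[of v] h0 hd
        by (intro exI[of _ "g v"]) auto
    qed
    fix s assume s: "0 < s" "s \<le> g d"
    have "0 < h s" using gh[of s] s g(3) by (cases "h s = 0") auto
    then have "f (x + circle_of (e * h s)) = w + circle_of (e * s)"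
      using g(5)[of "h s"] gh[of s] s by auto
    then show "finv f (w + circle_of (e * s)) = x + circle_of (e * h s)"
      using assms(1) by (metis bij_is_inj inv_f_f)
  qed (use g in auto)
qed

text \<open>A germ ignores the value at \<open>x\<close>, and a shorter arc misses the remaining
  finitely many points of disagreement. Germs are thus invariants of the class modulo
  \<open>Sym_fin\<close>.\<close>

lemma germ_cong:
  assumes "finite {y. f y \<noteq> h y}" "germ e f x w" "\<bar>e\<bar> = 1"
  shows "germ e h x w"
proof -
  obtain c where c: "0 < c" "c < 1" "\<And>s. s \<noteq> 0 \<Longrightarrow> \<bar>s\<bar> < c \<Longrightarrow> x + circle_of s \<notin> {y. f y \<noteq> h y}"
    using assms(1) by (rule finite_circle_avoid) blast
  have c2: "0 < c / 2" using c by simp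
  obtain d g where g: "0 < d" "d \<le> c/2" "mono_bij g 0 d" "g 0 = 0"
    "\<And>s. 0 < s \<Longrightarrow> s \<le> d \<Longrightarrow> f (x + circle_of (e * s)) = w + circle_of (e * g s)"
    using assms(2) c2 by (rule germE) blast
  show ?thesis
  proof (rule germI[of d g])
    fix s assume s: "0 < s" "s \<le> d"
    then have "e * s \<noteq> 0" "\<bar>e * s\<bar> < c" using c g assms by (auto simp: abs_mult)
    then show "h (x + circle_of (e * s)) = w + circle_of (e * g s)"
      using c(3)[of "e * s"] g(5)[of s] s by auto
  qed (use g in auto)
qed

lemma tendsto_circle_line:
  "((\<lambda>s. w + circle_of (e * s)) \<longlongrightarrow> w) (nhds 0)"
proof -
  have "((\<lambda>s. w + circle_of s) \<longlongrightarrow> w) (nhds 0)"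
    using filterlim_ident[of "nhds w"] by (subst (asm) (2) nhds_circle) (simp add: filterlim_filtermap)
  moreover have "((\<lambda>s. e * s) \<longlongrightarrow> 0) (nhds 0)"
    using tendsto_mult[OF tendsto_const[of e] filterlim_ident[of "nhds (0::real)"]] by simp
  ultimately show ?thesis by (rule filterlim_compose)
qed

lemma germ_tendsto:
  assumes "germ e f x w"
  shows "((\<lambda>s. f (x + circle_of (e * s))) \<longlongrightarrow> w) (at_right 0)"
proof (rule topological_tendstoI)
  fix S assume "open S" "w \<in> S"
  with tendsto_circle_line[of w e] have "\<forall>\<^sub>F s in nhds 0. w + circle_of (e * s) \<in> S"
    by (simp add: topological_tendstoD)
  then obtain c where c: "0 < c" "\<And>s. \<bar>s\<bar> < c \<Longrightarrow> w + circle_of (e * s) \<in> S"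
    by (auto simp: eventually_nhds_metric dist_real_def)
  have c2: "0 < c / 2" using c by simp
  obtain d g where g: "0 < d" "g d \<le> c/2" "mono_bij g 0 d" "g 0 = 0"
    "\<And>s. 0 < s \<Longrightarrow> s \<le> d \<Longrightarrow> f (x + circle_of (e * s)) = w + circle_of (e * g s)"
    using assms c2 by (rule germE) blast
  have "f (x + circle_of (e * s)) \<in> S" if "0 < s" "s < d" for s
    using g(5)[of s] that mono_bij_le[OF g(3), of s d] mono_bij_less[OF g(3), of 0 s] g c(2)[of "g s"] c(1) by auto
  then show "\<forall>\<^sub>F s in at_right 0. f (x + circle_of (e * s)) \<in> S"
    using g(1) by (auto simp: eventually_at_right_field)
qed

lemma germ_unique:
  assumes "germ e f x w" "germ e f x w'"
  shows "w = w'"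
  using germ_tendsto[OF assms(1)] germ_tendsto[OF assms(2)] by (rule tendsto_unique[rotated]) simp

lemma germ_isCont:
  assumes "isCont f x" "germ e f x w"
  shows "w = f x"
proof -
  have "((\<lambda>s. f (x + circle_of s)) \<longlongrightarrow> f x) (nhds 0)" using assms(1) by (simp add: isCont_circle)
  moreover have "((\<lambda>s. e * s) \<longlongrightarrow> 0) (at_right 0)"
    by (auto intro!: tendsto_eq_intros)
  ultimately have "((\<lambda>s. f (x + circle_of (e * s))) \<longlongrightarrow> f x) (at_right 0)"
    by (rule filterlim_compose)
  with germ_tendsto[OF assms(2)] show ?thesis by (rule tendsto_unique[rotated]) simp
qed

lemma isCont_germ:
  assumes "germ 1 f x (f x)" "germ (-1) f x (f x)"
  shows "isCont f x"
proof -
  have "((\<lambda>s. f (x + circle_of s)) \<longlongrightarrow> f x) (at_right 0)" using germ_tendsto[OF assms(1)] by simp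
  moreover have "((\<lambda>s. f (x + circle_of s)) \<longlongrightarrow> f x) (at_left 0)"
    using germ_tendsto[OF assms(2)] by (subst at_left_minus) (simp add: filterlim_filtermap)
  ultimately have "((\<lambda>s. f (x + circle_of s)) \<longlongrightarrow> f x) (at 0)"
    by (intro filterlim_split_at)
  then have "((\<lambda>s. f (x + circle_of s)) \<longlongrightarrow> f (x + circle_of 0)) (at 0)" by (simp add: circle_of_0)
  then have "((\<lambda>s. f (x + circle_of s)) \<longlongrightarrow> f (x + circle_of 0)) (nhds 0)"
    unfolding tendsto_at_iff_tendsto_nhds[of "\<lambda>s. f (x + circle_of s)"] .
  then show ?thesis by (simp add: isCont_circle circle_of_0)
qed

lemma right_continuous_tendsto:
  "right_continuous f \<longleftrightarrow> (\<forall>x. ((\<lambda>s. f (x + circle_of (1 * s))) \<longlongrightarrow> f x) (at_right 0))"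
proof -
  have "continuous (at_right t) (\<lambda>s. f (circle_of s)) \<longleftrightarrow>
      ((\<lambda>s. f (circle_of t + circle_of s)) \<longlongrightarrow> f (circle_of t)) (at_right 0)" for t
    unfolding continuous_within
    unfolding at_right_to_0[of t] filterlim_filtermap
    by (simp add: circle_of_add add.commute)
  then show ?thesis unfolding right_continuous_def using circle_of_surj by auto metis
qed

lemma left_continuous_tendsto:
  "left_continuous f \<longleftrightarrow> (\<forall>x. ((\<lambda>s. f (x + circle_of (-1 * s))) \<longlongrightarrow> f x) (at_right 0))"
proof -
  have "continuous (at_left t) (\<lambda>s. f (circle_of s)) \<longleftrightarrow>
      ((\<lambda>s. f (circle_of t + circle_of (- s))) \<longlongrightarrow> f (circle_of t)) (at_right 0)" for t
    unfolding continuous_within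
    unfolding at_left_minus[of t] at_right_to_0[of "- t"] filterlim_filtermap
    by (simp add: circle_of_diff circle_of_minus)
  then show ?thesis unfolding left_continuous_def using circle_of_surj by auto metis
qed

section \<open>Existence of germs for piecewise orientation-preserving maps\<close>

lemma orientation_preserving_at_local_lift:
  assumes "orientation_preserving_at f (x + circle_of s)"
  obtains e g where "e > 0" "continuous_on {s-e<..<s+e} g" "strict_mono_on {s-e<..<s+e} g"
    "\<And>r. \<bar>r - s\<bar> < e \<Longrightarrow> f (x + circle_of r) = circle_of (g r)"
proof -
  obtain t e g where g: "x + circle_of s = circle_of t" "e > 0"
      "continuous_on {t-e<..<t+e} g" "strict_mono_on {t-e<..<t+e} g"
      "\<And>s. s \<in> {t-e<..<t+e} \<Longrightarrow> f (circle_of s) = circle_of (g s)"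
    using assms unfolding orientation_preserving_at_def by blast
  have e: "x + circle_of r = circle_of (t + (r - s))" for r
    using g(1) by (simp add: circle_of_add circle_of_diff algebra_simps)
  show ?thesis
  proof (rule that[of e "\<lambda>r. g (t + (r - s))"])
    show "continuous_on {s-e<..<s+e} (\<lambda>r. g (t + (r - s)))"
      by (rule continuous_on_compose2[OF g(3)]) (auto intro!: continuous_intros)
    show "strict_mono_on {s-e<..<s+e} (\<lambda>r. g (t + (r - s)))"
      using g(4) by (auto simp: strict_mono_on_def)
    show "f (x + circle_of r) = circle_of (g (t + (r - s)))" if "\<bar>r - s\<bar> < e" for r
      unfolding e using that by (intro g(5)) auto
  qed fact
qed

lemma mono_bij_glue:
  assumes "mono_bij g a b" "mono_bij h b c" "g b = h b" "a \<le> b" "b \<le> c"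
  shows "mono_bij (\<lambda>r. if r \<le> b then g r else h r) a c"
proof (rule mono_bijI)
  fix s t assume st: "a \<le> s" "s < t" "t \<le> c"
  consider "t \<le> b" | "b < s" | "s \<le> b" "b < t" by linarith
  then show "(if s \<le> b then g s else h s) < (if t \<le> b then g t else h t)"
  proof cases
    case 3
    then have "g s \<le> g b" "h b < h t"
      using st mono_bij_le[OF assms(1), of s b] mono_bij_less[OF assms(2), of b t] assms by auto
    with 3 assms(3) show ?thesis by simp
  qed (use st mono_bij_less[OF assms(1), of s t] mono_bij_less[OF assms(2), of s t] in auto)
next
  fix v assume v: "(if a \<le> b then g a else h a) \<le> v" "v \<le> (if c \<le> b then g c else h c)"
  show "\<exists>s. a \<le> s \<and> s \<le> c \<and> (if s \<le> b then g s else h s) = v"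
  proof (cases "v \<le> g b")
    case True
    then obtain s where "a \<le> s" "s \<le> b" "g s = v"
      using mono_bij_surj[OF assms(1), of v] v assms by auto
    then show ?thesis using assms by (intro exI[of _ s]) auto
  next
    case False
    then have "c \<noteq> b" using v assms by auto
    then obtain s where "b \<le> s" "s \<le> c" "h s = v"
      using mono_bij_surj[OF assms(2), of v] v False assms by auto
    then show ?thesis using False assms by (intro exI[of _ s]) auto
  qed
qed

text \<open>Path lifting by bisection: local lifts exist, and lifts over adjacent intervals differ
  at the common point by an integer, so one of them can be translated before gluing.\<close>

lemma lift_on_interval:
  assumes "a \<le> b" "\<And>s. a \<le> s \<Longrightarrow> s \<le> b \<Longrightarrow> orientation_preserving_at f (x + circle_of s)"
  shows "\<exists>g. mono_bij g a b \<and> (\<forall>r\<in>{a..b}. f (x + circle_of r) = circle_of (g r))"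
  using assms(1)
proof (induction rule: Bolzano)
  case (trans a b c)
  then obtain g h where g: "mono_bij g a b" "\<And>r. r \<in> {a..b} \<Longrightarrow> f (x + circle_of r) = circle_of (g r)"
    and h: "mono_bij h b c" "\<And>r. r \<in> {b..c} \<Longrightarrow> f (x + circle_of r) = circle_of (h r)"
    by blast
  have "circle_of (h b) = circle_of (g b)" using g(2)[of b] h(2)[of b] trans by simp
  then have k: "h b - g b \<in> \<int>" by (simp add: circle_of_eq_iff)
  define h' where "h' r = h r - (h b - g b)" for r
  have "mono_bij h' b c"
  proof (rule mono_bijI)
    show "h' s < h' t" if "b \<le> s" "s < t" "t \<le> c" for s t
      using mono_bij_less[OF h(1)] that by (simp add: h'_def)
    show "\<exists>s\<ge>b. s \<le> c \<and> h' s = v" if "h' b \<le> v" "v \<le> h' c" for v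
      using mono_bij_surj[OF h(1), of "v + (h b - g b)"] that unfolding h'_def
      by (metis add_diff_cancel le_diff_eq diff_le_eq)
  qed
  moreover have "g b = h' b" by (simp add: h'_def)
  ultimately have "mono_bij (\<lambda>r. if r \<le> b then g r else h' r) a c"
    using g(1) trans by (intro mono_bij_glue) auto
  moreover have "circle_of (h' r) = circle_of (h r)" for r
    using Ints_minus[OF k] by (simp add: h'_def circle_of_eq_iff)
  then have "f (x + circle_of r) = circle_of (if r \<le> b then g r else h' r)" if "r \<in> {a..c}" for r
    using g(2)[of r] h(2)[of r] that by auto
  ultimately show ?case by blast
next
  case (local s)
  then obtain e g where g: "e > 0" "continuous_on {s-e<..<s+e} g" "strict_mono_on {s-e<..<s+e} g"
    "\<And>r. \<bar>r - s\<bar> < e \<Longrightarrow> f (x + circle_of r) = circle_of (g r)"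
    using orientation_preserving_at_local_lift[OF assms(2)] by metis
  show ?case
  proof (intro exI[of _ e] conjI allI impI)
    fix c d assume cd: "c \<le> s \<and> s \<le> d \<and> d - c < e"
    then have sub: "{c..d} \<subseteq> {s-e<..<s+e}" by auto
    have "mono_bij g c d"
      using cd continuous_on_subset[OF g(2) sub] monotone_on_subset[OF g(3) sub]
      by (intro mono_bij_continuous) auto
    then show "\<exists>g. mono_bij g c d \<and> (\<forall>r\<in>{c..d}. f (x + circle_of r) = circle_of (g r))"
      using g(4) cd by (intro exI[of _ g]) auto
  qed fact
qed

text \<open>Injectivity keeps a lift from gaining a full turn, since it would pass through a gain of
  exactly 1 and \<open>f\<close> would repeat a value. The displacement up to
  \<open>f (x + circle_of c)\<close> is therefore bounded, and it grows as the starting point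
  approaches \<open>x\<close>; its supremum locates the one-sided limit.\<close>

lemma germ_right_exists:
  assumes "inj f" "finite F" "\<And>y. y \<notin> F \<Longrightarrow> orientation_preserving_at f y"
  shows "\<exists>w. germ 1 f x w"
proof -
  obtain c0 where c0: "0 < c0" "c0 < 1" "\<And>s. s \<noteq> 0 \<Longrightarrow> \<bar>s\<bar> < c0 \<Longrightarrow> x + circle_of s \<notin> F"
    using finite_circle_avoid[OF assms(2)] by blast
  define c where "c = c0 / 2"
  have c: "0 < c" "c < 1" "c < c0" using c0 by (auto simp: c_def)
  define d where "d s = (SOME d. 0 \<le> d \<and> d < 1 \<and> f (x + circle_of c) = f (x + circle_of s) + circle_of d)" for s
  text \<open>The displacement \<open>d s\<close> from \<open>f (x + s)\<close> to \<open>f (x + c)\<close> is defined without reference to a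
    lift, so the lifts on the intervals \<open>[s, c]\<close> fit together.\<close>
  have lift: "\<exists>g. mono_bij g s c \<and> (\<forall>r\<in>{s..c}. f (x + circle_of r) = circle_of (g r)) \<and>
      (\<forall>r\<in>{s..c}. d r = g c - g r)" if s: "0 < s" "s \<le> c" for s
  proof -
    have op: "orientation_preserving_at f (x + circle_of r)" if "s \<le> r" "r \<le> c" for r
      using c0(3)[of r] that s c by (intro assms(3)) auto
    obtain g where g: "mono_bij g s c" "\<And>r. r \<in> {s..c} \<Longrightarrow> f (x + circle_of r) = circle_of (g r)"
      using lift_on_interval[OF s(2) op] by blast
    have len: "g c - g s < 1"
    proof (rule ccontr)
      assume "\<not> ?thesis"
      then obtain r where r: "s \<le> r" "r \<le> c" "g r = g s + 1"
        using mono_bij_surj[OF g(1), of "g s + 1"] by auto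
      then have "f (x + circle_of r) = f (x + circle_of s)"
        using g(2)[of r] g(2)[of s] s by (simp add: circle_of_eq_iff)
      then have "circle_of r = circle_of s" using injD[OF assms(1)] by fastforce
      then have "r = s" using circle_of_eq_close[of r s] r s c by auto
      then show False using r by simp
    qed
    have "d r = g c - g r" if r: "r \<in> {s..c}" for r
    proof -
      have gr: "g s \<le> g r" "g r \<le> g c" using mono_bij_le[OF g(1)] r by auto
      have ex: "0 \<le> g c - g r \<and> g c - g r < 1 \<and> f (x + circle_of c) = f (x + circle_of r) + circle_of (g c - g r)"
        using gr len g(2)[of c] g(2)[of r] r s by (simp add: circle_of_diff)
      have "0 \<le> d r \<and> d r < 1 \<and> f (x + circle_of c) = f (x + circle_of r) + circle_of (d r)"
        unfolding d_def by (rule someI_ex) (use ex in blast)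
      then show ?thesis using ex by (intro circle_of_eq_close) auto
    qed
    then show ?thesis using g by blast
  qed
  have d1: "d s < 1" "0 \<le> d s" "f (x + circle_of c) = f (x + circle_of s) + circle_of (d s)"
    if s: "0 < s" "s \<le> c" for s
  proof -
    have "\<exists>d. 0 \<le> d \<and> d < 1 \<and> f (x + circle_of c) = f (x + circle_of s) + circle_of d"
      by (rule circle_of_rep[of "f (x + circle_of c)" "f (x + circle_of s)"]) blast
    then have "0 \<le> d s \<and> d s < 1 \<and> f (x + circle_of c) = f (x + circle_of s) + circle_of (d s)"
      unfolding d_def by (rule someI_ex)
    then show "d s < 1" "0 \<le> d s" "f (x + circle_of c) = f (x + circle_of s) + circle_of (d s)" by auto
  qed
  have anti: "d t < d s" if st: "0 < s" "s < t" "t \<le> c" for s t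
  proof -
    obtain g where g: "mono_bij g s c" "\<And>r. r \<in> {s..c} \<Longrightarrow> d r = g c - g r"
      using lift[of s] st by force
    show ?thesis using g(2)[of s] g(2)[of t] mono_bij_less[OF g(1), of s t] st by auto
  qed
  have ivt: "\<exists>r\<ge>s. r \<le> c \<and> d r = v" if s: "0 < s" "s \<le> c" and v: "d c \<le> v" "v \<le> d s" for s v
  proof -
    obtain g where g: "mono_bij g s c" "\<And>r. r \<in> {s..c} \<Longrightarrow> d r = g c - g r"
      using lift[of s] s by force
    obtain r where "s \<le> r" "r \<le> c" "g r = g c - v"
      using mono_bij_surj[OF g(1), of "g c - v"] v g(2)[of s] g(2)[of c] s by auto
    then show ?thesis using g(2)[of r] by auto
  qed
  have dc: "d c = 0" using lift[of c] c by auto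
  \<comment> \<open>\<open>L\<close> is the displacement from the sought limit to
    \<open>f (x + circle_of c)\<close>. It is not attained, which makes \<open>g\<close> strictly
    increasing at 0.\<close>
  define L where "L = Sup (d ` {0<..c})"
  have bdd: "bdd_above (d ` {0<..c})" using d1(1) by (intro bdd_aboveI[of _ 1]) (auto intro: less_imp_le)
  have dL: "d s < L" if "0 < s" "s \<le> c" for s
  proof -
    have "d s < d (s/2)" using anti[of "s/2" s] that by auto
    also have "\<dots> \<le> L" unfolding L_def using that bdd by (intro cSup_upper) auto
    finally show ?thesis .
  qed
  define g where "g s = (if s = 0 then 0 else L - d s)" for s
  show ?thesis
  proof (intro exI germI)
    show "0 < c" by fact
    show "mono_bij g 0 c"
    proof (rule mono_bijI)
      show "g s < g t" if "0 \<le> s" "s < t" "t \<le> c" for s t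
        using that dL[of t] anti[of s t] by (auto simp: g_def)
      fix v assume v: "g 0 \<le> v" "v \<le> g c"
      show "\<exists>s. 0 \<le> s \<and> s \<le> c \<and> g s = v"
      proof (cases "v = 0")
        case False
        then have v': "0 < v" "v \<le> L" using v c dc by (auto simp: g_def)
        have "\<exists>y\<in>d ` {0<..c}. L - v < y"
          using v' bdd c unfolding L_def by (subst less_cSup_iff[symmetric]) auto
        then obtain s where s: "0 < s" "s \<le> c" "L - v < d s" by auto
        then obtain r where "s \<le> r" "r \<le> c" "d r = L - v"
          using ivt[of s "L - v"] v' dc by auto
        then show ?thesis using s by (intro exI[of _ r]) (auto simp: g_def)
      qed (use c in \<open>auto simp: g_def intro!: exI[of _ 0]\<close>)
    qed
    show "f (x + circle_of (1 * s)) = f (x + circle_of c) - circle_of L + circle_of (1 * g s)" if "0 < s" "s \<le> c" for s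
      using d1(3)[OF that] that by (simp add: g_def circle_of_diff)
  qed (simp add: g_def)
qed

lemma orientation_preserving_at_reflect:
  assumes "orientation_preserving_at f (- x)"
  shows "orientation_preserving_at (\<lambda>y. - f (- y)) x"
proof -
  obtain t e g where g: "- x = circle_of t" "e > 0"
      "continuous_on {t-e<..<t+e} g" "strict_mono_on {t-e<..<t+e} g"
      "\<And>s. s \<in> {t-e<..<t+e} \<Longrightarrow> f (circle_of s) = circle_of (g s)"
    using assms unfolding orientation_preserving_at_def by blast
  show ?thesis unfolding orientation_preserving_at_def
  proof (rule exI[of _ "- t"], rule exI[of _ e], rule exI[of _ "\<lambda>r. - g (- r)"], intro conjI ballI)
    show "x = circle_of (- t)" using g(1) by (simp add: circle_of_minus flip: g(1))
    show "continuous_on {- t - e<..<- t + e} (\<lambda>r. - g (- r))"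
      by (intro continuous_on_minus, rule continuous_on_compose2[OF g(3)]) (auto intro!: continuous_intros)
    show "strict_mono_on {- t - e<..<- t + e} (\<lambda>r. - g (- r))"
      using g(4) by (auto simp: strict_mono_on_def)
    show "- f (- circle_of s) = circle_of (- g (- s))" if "s \<in> {- t - e<..<- t + e}" for s
      using g(5)[of "- s"] that by (auto simp: circle_of_minus)
  qed fact
qed

text \<open>The left side is reduced to the right one by conjugating with \<open>uminus\<close>,
  which reverses orientation twice.\<close>

lemma germ_exists:
  assumes "inj f" "finite F" "\<And>y. y \<notin> F \<Longrightarrow> orientation_preserving_at f y" "\<bar>e\<bar> = 1"
  shows "\<exists>w. germ e f x w"
proof (cases "e = 1")
  case True
  then show ?thesis using germ_right_exists[OF assms(1-3)] by simp
next
  case False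
  then have e: "e = -1" using assms(4) by auto
  have "inj (\<lambda>y. - f (- y))" using injD[OF assms(1)] by (fastforce intro!: injI)
  moreover have "orientation_preserving_at (\<lambda>y. - f (- y)) y" if "y \<notin> uminus ` F" for y
    using that assms(3)[of "- y"] by (intro orientation_preserving_at_reflect) force
  ultimately obtain w where "germ 1 (\<lambda>y. - f (- y)) (- x) w"
    using germ_right_exists[of "\<lambda>y. - f (- y)" "uminus ` F" "- x"] assms(2) by auto
  then obtain d g where g: "0 < d" "mono_bij g 0 d" "g 0 = 0"
    "\<And>s. 0 < s \<Longrightarrow> s \<le> d \<Longrightarrow> - f (- (- x + circle_of (1 * s))) = w + circle_of (1 * g s)"
    by (rule germE[of _ _ _ _ 1]) (simp, blast)
  have "germ e f x (- w)"
  proof (rule germI[OF g(1-3)])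
    fix s assume "0 < s" "s \<le> d"
    moreover have "- (- x + circle_of (1 * s)) = x + circle_of (e * s)" by (simp add: e circle_of_minus)
    ultimately have "f (x + circle_of (e * s)) = - (w + circle_of (1 * g s))" using g(4) by (metis minus_minus)
    then show "f (x + circle_of (e * s)) = - w + circle_of (e * g s)" by (simp add: e circle_of_minus)
  qed
  then show ?thesis by blast
qed

section \<open>Cosets of finitely supported permutations\<close>

lemma PC_hat_simps:
  "f \<in> carrier PC_hat \<longleftrightarrow> bij f \<and> (\<exists>F. finite F \<and> (\<forall>x. x \<notin> F \<longrightarrow> isCont f x))"
  "mult PC_hat = (\<circ>)" "one PC_hat = id"
  by (simp_all add: PC_hat_def)

lemma PC_hat_bij: "f \<in> carrier PC_hat \<Longrightarrow> bij f"
  by (simp add: PC_hat_simps)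

lemma id_in_PC_hat: "id \<in> carrier PC_hat"
  by (auto simp: PC_hat_simps)

lemma PC_hat_comp:
  assumes "f \<in> carrier PC_hat" "h \<in> carrier PC_hat"
  shows "h \<circ> f \<in> carrier PC_hat"
proof -
  obtain F E where F: "finite F" "\<And>x. x \<notin> F \<Longrightarrow> isCont f x" and E: "finite E" "\<And>x. x \<notin> E \<Longrightarrow> isCont h x"
    and b: "bij f" "bij h"
    using assms by (auto simp: PC_hat_simps)
  have "isCont (h \<circ> f) x" if "x \<notin> F \<union> f -` E" for x
    using that F(2) E(2) by (auto intro: continuous_at_compose)
  moreover have "finite (F \<union> f -` E)"
    using F E b by (auto intro: finite_vimageI bij_is_inj)
  ultimately show ?thesis using b by (auto simp: PC_hat_simps bij_comp)
qed

lemma PC_hat_cong: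
  assumes "f \<in> carrier PC_hat" "bij h" "finite {y. f y \<noteq> h y}"
  shows "h \<in> carrier PC_hat"
proof -
  obtain F where F: "finite F" "\<And>x. x \<notin> F \<Longrightarrow> isCont f x"
    using assms by (auto simp: PC_hat_simps)
  have "isCont h x" if x: "x \<notin> F \<union> {y. f y \<noteq> h y}" for x
  proof -
    have "open (- {y. f y \<noteq> h y})" using assms by (intro open_Compl finite_imp_closed)
    then have "eventually (\<lambda>y. y \<in> - {y. f y \<noteq> h y}) (nhds x)"
      using x by (intro eventually_nhds_in_open) auto
    then have "eventually (\<lambda>y. f y = h y) (nhds x)" by simp
    then have "isCont f x \<longleftrightarrow> isCont h x" by (rule isCont_cong)
    then show ?thesis using F(2)[of x] x by simp
  qed
  then show ?thesis using F(1) assms by (auto simp: PC_hat_simps intro!: exI[of _ "F \<union> {y. f y \<noteq> h y}"])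
qed

text \<open>The inverse in the record is a definite description, so closure under inversion is
  needed before it can be evaluated. That closure comes later from germs
  (\<open>regular_inverse_PC_hat\<close>), hence the second hypothesis.\<close>

lemma PC_hat_inv:
  assumes "f \<in> carrier PC_hat" "finv f \<in> carrier PC_hat"
  shows "inv\<^bsub>PC_hat\<^esub> f = finv f"
  unfolding m_inv_def
proof (rule the_equality)
  have b: "bij f" using assms by (simp add: PC_hat_simps)
  then show "finv f \<in> carrier PC_hat \<and> f \<otimes>\<^bsub>PC_hat\<^esub> finv f = \<one>\<^bsub>PC_hat\<^esub> \<and> finv f \<otimes>\<^bsub>PC_hat\<^esub> f = \<one>\<^bsub>PC_hat\<^esub>"
    using assms surj_iff[of f] inv_o_cancel[of f] by (auto simp: PC_hat_simps(2,3) bij_def)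
  fix h assume "h \<in> carrier PC_hat \<and> f \<otimes>\<^bsub>PC_hat\<^esub> h = \<one>\<^bsub>PC_hat\<^esub> \<and> h \<otimes>\<^bsub>PC_hat\<^esub> f = \<one>\<^bsub>PC_hat\<^esub>"
  then show "h = finv f" by (auto simp: PC_hat_simps(2,3) intro!: inv_unique_comp[symmetric])
qed

lemma finite_support_comp:
  assumes "finite {x. f x \<noteq> g x}" "finite {x. h x \<noteq> k x}" "inj f"
  shows "finite {x. h (f x) \<noteq> k (g x)}"
proof (rule finite_subset)
  show "{x. h (f x) \<noteq> k (g x)} \<subseteq> {x. f x \<noteq> g x} \<union> f -` {x. h x \<noteq> k x}" by auto
  show "finite ({x. f x \<noteq> g x} \<union> f -` {x. h x \<noteq> k x})"
    using assms finite_vimageI[of "{x. h x \<noteq> k x}" f] by simp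
qed

lemma finite_support_inv:
  assumes "finite {x. f x \<noteq> g x}" "bij f" "bij g"
  shows "finite {x. finv f x \<noteq> finv g x}"
proof (rule finite_subset)
  show "{x. finv f x \<noteq> finv g x} \<subseteq> f ` {x. f x \<noteq> g x}"
  proof
    fix x assume "x \<in> {x. finv f x \<noteq> finv g x}"
    then have ne: "finv f x \<noteq> finv g x" by simp
    have "f (finv f x) = x" using assms(2) by (simp add: bij_is_surj surj_f_inv_f)
    moreover have "g (finv f x) \<noteq> x" using ne inv_f_f[OF bij_is_inj[OF assms(3)], of "finv f x"] by auto
    ultimately have "f (finv f x) = x" "f (finv f x) \<noteq> g (finv f x)" by auto
    then show "x \<in> f ` {x. f x \<noteq> g x}" by (metis (mono_tags, lifting) image_eqI mem_Collect_eq)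
  qed
qed (use assms in auto)

lemma finite_support_trans:
  "finite {x. f x \<noteq> g x} \<Longrightarrow> finite {x. g x \<noteq> h x} \<Longrightarrow> finite {x. f x \<noteq> h x}"
  by (rule finite_subset[of _ "{x. f x \<noteq> g x} \<union> {x. g x \<noteq> h x}"]) auto

lemma finite_support_sym:
  "finite {x. f x \<noteq> g x} \<Longrightarrow> finite {x. g x \<noteq> f x}"
  by (simp add: eq_commute)

lemma PC_proj_eq:
  assumes "bij f"
  shows "PC_proj f = {h. bij h \<and> finite {x. f x \<noteq> h x}}"
proof (intro equalityI subsetI)
  fix h assume "h \<in> PC_proj f"
  then obtain \<sigma> where s: "bij \<sigma>" "finite {x. \<sigma> x \<noteq> x}" "h = \<sigma> \<circ> f"
    by (auto simp: PC_proj_def r_coset_def Sym_fin_def PC_hat_simps(2))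
  have "{x. f x \<noteq> h x} = f -` {x. \<sigma> x \<noteq> x}" using s by auto
  then show "h \<in> {h. bij h \<and> finite {x. f x \<noteq> h x}}"
    using s assms finite_vimageI[OF s(2) bij_is_inj[OF assms]] by (simp add: bij_comp)
next
  fix h assume h: "h \<in> {h. bij h \<and> finite {x. f x \<noteq> h x}}"
  define \<sigma> where "\<sigma> = h \<circ> finv f"
  have "h = \<sigma> \<circ> f" using assms by (auto simp: \<sigma>_def fun_eq_iff bij_is_inj)
  moreover have "bij \<sigma>" using h assms by (auto simp: \<sigma>_def bij_comp bij_imp_bij_inv)
  moreover have "{x. \<sigma> x \<noteq> x} \<subseteq> f ` {x. f x \<noteq> h x}"
  proof
    fix x assume "x \<in> {x. \<sigma> x \<noteq> x}"
    then have "f (finv f x) = x" "h (finv f x) \<noteq> x"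
      using assms by (auto simp: \<sigma>_def bij_is_surj surj_f_inv_f)
    then show "x \<in> f ` {x. f x \<noteq> h x}" by (metis (mono_tags, lifting) image_eqI mem_Collect_eq)
  qed
  then have "finite {x. \<sigma> x \<noteq> x}" using h finite_subset by blast
  ultimately show "h \<in> PC_proj f"
    by (auto simp: PC_proj_def r_coset_def Sym_fin_def PC_hat_simps(2))
qed

lemma PC_proj_eq_iff:
  assumes "bij f" "bij h"
  shows "PC_proj f = PC_proj h \<longleftrightarrow> finite {x. f x \<noteq> h x}"
proof
  assume *: "PC_proj f = PC_proj h"
  have "h \<in> PC_proj h" using assms by (simp add: PC_proj_eq)
  then have "h \<in> PC_proj f" by (simp only: *)
  then show "finite {x. f x \<noteq> h x}" using assms by (simp add: PC_proj_eq)
next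
  assume fin: "finite {x. f x \<noteq> h x}"
  have "finite {x. f x \<noteq> k x} \<longleftrightarrow> finite {x. h x \<noteq> k x}" for k
    by (rule iffI, erule finite_support_trans[OF finite_support_sym[OF fin]], erule finite_support_trans[OF fin])
  then show "PC_proj f = PC_proj h"
    using assms by (simp add: PC_proj_eq)
qed

section \<open>The quotient group in terms of representatives\<close>

lemma carrier_PC: "carrier PC = PC_proj ` carrier PC_hat"
  by (auto simp: PC_def FactGroup_def RCOSETS_def PC_proj_def)

lemma PC_one: "\<one>\<^bsub>PC\<^esub> = PC_proj id"
proof -
  have "{x. id x \<noteq> h x} = {x. h x \<noteq> x}" for h :: "circle \<Rightarrow> circle" by auto
  then show ?thesis by (simp add: PC_def FactGroup_def PC_proj_eq Sym_fin_def)
qed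

lemma PC_mult:
  assumes "bij f" "bij h"
  shows "PC_proj f \<otimes>\<^bsub>PC\<^esub> PC_proj h = PC_proj (f \<circ> h)"
proof (intro equalityI subsetI)
  fix k assume "k \<in> PC_proj f \<otimes>\<^bsub>PC\<^esub> PC_proj h"
  then obtain f' h' where "f' \<in> PC_proj f" "h' \<in> PC_proj h" "k = f' \<circ> h'"
    by (auto simp: PC_def FactGroup_def set_mult_def PC_hat_simps(2))
  then show "k \<in> PC_proj (f \<circ> h)" using assms finite_support_comp[of h h' f f']
    by (auto simp: PC_proj_eq bij_comp bij_is_inj)
next
  fix k assume k: "k \<in> PC_proj (f \<circ> h)"
  then have k': "bij k" "finite {x. f (h x) \<noteq> k x}" using assms by (auto simp: PC_proj_eq bij_comp)
  have "finite {x. h x \<noteq> (finv f \<circ> k) x}"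
    using finite_support_comp[OF k'(2), of "finv f" "finv f"] assms bij_comp[OF assms(2,1)]
    by (auto simp: bij_is_inj o_def)
  moreover have "bij (finv f \<circ> k)" using assms k' by (simp add: bij_comp bij_imp_bij_inv)
  ultimately have "finv f \<circ> k \<in> PC_proj h" using assms by (simp add: PC_proj_eq)
  moreover have "f \<in> PC_proj f" using assms by (simp add: PC_proj_eq)
  moreover have "k = f \<circ> (finv f \<circ> k)"
    using assms by (auto simp: fun_eq_iff bij_is_surj surj_f_inv_f)
  ultimately show "k \<in> PC_proj f \<otimes>\<^bsub>PC\<^esub> PC_proj h"
    by (auto simp: PC_def FactGroup_def set_mult_def PC_hat_simps(2))
qed

lemma PC_inv:
  assumes "f \<in> carrier PC_hat" "finv f \<in> carrier PC_hat"
  shows "inv\<^bsub>PC\<^esub> (PC_proj f) = PC_proj (finv f)"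
  unfolding m_inv_def
proof (rule the_equality)
  have b: "bij f" "bij (finv f)" using assms by (auto simp: PC_hat_simps)
  have c: "f \<circ> finv f = id" "finv f \<circ> f = id"
    using bij_is_surj[OF b(1)] inv_o_cancel[OF bij_is_inj[OF b(1)]] by (simp_all add: surj_iff)
  then show "PC_proj (finv f) \<in> carrier PC \<and> PC_proj f \<otimes>\<^bsub>PC\<^esub> PC_proj (finv f) = \<one>\<^bsub>PC\<^esub> \<and>
      PC_proj (finv f) \<otimes>\<^bsub>PC\<^esub> PC_proj f = \<one>\<^bsub>PC\<^esub>"
    using assms b c by (simp add: carrier_PC PC_mult PC_one)
  fix y assume y: "y \<in> carrier PC \<and> PC_proj f \<otimes>\<^bsub>PC\<^esub> y = \<one>\<^bsub>PC\<^esub> \<and> y \<otimes>\<^bsub>PC\<^esub> PC_proj f = \<one>\<^bsub>PC\<^esub>"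
  then obtain h where h: "y = PC_proj h" "bij h" by (auto simp: carrier_PC PC_hat_simps)
  then have "PC_proj (f \<circ> h) = PC_proj id"
    using y PC_mult[OF b(1) h(2)] PC_one by metis
  then have "finite {x. (f \<circ> h) x \<noteq> id x}"
    using PC_proj_eq_iff[OF bij_comp[OF h(2) b(1)] bij_id] by blast
  then have "finite {x. finv f ((f \<circ> h) x) \<noteq> finv f (id x)}"
    using b h by (intro finite_support_comp[of "f \<circ> h" id "finv f" "finv f"]) (simp_all add: bij_is_inj bij_comp)
  then have "finite {x. h x \<noteq> finv f x}" using inv_f_f[OF bij_is_inj[OF b(1)]] by simp
  then show "y = PC_proj (finv f)" using PC_proj_eq_iff[OF h(2) b(2)] h(1) by simp
qed

section \<open>One-sided arcs\<close>

definition sarc :: "real \<Rightarrow> circle \<Rightarrow> real \<Rightarrow> circle set" where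
  "sarc e x L = (\<lambda>s. x + circle_of (e * s)) ` {0<..<L}"

lemma sarc_memI: "0 < s \<Longrightarrow> s < L \<Longrightarrow> x + circle_of (e * s) \<in> sarc e x L"
  by (auto simp: sarc_def)

lemma sarc_left_eq: "sarc (-1) x L = sarc 1 (x - circle_of L) L"
proof (intro equalityI subsetI)
  fix y assume "y \<in> sarc (-1) x L"
  then obtain s where s: "0 < s" "s < L" "y = x + circle_of (-1 * s)" by (auto simp: sarc_def)
  then have "y = (x - circle_of L) + circle_of (1 * (L - s))"
    by (simp add: circle_of_minus circle_of_diff)
  then show "y \<in> sarc 1 (x - circle_of L) L" by (rule ssubst) (rule sarc_memI, use s in auto)
next
  fix y assume "y \<in> sarc 1 (x - circle_of L) L"
  then obtain s where s: "0 < s" "s < L" "y = (x - circle_of L) + circle_of (1 * s)" by (auto simp: sarc_def)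
  then have "y = x + circle_of (-1 * (L - s))"
    by (simp add: circle_of_minus circle_of_diff)
  then show "y \<in> sarc (-1) x L" by (rule ssubst) (rule sarc_memI, use s in auto)
qed

lemma sarc_split:
  assumes "0 < a" "0 < b"
  shows "sarc 1 (x - circle_of a) (a + b) = sarc (-1) x a \<union> {x} \<union> sarc 1 x b"
proof (intro equalityI subsetI)
  fix y assume "y \<in> sarc 1 (x - circle_of a) (a + b)"
  then obtain s where s: "0 < s" "s < a + b" "y = (x - circle_of a) + circle_of (1 * s)" by (auto simp: sarc_def)
  consider "s < a" | "s = a" | "s > a" by linarith
  then show "y \<in> sarc (-1) x a \<union> {x} \<union> sarc 1 x b"
  proof cases
    case 1
    then have "y = x + circle_of (-1 * (a - s))" using s by (simp add: circle_of_minus circle_of_diff)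
    moreover have "x + circle_of (-1 * (a - s)) \<in> sarc (-1) x a" by (rule sarc_memI) (use 1 s in auto)
    ultimately show ?thesis by (metis Un_iff)
  next
    case 3
    then have "y = x + circle_of (1 * (s - a))" using s by (simp add: circle_of_diff)
    moreover have "x + circle_of (1 * (s - a)) \<in> sarc 1 x b" by (rule sarc_memI) (use 3 s in auto)
    ultimately show ?thesis by (metis Un_iff)
  qed (use s in simp)
next
  fix y assume "y \<in> sarc (-1) x a \<union> {x} \<union> sarc 1 x b"
  then consider s where "0 < s" "s < a" "y = x + circle_of (-1 * s)" | "y = x" |
    s where "0 < s" "s < b" "y = x + circle_of (1 * s)" by (auto simp: sarc_def)
  then obtain s where "0 < s" "s < a + b" "y = (x - circle_of a) + circle_of (1 * s)"
  proof cases
    case 1 then show ?thesis using that[of "a - s"] assms by (simp add: circle_of_minus circle_of_diff)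
  next
    case 2 then show ?thesis using that[of a] assms by simp
  next
    case 3 then show ?thesis using that[of "a + s"] assms by (simp add: circle_of_add)
  qed
  then show "y \<in> sarc 1 (x - circle_of a) (a + b)" by (metis sarc_memI)
qed

text \<open>In this window \<open>t\<close> is less than a full turn away from every number between
  0 and \<open>L\<close>, so no other representative of \<open>circle_of t\<close> can fall into the
  arc.\<close>

lemma sarc_mem_iff:
  assumes "L - 1 \<le> t" "t \<le> 1"
  shows "x + circle_of t \<in> sarc 1 x L \<longleftrightarrow> 0 < t \<and> t < L"
proof
  assume "x + circle_of t \<in> sarc 1 x L"
  then obtain s where s: "0 < s" "s < L" "circle_of t = circle_of s" by (auto simp: sarc_def)
  then have "t = s" using assms by (intro circle_of_eq_close) auto
  then show "0 < t \<and> t < L" using s by simp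
qed (use sarc_memI[of t L x 1] in simp)

lemma sarc_translate: "(\<lambda>y. y + c) ` sarc e x L = sarc e (x + c) L"
  by (simp add: sarc_def image_image algebra_simps)

lemma germ_sarc_image:
  assumes "mono_bij g 0 d" "g 0 = 0" "L \<le> d" "0 < L"
    "\<And>s. 0 < s \<Longrightarrow> s \<le> d \<Longrightarrow> k (x + circle_of (e * s)) = w + circle_of (e * g s)"
  shows "k ` sarc e x L = sarc e w (g L)"
proof (intro equalityI subsetI)
  fix y assume "y \<in> k ` sarc e x L"
  then obtain s where s: "0 < s" "s < L" "y = k (x + circle_of (e * s))" by (auto simp: sarc_def)
  then have "y = w + circle_of (e * g s)" using assms(3,5) by auto
  moreover have "0 < g s" "g s < g L"
    using mono_bij_less[OF assms(1), of 0 s] mono_bij_less[OF assms(1), of s L] assms s by auto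
  ultimately show "y \<in> sarc e w (g L)" using sarc_memI by simp
next
  fix y assume "y \<in> sarc e w (g L)"
  then obtain v where v: "0 < v" "v < g L" "y = w + circle_of (e * v)" by (auto simp: sarc_def)
  have gL: "mono_bij g 0 L" using mono_bij_subinterval[OF assms(1), of 0 L] assms by simp
  obtain s where s: "0 \<le> s" "s \<le> L" "g s = v" using mono_bij_surj[OF gL, of v] v assms by auto
  have "s \<noteq> 0" "s \<noteq> L" using s v assms by auto
  then have s': "0 < s" "s < L" using s by auto
  have "y = k (x + circle_of (e * s))" using assms(5)[of s] assms(3) s s' v by simp
  then show "y \<in> k ` sarc e x L" using sarc_memI[OF s', of x e] by (rule image_eqI)
qed

text \<open>Values of lifts will be identified by confining them at every scale \<open>c\<close>.
  The decisive scale is the distance \<open>min d (1 - d)\<close> between \<open>y\<close> and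
  \<open>w\<close>.\<close>

lemma circle_limit:
  assumes "\<And>c. 0 < c \<Longrightarrow> \<exists>s. \<bar>s\<bar> < c \<and> y = w + circle_of s"
  shows "y = w"
proof -
  obtain d where d: "0 \<le> d" "d < 1" "y = w + circle_of d" by (rule circle_of_rep[of y w]) blast
  show ?thesis
  proof (cases "d = 0")
    case False
    then obtain s where s: "\<bar>s\<bar> < min d (1 - d)" "y = w + circle_of s"
      using assms[of "min d (1 - d)"] d by auto
    then have "circle_of s = circle_of d" using d(3) by simp
    then have "s = d" using s d by (intro circle_of_eq_close) auto
    then show ?thesis using s by auto
  qed (use d in \<open>simp add: circle_of_0\<close>)
qed

text \<open>The first case uses translates that contain \<open>p\<close> but not \<open>q\<close>,
  the second those that contain \<open>q\<close> but not \<open>p\<close>; there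
  \<open>q \<le> 2 * L\<close>, and \<open>3 * L < 1\<close> leaves room on the right. A whole
  interval of \<open>u\<close> is found, so that a dense set of rotations minus a finite set still
  meets it.\<close>

lemma exactly_one_in_translate:
  fixes L p q :: real
  assumes "0 < L" "3 * L < 1" "L < p" "p < q" "q \<le> 1"
  shows "\<exists>a b. a < b \<and> (\<forall>u. a < u \<and> u < b \<longrightarrow> L < u \<and> u < 1 - L \<and>
    ((u < p \<and> p < u + L) \<noteq> (u < q \<and> q < u + L)))"
proof (cases "2 * L < q")
  case True
  then show ?thesis using assms
    by (intro exI[of _ "max (p - L) L"] exI[of _ "min (q - L) p"]) auto
next
  case False
  then show ?thesis using assms
    by (intro exI[of _ "max p (q - L)"] exI[of _ "min q (1 - L)"]) auto
qed

section \<open>Groups of permutations containing the rotations by a dense subgroup\<close>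

text \<open>Because \<open>f\<close> moves \<open>f y\<close> exactly when it moves
  \<open>y\<close>, and likewise for \<open>g\<close>, a failure to commute at \<open>y\<close>
  forces one of \<open>y\<close>, \<open>f y\<close>, \<open>g y\<close> into both supports.\<close>

lemma commute_almost_disjoint:
  assumes "bij f" "bij g" "finite {y. f y \<noteq> y \<and> g y \<noteq> y}"
  shows "finite {y. f (g y) \<noteq> g (f y)}"
proof (rule finite_subset)
  let ?B = "{y. f y \<noteq> y \<and> g y \<noteq> y}"
  show "{y. f (g y) \<noteq> g (f y)} \<subseteq> ?B \<union> f -` ?B \<union> g -` ?B"
  proof
    fix y assume "y \<in> {y. f (g y) \<noteq> g (f y)}"
    moreover have "f (f y) = f y \<longleftrightarrow> f y = y" "g (g y) = g y \<longleftrightarrow> g y = y"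
      using assms(1,2) by (auto simp: bij_is_inj inj_eq)
    ultimately show "y \<in> ?B \<union> f -` ?B \<union> g -` ?B" by (cases "f y = y"; cases "g y = y") auto
  qed
  show "finite (?B \<union> f -` ?B \<union> g -` ?B)"
    using assms finite_vimageI[OF assms(3) bij_is_inj[OF assms(1)]]
      finite_vimageI[OF assms(3) bij_is_inj[OF assms(2)]] by blast
qed

text \<open>Allowing a finite error makes the property depend only on the class of
  \<open>f\<close>.\<close>

definition supp_on :: "(circle \<Rightarrow> circle) \<Rightarrow> circle set \<Rightarrow> bool" where
  "supp_on f A \<longleftrightarrow> finite {y. (f y \<noteq> y) \<noteq> (y \<in> A)}"

lemma supp_on_conj:
  assumes "supp_on q A" "bij k"
  shows "supp_on (k \<circ> q \<circ> finv k) (k ` A)"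
proof -
  have "{y. ((k \<circ> q \<circ> finv k) y \<noteq> y) \<noteq> (y \<in> k ` A)} \<subseteq> k ` {y. (q y \<noteq> y) \<noteq> (y \<in> A)}"
  proof
    fix y assume y: "y \<in> {y. ((k \<circ> q \<circ> finv k) y \<noteq> y) \<noteq> (y \<in> k ` A)}"
    define z where "z = finv k y"
    have kz: "y = k z" using assms(2) by (simp add: z_def bij_is_surj surj_f_inv_f)
    have "finv k (k z) = z" using assms(2) by (simp add: bij_is_inj)
    moreover have "k (q z) = k z \<longleftrightarrow> q z = z" "k z \<in> k ` A \<longleftrightarrow> z \<in> A"
      using bij_is_inj[OF assms(2)] by (simp_all add: inj_eq inj_image_mem_iff)
    ultimately have "(q z \<noteq> z) \<noteq> (z \<in> A)" using y by (simp add: kz)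
    then show "y \<in> k ` {y. (q y \<noteq> y) \<noteq> (y \<in> A)}" using kz by blast
  qed
  then show ?thesis using assms(1) unfolding supp_on_def by (meson finite_imageI finite_subset)
qed

lemma supp_on_cong:
  assumes "supp_on f A" "finite {y. (y \<in> A) \<noteq> (y \<in> B)}"
  shows "supp_on f B"
  unfolding supp_on_def
  by (rule finite_subset[OF _ finite_UnI[OF assms[unfolded supp_on_def]]]) blast

lemma subgroup_int_multiple:
  assumes "0 \<in> L" "\<And>a b. a \<in> L \<Longrightarrow> b \<in> L \<Longrightarrow> a + b \<in> L" "\<And>a. a \<in> L \<Longrightarrow> - a \<in> L" "circle_of p \<in> L"
  shows "circle_of (of_int m * p) \<in> L"
proof (induction m rule: int_induct[of _ 0])
  case base then show ?case using assms by (simp add: circle_of_0)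
next
  case (step1 i)
  then show ?case using assms(2)[of "circle_of (of_int i * p)" "circle_of p"] assms(4)
    by (simp add: distrib_right circle_of_add)
next
  case (step2 i)
  then show ?case using assms(2)[of "circle_of (of_int i * p)" "- circle_of p"] assms(3,4)
    by (simp add: left_diff_distrib circle_of_diff)
qed

text \<open>Equivalently, 1, \<open>p\<close> and \<open>q\<close> are linearly independent over the
  rationals; the classes of \<open>p\<close> and \<open>q\<close> then generate a copy of Z^2 in the
  circle.\<close>

definition independent_mod_1 :: "real \<Rightarrow> real \<Rightarrow> bool" where
  "independent_mod_1 p q \<longleftrightarrow> (\<forall>m n. of_int m * p + of_int n * q \<in> \<int> \<longrightarrow> m = 0 \<and> n = (0::int))"

text \<open>\<open>H_eqI\<close> is injectivity of the projection. \<open>L\<close> plays two parts: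
  its rotations have lifts in \<open>H\<close>, and outside \<open>L\<close> the one-sided limits of
  every element agree. When all rotations are available, \<open>L\<close> is the whole circle and
  \<open>H_cont\<close> is vacuous.\<close>

locale permutation_lift =
  fixes H :: "(circle \<Rightarrow> circle) set" and L :: "circle set"
  assumes H_bij: "f \<in> H \<Longrightarrow> bij f"
    and H_comp: "f \<in> H \<Longrightarrow> g \<in> H \<Longrightarrow> f \<circ> g \<in> H"
    and H_inv: "f \<in> H \<Longrightarrow> finv f \<in> H"
    and H_eqI: "f \<in> H \<Longrightarrow> g \<in> H \<Longrightarrow> finite {x. f x \<noteq> g x} \<Longrightarrow> f = g"
    and H_germ: "f \<in> H \<Longrightarrow> \<bar>e\<bar> = 1 \<Longrightarrow> \<exists>w. germ e f x w"
    and H_cont: "f \<in> H \<Longrightarrow> x \<notin> L \<Longrightarrow> germ 1 f x w \<Longrightarrow> germ (-1) f x w' \<Longrightarrow> w = w'"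
    and H_rot: "a \<in> L \<Longrightarrow> \<exists>f\<in>H. finite {x. f x \<noteq> x + a}"
    and L_add: "a \<in> L \<Longrightarrow> b \<in> L \<Longrightarrow> a + b \<in> L"
    and L_minus: "a \<in> L \<Longrightarrow> - a \<in> L"
    and L_indep: "\<exists>p q. circle_of p \<in> L \<and> circle_of q \<in> L \<and>
      independent_mod_1 p q"
begin

lemma L_0: "0 \<in> L"
  using L_indep L_add L_minus by (metis add.right_inverse)

lemma L_int_multiple: "circle_of p \<in> L \<Longrightarrow> circle_of (of_int m * p) \<in> L"
  by (rule subgroup_int_multiple[OF L_0 L_add L_minus])

text \<open>Dirichlet approximation puts a multiple of \<open>p\<close> close to an integer, and
  independence keeps the difference from vanishing.\<close>

lemma L_small: "0 < c \<Longrightarrow> \<exists>l. 0 < l \<and> l < c \<and> circle_of l \<in> L"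
proof -
  assume c: "0 < c"
  obtain p q where p: "circle_of p \<in> L" "\<And>m n. of_int m * p + of_int n * q \<in> \<int> \<Longrightarrow> m = 0 \<and> n = (0::int)"
    using L_indep unfolding independent_mod_1_def by blast
  obtain N where N: "N > 0" "inverse (real N) < c" using reals_Archimedean[OF c] by (metis zero_less_Suc)
  obtain h k where k: "0 < k" "k \<le> int N" "\<bar>of_int k * p - of_int h\<bar> < 1 / real N"
    using N Dirichlet_approx by blast
  have ne: "of_int k * p - of_int h \<noteq> 0"
  proof
    assume "of_int k * p - of_int h = 0"
    then have "of_int k * p + of_int 0 * q \<in> \<int>" by simp
    then show False using p(2) k(1) by blast
  qed
  have m: "circle_of (of_int k * p - of_int h) \<in> L"
    using L_int_multiple[OF p(1), of k] circle_of_Ints[of "of_int h"] by (simp add: circle_of_diff)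
  then have "circle_of \<bar>of_int k * p - of_int h\<bar> \<in> L"
    using L_minus[OF m] by (auto simp: abs_if circle_of_minus[symmetric])
  then show ?thesis using ne k N by (intro exI[of _ "\<bar>of_int k * p - of_int h\<bar>"]) (auto simp: divide_inverse)
qed

lemma L_dense:
  assumes "a < b" "finite E"
  shows "\<exists>u. a < u \<and> u < b \<and> circle_of u \<in> L \<and> u \<notin> E"
proof -
  have "\<not> {a<..<b} \<subseteq> E" using assms infinite_Ioo finite_subset by blast
  then obtain c where c: "a < c" "c < b" "c \<notin> E" by (auto simp: subset_iff)
  have "open ({a<..<b} - E)" using assms by (intro open_Diff finite_imp_closed) auto
  then obtain d where d: "0 < d" "\<And>u. \<bar>u - c\<bar> < d \<Longrightarrow> u \<in> {a<..<b} - E"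
    using c unfolding open_dist dist_real_def by (metis DiffI greaterThanLessThan_iff)
  obtain l where l: "0 < l" "l < d" "circle_of l \<in> L" using L_small[OF d(1)] by blast
  define u where "u = of_int \<lfloor>c / l\<rfloor> * l"
  have "u \<le> (c / l) * l" "(c / l) * l < (of_int \<lfloor>c / l\<rfloor> + 1) * l"
    unfolding u_def using l(1) by (intro mult_right_mono mult_strict_right_mono; linarith)+
  then have "u \<le> c" "c < u + l" using l(1) by (simp_all add: u_def distrib_right)
  then have "u \<in> {a<..<b} - E" using l by (intro d(2)) auto
  moreover have "circle_of u \<in> L" unfolding u_def by (rule L_int_multiple[OF l(3)])
  ultimately show ?thesis by auto
qed

text \<open>The image arc issues from the one-sided limit \<open>w\<close>, whatever value
  \<open>k\<close> takes at \<open>x\<close>, because the open arc leaves out its endpoint. This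
  locates supports before \<open>k x\<close> is known.\<close>

lemma supp_conj_germ:
  assumes "k \<in> H" "\<bar>e\<bar> = 1" "germ e k x w" "0 < c"
  obtains d where "0 < d"
    "\<And>q L. 0 < L \<Longrightarrow> L \<le> d \<Longrightarrow> supp_on q (sarc e x L) \<Longrightarrow> \<exists>M. 0 < M \<and> M < c \<and> supp_on (k \<circ> q \<circ> finv k) (sarc e w M)"
proof -
  have c2: "0 < c / 2" using assms by simp
  obtain d g where g: "0 < d" "d \<le> c/2" "g d \<le> c/2" "mono_bij g 0 d" "g 0 = 0"
    "\<And>s. 0 < s \<Longrightarrow> s \<le> d \<Longrightarrow> k (x + circle_of (e * s)) = w + circle_of (e * g s)"
    using assms(3) c2 by (rule germE) blast
  show ?thesis
  proof (rule that[OF g(1)])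
    fix q M assume M: "0 < M" "M \<le> d" "supp_on q (sarc e x M)"
    have "supp_on (k \<circ> q \<circ> finv k) (sarc e w (g M))"
      using supp_on_conj[OF M(3) H_bij[OF assms(1)]] germ_sarc_image[OF g(4,5) M(2,1) g(6)] by simp
    moreover have "0 < g M" "g M < c"
      using mono_bij_less[OF g(4), of 0 M] mono_bij_le[OF g(4), of M d] M g assms by auto
    ultimately show "\<exists>M. 0 < M \<and> M < c \<and> supp_on (k \<circ> q \<circ> finv k) (sarc e w M)" by blast
  qed
qed

lemma supp_conj_two_sided:
  assumes "k \<in> H" "germ 1 k x w" "germ (-1) k x w" "0 < c"
  obtains d where "0 < d"
    "\<And>q a b. 0 < a \<Longrightarrow> a \<le> d \<Longrightarrow> 0 < b \<Longrightarrow> b \<le> d \<Longrightarrow> supp_on q (sarc 1 (x - circle_of a) (a + b)) \<Longrightarrow>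
      \<exists>a' b'. 0 < a' \<and> a' < c \<and> 0 < b' \<and> b' < c \<and> supp_on (k \<circ> q \<circ> finv k) (sarc 1 (w - circle_of a') (a' + b'))"
proof -
  have c2: "0 < c / 2" using assms by simp
  obtain d g where g: "0 < d" "d \<le> c/2" "g d \<le> c/2" "mono_bij g 0 d" "g 0 = 0"
    "\<And>s. 0 < s \<Longrightarrow> s \<le> d \<Longrightarrow> k (x + circle_of (1 * s)) = w + circle_of (1 * g s)"
    using assms(2) c2 by (rule germE) blast
  obtain d' g' where g': "0 < d'" "d' \<le> c/2" "g' d' \<le> c/2" "mono_bij g' 0 d'" "g' 0 = 0"
    "\<And>s. 0 < s \<Longrightarrow> s \<le> d' \<Longrightarrow> k (x + circle_of (- 1 * s)) = w + circle_of (- 1 * g' s)"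
    using assms(3) c2 by (rule germE) blast
  show ?thesis
  proof (rule that[of "min d d'"])
    fix q a b assume ab: "0 < a" "a \<le> min d d'" "0 < b" "b \<le> min d d'"
      and q: "supp_on q (sarc 1 (x - circle_of a) (a + b))"
    have pos: "0 < g b" "0 < g' a" "g b < c" "g' a < c"
      using mono_bij_less[OF g(4), of 0 b] mono_bij_le[OF g(4), of b d]
        mono_bij_less[OF g'(4), of 0 a] mono_bij_le[OF g'(4), of a d'] ab g g' assms by auto
    have im: "k ` sarc 1 x b = sarc 1 w (g b)" "k ` sarc (-1) x a = sarc (-1) w (g' a)"
      using ab by (intro germ_sarc_image[OF g(4,5) _ _ g(6)] germ_sarc_image[OF g'(4,5) _ _ g'(6)]; simp)+
    have "supp_on (k \<circ> q \<circ> finv k) (k ` sarc 1 (x - circle_of a) (a + b))"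
      by (rule supp_on_conj[OF q H_bij[OF assms(1)]])
    \<comment> \<open>The middle point goes to \<open>k x\<close>, which may differ from
      \<open>w\<close>. The discrepancy of at most two points is absorbed by
      \<open>supp_on\<close>.\<close>
    also have "k ` sarc 1 (x - circle_of a) (a + b) = sarc (-1) w (g' a) \<union> {k x} \<union> sarc 1 w (g b)"
      using ab by (simp add: sarc_split image_Un im del: One_nat_def)
    finally have "supp_on (k \<circ> q \<circ> finv k) (sarc 1 (w - circle_of (g' a)) (g' a + g b))"
    proof (rule supp_on_cong)
      show "finite {y. (y \<in> sarc (- 1) w (g' a) \<union> {k x} \<union> sarc 1 w (g b)) \<noteq>
          (y \<in> sarc 1 (w - circle_of (g' a)) (g' a + g b))}"
        by (rule finite_subset[of _ "{k x, w}"]) (auto simp: sarc_split pos)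
    qed
    then show "\<exists>a' b'. 0 < a' \<and> a' < c \<and> 0 < b' \<and> b' < c \<and> supp_on (k \<circ> q \<circ> finv k) (sarc 1 (w - circle_of a') (a' + b'))"
      using pos by blast
  qed (use g g' in simp)
qed

end

text \<open>This is the situation after conjugation by the permutation of
  \<open>rotations_rigid\<close>. Exact rotations carry arcs to arcs, so elements with small support
  can be moved around the circle by \<open>L\<close>.\<close>

locale rotation_lift = permutation_lift +
  assumes rot_in_H: "a \<in> L \<Longrightarrow> (\<lambda>x. x + a) \<in> H"
begin

lemma rotated_in_H: "f \<in> H \<Longrightarrow> a \<in> L \<Longrightarrow> (\<lambda>y. f (y - a) + a) \<in> H"
  using H_comp[OF rot_in_H[of a] H_comp[of f, OF _ rot_in_H[OF L_minus[of a]]]] by (simp add: o_def)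

lemma rotated_supp_on:
  assumes "supp_on f (sarc e x l)"
  shows "supp_on (\<lambda>y. f (y - a) + a) (sarc e (x + a) l)"
proof -
  have b: "bij (\<lambda>y. y + a)" by (rule bij_betwI[of _ _ _ "\<lambda>y. y - a"]) auto
  have "finv (\<lambda>y. y + a) = (\<lambda>y. y - a)" using b by (intro inv_unique_comp) (auto simp: o_def id_def)
  then show ?thesis using supp_on_conj[OF assms b] by (simp add: sarc_translate o_def)
qed

text \<open>Two elements whose supports are almost disjoint commute. Applied to \<open>f\<close> and a rotated copy
  of \<open>f\<close>, this shows that \<open>f\<close> preserves the support of the copy; varying the rotation
  one can separate \<open>y\<close> from \<open>f y\<close> unless \<open>y\<close> lies in the closed arc.\<close>

lemma supp_subset_closed_arc:
  assumes f: "f \<in> H" "supp_on f (sarc 1 x l)" and l: "0 < l" "3 * l < 1" and y: "f y \<noteq> y"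
  shows "\<exists>s. 0 \<le> s \<and> s \<le> l \<and> y = x + circle_of s"
proof (rule ccontr)
  assume nex: "\<not> ?thesis"
  obtain p where p: "0 \<le> p" "p < 1" "y = x + circle_of p" by (rule circle_of_rep[of y x]) blast
  obtain q' where q': "0 \<le> q'" "q' < 1" "f y = x + circle_of q'" by (rule circle_of_rep[of "f y" x]) blast
  \<comment> \<open>If \<open>f y\<close> lies in the closed arc, its position is replaced by 1.
    Neither position is ever inside a translate \<open>(u, u + l)\<close> with
    \<open>l < u < 1 - l\<close>, so the membership conditions agree and only one inequality lemma
    is needed.\<close>
  define q where "q = (if l < q' then q' else 1)"
  have pl: "l < p" using nex p(1,3) by (metis not_le)
  have "p \<noteq> q'" using p q' y by auto
  then have pq: "p \<noteq> q" "q \<le> 1" "l < q" using p q' l by (auto simp: q_def)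
  define E where "E = {y. (f y \<noteq> y) \<noteq> (y \<in> sarc 1 x l)}"
  have E: "finite E" using f(2) by (simp add: E_def supp_on_def)
  have good: "(u < p \<and> p < u + l) = (u < q \<and> q < u + l)"
    if u: "l < u" "u < 1 - l" "circle_of u \<in> L" "y - circle_of u \<notin> E" "f y - circle_of u \<notin> E" for u
  proof -
    define g where "g = (\<lambda>y. f (y - circle_of u) + circle_of u)"
    have g: "g \<in> H" using rotated_in_H[OF f(1) u(3)] by (simp add: g_def)
    have gne: "g z \<noteq> z \<longleftrightarrow> f (z - circle_of u) \<noteq> z - circle_of u" for z
      by (auto simp: g_def algebra_simps)
    \<comment> \<open>The translated arc starts beyond \<open>l\<close> and ends before a full turn,
      so it is disjoint from the original. The two supports can meet only in exceptional
      points.\<close>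
    have "{z. f z \<noteq> z \<and> g z \<noteq> z} \<subseteq> E \<union> (\<lambda>z. z + circle_of u) ` E"
    proof
      fix z assume z: "z \<in> {z. f z \<noteq> z \<and> g z \<noteq> z}"
      show "z \<in> E \<union> (\<lambda>z. z + circle_of u) ` E"
      proof (rule ccontr)
        assume n: "\<not> ?thesis"
        have "z - circle_of u \<notin> E"
        proof
          assume "z - circle_of u \<in> E"
          then have "(z - circle_of u) + circle_of u \<in> (\<lambda>z. z + circle_of u) ` E" by (rule imageI)
          then show False using n by simp
        qed
        then have "z \<in> sarc 1 x l" "z - circle_of u \<in> sarc 1 x l"
          using z n gne[of z] by (auto simp: E_def)
        then obtain s t where st: "0 < s" "s < l" "z = x + circle_of s" "0 < t" "t < l" "z - circle_of u = x + circle_of t"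
          by (auto simp: sarc_def)
        then have "circle_of s = circle_of (t + u)" by (simp add: circle_of_add algebra_simps)
        then have "s = t + u" using st u by (intro circle_of_eq_close) auto
        then show False using st u by simp
      qed
    qed
    then have "finite {z. f z \<noteq> z \<and> g z \<noteq> z}" using E finite_subset by blast
    then have "finite {y. (f \<circ> g) y \<noteq> (g \<circ> f) y}"
      using commute_almost_disjoint[OF H_bij[OF f(1)] H_bij[OF g]] by simp
    then have comm: "f \<circ> g = g \<circ> f" using H_eqI H_comp f(1) g by blast
    then have "g (f y) = f (g y)" by (metis comp_apply)
    \<comment> \<open>Commuting permutations preserve each other's supports, so apart from
      exceptional points the rotated arc contains both or neither of \<open>y\<close> and
      \<open>f y\<close>.\<close>
    then have "g y \<noteq> y \<longleftrightarrow> g (f y) \<noteq> f y" using H_bij[OF f(1)] by (simp add: bij_is_inj inj_eq)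
    then have "f (y - circle_of u) \<noteq> y - circle_of u \<longleftrightarrow> f (f y - circle_of u) \<noteq> f y - circle_of u"
      by (simp only: gne)
    then have "y - circle_of u \<in> sarc 1 x l \<longleftrightarrow> f y - circle_of u \<in> sarc 1 x l"
      using u(4,5) by (simp add: E_def)
    moreover have "y - circle_of u = x + circle_of (p - u)" "f y - circle_of u = x + circle_of (q' - u)"
      using p q' by (simp_all add: circle_of_diff)
    moreover have "x + circle_of (p - u) \<in> sarc 1 x l \<longleftrightarrow> 0 < p - u \<and> p - u < l"
      "x + circle_of (q' - u) \<in> sarc 1 x l \<longleftrightarrow> 0 < q' - u \<and> q' - u < l"
      using p q' u l by (intro sarc_mem_iff; simp)+
    ultimately have "(0 < p - u \<and> p - u < l) = (0 < q' - u \<and> q' - u < l)" by metis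
    then show ?thesis using u l q' by (auto simp: q_def)
  qed
  have "\<exists>a b. a < b \<and> (\<forall>u. a < u \<and> u < b \<longrightarrow> l < u \<and> u < 1 - l \<and>
    ((u < p \<and> p < u + l) \<noteq> (u < q \<and> q < u + l)))"
  proof (cases "p < q")
    case True
    then show ?thesis using exactly_one_in_translate[OF l pl] pq by blast
  next
    case False
    then show ?thesis using exactly_one_in_translate[OF l pq(3), of p] p pq by auto
  qed
  then obtain a b where ab: "a < b" "\<And>u. a < u \<Longrightarrow> u < b \<Longrightarrow> l < u \<and> u < 1 - l \<and>
    ((u < p \<and> p < u + l) \<noteq> (u < q \<and> q < u + l))" by blast
  \<comment> \<open>Only finitely many rotations place a given point at an exception of
    \<open>supp_on\<close>, so density still offers an admissible \<open>u\<close>.\<close>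
  have fin: "finite {u. 0 < u \<and> u < 1 \<and> z - circle_of u \<in> E}" for z
  proof (rule finite_imageD)
    show "finite ((\<lambda>u. z - circle_of u) ` {u. 0 < u \<and> u < 1 \<and> z - circle_of u \<in> E})"
      by (rule finite_subset[OF _ E]) auto
    show "inj_on (\<lambda>u. z - circle_of u) {u. 0 < u \<and> u < 1 \<and> z - circle_of u \<in> E}"
      by (rule inj_onI) (auto intro!: circle_of_eq_close)
  qed
  obtain u where u: "a < u" "u < b" "circle_of u \<in> L"
    "u \<notin> {u. 0 < u \<and> u < 1 \<and> y - circle_of u \<in> E} \<union> {u. 0 < u \<and> u < 1 \<and> f y - circle_of u \<in> E}"
    using L_dense[OF ab(1), of "{u. 0 < u \<and> u < 1 \<and> y - circle_of u \<in> E} \<union> {u. 0 < u \<and> u < 1 \<and> f y - circle_of u \<in> E}"]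
      fin by blast
  have u2: "l < u" "u < 1 - l" using ab(2)[OF u(1,2)] by auto
  then have "0 < u" "u < 1" using l by auto
  then have "y - circle_of u \<notin> E" "f y - circle_of u \<notin> E" using u(4) by auto
  with good[OF u2 u(3)] ab(2)[OF u(1,2)] show False by blast
qed

lemma supp_subset_closed_sarc:
  assumes "f \<in> H" "supp_on f (sarc e x l)" "\<bar>e\<bar> = 1" "0 < l" "3 * l < 1" "f y \<noteq> y"
  shows "\<exists>s. 0 \<le> s \<and> s \<le> l \<and> y = x + circle_of (e * s)"
proof (cases "e = 1")
  case True
  then show ?thesis using supp_subset_closed_arc[of f x l y] assms by simp
next
  case False
  then have e: "e = -1" using assms(3) by auto
  then obtain s where s: "0 \<le> s" "s \<le> l" "y = x - circle_of l + circle_of s"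
    using supp_subset_closed_arc[of f "x - circle_of l" l y] assms by (auto simp: sarc_left_eq)
  then show ?thesis by (intro exI[of _ "l - s"]) (simp add: e circle_of_diff)
qed

end

section \<open>Interval swaps\<close>

definition crep :: "circle \<Rightarrow> real" where
  "crep x = (THE s. 0 \<le> s \<and> s < 1 \<and> x = circle_of s)"

lemma crep_circle_of: "0 \<le> s \<Longrightarrow> s < 1 \<Longrightarrow> crep (circle_of s) = s"
  unfolding crep_def by (rule the_equality) (auto intro: circle_of_eq_close)

lemma circle_cases:
  obtains s where "0 \<le> s" "s < 1" "x = circle_of s"
  using circle_of_rep[of x 0] by auto

text \<open>If \<open>2 * l < 1\<close>, the discontinuities lie among 0, \<open>l\<close> and
  \<open>2 * l\<close>, all multiples of \<open>l\<close>. Hence the class belongs to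
  \<open>IET_plus_on L\<close> for every subgroup \<open>L\<close> that contains
  \<open>circle_of l\<close>.\<close>

definition swap :: "real \<Rightarrow> circle \<Rightarrow> circle" where
  "swap l x = (if crep x < l then x + circle_of l else if crep x < 2 * l then x - circle_of l else x)"

lemma swap_circle_of:
  assumes "0 \<le> s" "s < 1"
  shows "swap l (circle_of s) = circle_of (if s < l then s + l else if s < 2 * l then s - l else s)"
  using assms by (simp add: swap_def crep_circle_of circle_of_add circle_of_diff)

lemma swap_shifted:
  assumes "0 \<le> s" "s < 1" "0 \<le> a" "0 < l" "a + 2 * l \<le> 1"
  shows "swap l (circle_of s - circle_of a) + circle_of a =
    circle_of (if a \<le> s \<and> s < a + l then s + l else if a + l \<le> s \<and> s < a + 2 * l then s - l else s)"
proof (cases "a \<le> s")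
  case True
  then show ?thesis using assms swap_circle_of[of "s - a" l] by (auto simp: circle_of_add circle_of_diff)
next
  case False
  have "circle_of s - circle_of a = circle_of (s - a + 1)"
    using circle_of_eq_iff[of "s - a" "s - a + 1"] by (simp add: circle_of_diff)
  then show ?thesis using False assms swap_circle_of[of "s - a + 1" l] circle_of_eq_iff[of "s + 1" s]
    by (auto simp: circle_of_add circle_of_diff)
qed

lemma swap_swap:
  assumes "0 < l" "2 * l \<le> 1"
  shows "swap l (swap l x) = x"
proof (cases x rule: circle_cases)
  case (1 s)
  consider "s < l" | "l \<le> s" "s < 2 * l" | "2 * l \<le> s" by linarith
  then show ?thesis
    using 1 assms by cases (simp_all add: swap_circle_of)
qed

lemma swap_bij: "0 < l \<Longrightarrow> 2 * l \<le> 1 \<Longrightarrow> bij (swap l)"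
  by (rule bij_betwI[of _ _ _ "swap l"]) (auto simp: swap_swap)

lemma swap_local_translation:
  assumes "0 < l" "2 * l < 1" "x \<noteq> 0" "x \<noteq> circle_of l" "x \<noteq> circle_of (2 * l)"
  obtains c d where "c \<in> {0, circle_of l, - circle_of l}" "0 < d"
    "\<And>t. \<bar>t\<bar> < d \<Longrightarrow> swap l (x + circle_of t) = x + circle_of t + c"
proof (cases x rule: circle_cases)
  case (1 s)
  have s: "0 < s" "s \<noteq> l" "s \<noteq> 2 * l" using 1 assms by (auto simp: circle_of_0 order_less_le)
  have sw: "swap l (circle_of s + circle_of t) =
      circle_of (if s + t < l then s + t + l else if s + t < 2 * l then s + t - l else s + t)"
    if "0 \<le> s + t" "s + t < 1" for t
    using swap_circle_of[OF that, of l] by (simp only: circle_of_add)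
  consider "s < l" | "l < s" "s < 2 * l" | "2 * l < s" using s by linarith
  then show ?thesis
  proof cases
    case a: 1
    show ?thesis using a 1 s assms
      by (intro that[of "circle_of l" "min s (l - s)"]) (auto simp: sw circle_of_add)
  next
    case a: 2
    show ?thesis using a 1 s assms
      by (intro that[of "- circle_of l" "min (s - l) (2 * l - s)"]) (auto simp: sw circle_of_add circle_of_diff)
  next
    case a: 3
    show ?thesis using a 1 s assms
      by (intro that[of 0 "min (s - 2 * l) (1 - s)"]) (auto simp: sw circle_of_add)
  qed
qed

lemma swap_germ:
  assumes "0 < l" "2 * l < 1" "x \<noteq> 0" "x \<noteq> circle_of l" "x \<noteq> circle_of (2 * l)" "\<bar>e\<bar> = 1"
  shows "germ e (swap l) x (swap l x)"
proof -
  obtain c d where c: "0 < d" "\<And>t. \<bar>t\<bar> < d \<Longrightarrow> swap l (x + circle_of t) = x + circle_of t + c"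
    using swap_local_translation[OF assms(1-5)] by blast
  have x: "swap l x = x + c" using c(2)[of 0] c(1) by (simp add: circle_of_0)
  show ?thesis
  proof (rule germ_translation[of "d/2"])
    fix s assume s: "0 < s" "s \<le> d/2"
    then have "\<bar>e * s\<bar> < d" using assms(6) by (simp add: abs_mult)
    then show "swap l (x + circle_of (e * s)) = swap l x + circle_of (e * s)"
      using c(2) x by (simp add: algebra_simps)
  qed (use c in simp)
qed

lemma swap_supp_on:
  assumes "0 < l" "2 * l < 1" "finite {x. f x \<noteq> swap l x}"
  shows "supp_on f (sarc 1 0 (2 * l))"
  unfolding supp_on_def
proof (rule finite_subset)
  show "{y. (f y \<noteq> y) \<noteq> (y \<in> sarc 1 0 (2 * l))} \<subseteq> {x. f x \<noteq> swap l x} \<union> {0}"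
  proof
    fix y assume y: "y \<in> {y. (f y \<noteq> y) \<noteq> (y \<in> sarc 1 0 (2 * l))}"
    show "y \<in> {x. f x \<noteq> swap l x} \<union> {0}"
    proof (rule ccontr)
      assume n: "\<not> ?thesis"
      obtain s where s: "0 \<le> s" "s < 1" "y = circle_of s" by (rule circle_cases)
      then have s0: "0 < s" using n by (auto simp: circle_of_0 order_less_le)
      have "y \<in> sarc 1 0 (2 * l) \<longleftrightarrow> s < 2 * l"
        using sarc_mem_iff[of "2 * l" s 0] s s0 assms by simp
      moreover have "swap l y \<noteq> y \<longleftrightarrow> s < 2 * l"
      proof -
        have "swap l y = y + circle_of l" if "s < l" using that s swap_circle_of[of s l] by (simp add: circle_of_add)
        moreover have "swap l y = y - circle_of l" if "\<not> s < l" "s < 2 * l"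
          using that s swap_circle_of[of s l] by (simp add: circle_of_diff)
        moreover have "swap l y = y" if "\<not> s < l" "\<not> s < 2 * l"
          using that s swap_circle_of[of s l] by simp
        moreover have "circle_of l \<noteq> 0" using circle_of_eq_close[of l 0] assms by (auto simp: circle_of_0)
        ultimately show ?thesis using assms(1) by (cases "s < l"; cases "s < 2 * l") auto
      qed
      ultimately show False using y n by auto
    qed
  qed
qed (use assms in simp)

text \<open>Cut the interval of length \<open>4 * l\<close> into cells ABCD. The passage to CDAB is
  a product of four swaps of neighbouring cells, through ACBD, ACDB and CADB.\<close>

lemma swap_double:
  assumes "0 < l" "4 * l < 1"
  defines "T \<equiv> \<lambda>a y. swap l (y - circle_of a) + circle_of a"
  shows "swap (2 * l) x = T l (T 0 (T (2 * l) (T l x)))"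
proof (cases x rule: circle_cases)
  case (1 s)
  have T: "T a (circle_of t) = circle_of (if a \<le> t \<and> t < a + l then t + l else if a + l \<le> t \<and> t < a + 2 * l then t - l else t)"
    if "0 \<le> t" "t < 1" "0 \<le> a" "a + 2 * l \<le> 1" for a t
    unfolding T_def by (rule swap_shifted) (use that assms in auto)
  consider "s < l" | "l \<le> s" "s < 2 * l" | "2 * l \<le> s" "s < 3 * l" | "3 * l \<le> s" "s < 4 * l" | "4 * l \<le> s"
    by linarith
  then show ?thesis using 1 assms(1,2) by (cases; simp add: T swap_circle_of) (simp_all add: add.commute)
qed

section \<open>Values of a lift at continuity points and at jumps\<close>

locale swap_lift = rotation_lift +
  assumes H_swap: "0 < l \<Longrightarrow> 2 * l < 1 \<Longrightarrow> circle_of l \<in> L \<Longrightarrow> \<exists>f\<in>H. finite {x. f x \<noteq> swap l x}"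
begin

text \<open>A rotated short swap is arranged to have \<open>x\<close> inside its arc and to move
  \<open>x\<close> itself. Its conjugate by \<open>k\<close> moves \<open>k x\<close> and is
  confined to a closed arc around \<open>w\<close> that shrinks with \<open>c\<close>.\<close>

lemma continuity_point_value:
  assumes k: "k \<in> H" "germ 1 k x w" "germ (-1) k x w"
  shows "k x = w"
proof (rule circle_limit)
  fix c :: real assume c: "0 < c"
  \<comment> \<open>With this bound the arc around \<open>w\<close> has length
    \<open>a' + b' < 1/4\<close>, short enough for \<open>supp_subset_closed_arc\<close>.\<close>
  define c' where "c' = min c (1/8)"
  have c': "0 < c'" "c' \<le> c" "c' \<le> 1/8" using c by (auto simp: c'_def)
  obtain d where d: "0 < d"
    "\<And>q a b. 0 < a \<Longrightarrow> a \<le> d \<Longrightarrow> 0 < b \<Longrightarrow> b \<le> d \<Longrightarrow> supp_on q (sarc 1 (x - circle_of a) (a + b)) \<Longrightarrow>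
      \<exists>a' b'. 0 < a' \<and> a' < c' \<and> 0 < b' \<and> b' < c' \<and> supp_on (k \<circ> q \<circ> finv k) (sarc 1 (w - circle_of a') (a' + b'))"
    using supp_conj_two_sided[OF k c'(1)] by blast
  obtain l where l: "0 < l" "l < min (d/2) (1/2)" "circle_of l \<in> L"
    using L_small[of "min (d/2) (1/2)"] d by auto
  obtain p where p: "p \<in> H" "finite {x. p x \<noteq> swap l x}"
    using H_swap[of l] l by auto
  have sp: "supp_on p (sarc 1 0 (2 * l))" using swap_supp_on p l by simp
  obtain t where t: "x = circle_of t" using circle_of_surj by blast
  define E where "E = {y. (p y \<noteq> y) \<noteq> (y \<in> sarc 1 0 (2 * l))}"
  \<comment> \<open>\<open>t - u\<close> is the position of \<open>x\<close> in the rotated arc. It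
    must avoid the finitely many positions at which the lift \<open>p\<close> may fix a point of the
    arc.\<close>
  have fin: "finite {u. t - 2 * l < u \<and> u < t \<and> circle_of (t - u) \<in> E}"
  proof (rule finite_imageD)
    show "finite ((\<lambda>u. circle_of (t - u)) ` {u. t - 2 * l < u \<and> u < t \<and> circle_of (t - u) \<in> E})"
      by (rule finite_subset[of _ E]) (use sp in \<open>auto simp: E_def supp_on_def\<close>)
    show "inj_on (\<lambda>u. circle_of (t - u)) {u. t - 2 * l < u \<and> u < t \<and> circle_of (t - u) \<in> E}"
    proof (rule inj_onI)
      fix u v assume "u \<in> {u. t - 2 * l < u \<and> u < t \<and> circle_of (t - u) \<in> E}"
        "v \<in> {u. t - 2 * l < u \<and> u < t \<and> circle_of (t - u) \<in> E}" "circle_of (t - u) = circle_of (t - v)"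
      then have "t - u = t - v" using l by (intro circle_of_eq_close) auto
      then show "u = v" by simp
    qed
  qed
  obtain u where u: "t - 2 * l < u" "u < t" "circle_of u \<in> L" "circle_of (t - u) \<notin> E"
    using L_dense[OF _ fin, of "t - 2 * l" t] l by auto
  define a where "a = t - u"
  have a: "0 < a" "a < 2 * l" "circle_of u = x - circle_of a" using u by (auto simp: a_def t circle_of_diff)
  have pa: "p (circle_of a) \<noteq> circle_of a"
    using u(4) sarc_memI[of a "2 * l" 0 1] a by (auto simp: E_def a_def)
  define q where "q = (\<lambda>y. p (y - circle_of u) + circle_of u)"
  have q: "q \<in> H" unfolding q_def by (rule rotated_in_H[OF p(1) u(3)])
  have "supp_on q (sarc 1 (0 + circle_of u) (2 * l))" unfolding q_def by (rule rotated_supp_on[OF sp])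
  then have "supp_on q (sarc 1 (x - circle_of a) (a + (2 * l - a)))" using a by simp
  moreover have "a \<le> d" "2 * l - a \<le> d" "0 < 2 * l - a" using a l by auto
  ultimately obtain a' b' where ab: "0 < a'" "a' < c'" "0 < b'" "b' < c'"
    "supp_on (k \<circ> q \<circ> finv k) (sarc 1 (w - circle_of a') (a' + b'))"
    using d(2)[of a "2 * l - a" q] a(1) by blast
  have kq: "k \<circ> q \<circ> finv k \<in> H" by (intro H_comp H_inv k q)
  have qx: "q x \<noteq> x"
  proof
    assume "q x = x"
    moreover have "q x = p (circle_of a) + (x - circle_of a)" by (simp add: q_def a(3))
    ultimately have "p (circle_of a) + (x - circle_of a) = circle_of a + (x - circle_of a)" by simp
    with pa show False by (simp only: add_right_cancel)
  qed
  have inj: "inj k" using H_bij[OF k(1)] by (rule bij_is_inj)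
  then have "(k \<circ> q \<circ> finv k) (k x) \<noteq> k x" using qx by (simp add: inj_eq)
  then obtain s where s: "0 \<le> s" "s \<le> a' + b'" "k x = w - circle_of a' + circle_of s"
    using supp_subset_closed_arc[OF kq ab(5)] ab c' by auto
  then show "\<exists>s. \<bar>s\<bar> < c \<and> k x = w + circle_of s"
    using ab c' by (intro exI[of _ "s - a'"]) (auto simp: circle_of_diff)
qed

text \<open>Here the two one-sided limits of \<open>k\<close> may differ. \<open>Q\<close> supplies
  elements with ever shorter support issuing from 0 on side \<open>e\<close> that really move 0.
  They can be rotated to \<open>x\<close> because \<open>x\<close> is in \<open>L\<close>, and
  conjugation by \<open>k\<close> confines \<open>k x\<close> to the neighbourhood of the limit on
  that side.\<close>

lemma endpoint_value:
  assumes k: "k \<in> H" "germ e k x w" "\<bar>e\<bar> = 1" and x: "x \<in> L"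
    and Q: "\<And>c. 0 < c \<Longrightarrow> \<exists>l q. 0 < l \<and> l < c \<and> q \<in> H \<and> supp_on q (sarc e 0 l) \<and> q 0 \<noteq> 0"
  shows "k x = w"
proof (rule circle_limit)
  fix c :: real assume c: "0 < c"
  define c' where "c' = min c (1/3)"
  have c': "0 < c'" "c' \<le> c" "c' \<le> 1/3" using c by (auto simp: c'_def)
  obtain d where d: "0 < d"
    "\<And>q L. 0 < L \<Longrightarrow> L \<le> d \<Longrightarrow> supp_on q (sarc e x L) \<Longrightarrow> \<exists>M. 0 < M \<and> M < c' \<and> supp_on (k \<circ> q \<circ> finv k) (sarc e w M)"
    using supp_conj_germ[OF k(1,3,2) c'(1)] by blast
  obtain l p where p: "0 < l" "l < d" "p \<in> H" "supp_on p (sarc e 0 l)" "p 0 \<noteq> 0" using Q[OF d(1)] by blast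
  define q where "q = (\<lambda>y. p (y - x) + x)"
  have q: "q \<in> H" unfolding q_def by (rule rotated_in_H[OF p(3) x])
  have "supp_on q (sarc e x l)" using rotated_supp_on[OF p(4), of x] by (simp add: q_def)
  then obtain M where M: "0 < M" "M < c'" "supp_on (k \<circ> q \<circ> finv k) (sarc e w M)"
    using d(2)[of l q] p by auto
  have kq: "k \<circ> q \<circ> finv k \<in> H" by (intro H_comp H_inv k q)
  have qx: "q x \<noteq> x" using p(5) by (simp add: q_def)
  have inj: "inj k" using H_bij[OF k(1)] by (rule bij_is_inj)
  then have "(k \<circ> q \<circ> finv k) (k x) \<noteq> k x" using qx by (simp add: inj_eq)
  then obtain s where s: "0 \<le> s" "s \<le> M" "k x = w + circle_of (e * s)"
    using supp_subset_closed_sarc[OF kq M(3) k(3) M(1)] M c' by auto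
  then show "\<exists>s. \<bar>s\<bar> < c \<and> k x = w + circle_of s"
    using M c' k(3) by (intro exI[of _ "e * s"]) (auto simp: abs_mult)
qed

lemma swap_lift_off_endpoints:
  assumes "0 < l" "2 * l < 1" "p \<in> H" "finite {x. p x \<noteq> swap l x}" "y \<noteq> 0" "y \<noteq> circle_of l" "y \<noteq> circle_of (2 * l)"
  shows "p y = swap l y"
proof (rule continuity_point_value[of p y])
  show "germ 1 p y (swap l y)" "germ (-1) p y (swap l y)"
    using swap_germ[OF assms(1,2,5-7)] finite_support_sym[OF assms(4)] by (auto intro: germ_cong)
qed fact

text \<open>If a lift of the swap of length \<open>l\<close> fixed both ends of its support, it would fix all multiples
  of \<open>l\<close>; but the swap of length \<open>2 l\<close> is a product of rotated copies of it, and moves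
  the continuity point \<open>l\<close>.\<close>

lemma swap_lift_moves_endpoint:
  assumes l: "0 < l" "4 * l < 1" "circle_of l \<in> L" and p: "p \<in> H" "finite {x. p x \<noteq> swap l x}"
  shows "p 0 \<noteq> 0 \<or> p (circle_of (2 * l)) \<noteq> circle_of (2 * l)"
proof (rule ccontr)
  assume "\<not> ?thesis"
  then have fx: "p 0 = 0" "p (circle_of (2 * l)) = circle_of (2 * l)" by auto
  have ne: "circle_of s \<noteq> circle_of t" if "0 \<le> s" "s < t" "t < 1" for s t
    using circle_of_eq_close[of s t] that by auto
  have off: "p y = swap l y" if "y \<noteq> 0" "y \<noteq> circle_of l" "y \<noteq> circle_of (2 * l)" for y
    using swap_lift_off_endpoints[OF l(1) _ p that] l by simp
  have inj: "inj p" using H_bij[OF p(1)] by (rule bij_is_inj)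
  \<comment> \<open>\<open>swap l\<close> permutes the three exceptional points, so
    \<open>p\<close>, which agrees with it elsewhere, preserves their complement. With two of the
    three fixed, the third is fixed as well.\<close>
  have pl: "p (circle_of l) = circle_of l"
  proof (rule ccontr)
    assume n: "p (circle_of l) \<noteq> circle_of l"
    define z where "z = p (circle_of l)"
    have z: "z \<noteq> 0" "z \<noteq> circle_of (2 * l)" "z \<noteq> circle_of l"
      using n fx injD[OF inj, of "circle_of l" 0] injD[OF inj, of "circle_of l" "circle_of (2 * l)"]
        ne[of 0 l] ne[of l "2 * l"] l by (auto simp: z_def circle_of_0)
    have s0: "swap l 0 = circle_of l" "swap l (circle_of l) = 0" "swap l (circle_of (2 * l)) = circle_of (2 * l)"
      using swap_circle_of[of 0 l] swap_circle_of[of l l] swap_circle_of[of "2 * l" l] l by (simp_all add: circle_of_0)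
    have ss: "swap l (swap l z) = z" using swap_swap l by simp
    have "swap l z \<noteq> 0" "swap l z \<noteq> circle_of l" "swap l z \<noteq> circle_of (2 * l)"
      using ss s0 z by auto
    then have "p (swap l z) = p (circle_of l)" using off ss by (simp add: z_def)
    then have "swap l z = circle_of l" using inj by (simp add: inj_eq)
    then show False using ss s0 z by auto
  qed
  define q where "q a = (\<lambda>y. p (y - circle_of a) + circle_of a)" for a
  define T where "T a = (\<lambda>y. swap l (y - circle_of a) + circle_of a)" for a
  have l2: "circle_of (2 * l) \<in> L" using L_int_multiple[OF l(3), of 2] by simp
  have qH: "q l \<in> H" "q 0 \<in> H" "q (2 * l) \<in> H"
    using rotated_in_H[OF p(1)] l(3) l2 p(1) by (simp_all add: q_def circle_of_0)
  have qT: "finite {x. q a x \<noteq> T a x}" for a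
  proof -
    have "finite ((\<lambda>y. y - circle_of a) -` {x. p x \<noteq> swap l x})"
      by (intro finite_vimageI p(2)) (auto intro: injI)
    moreover have "{x. q a x \<noteq> T a x} = (\<lambda>y. y - circle_of a) -` {x. p x \<noteq> swap l x}"
      by (auto simp: q_def T_def)
    ultimately show ?thesis by simp
  qed
  obtain p2 where p2: "p2 \<in> H" "finite {x. p2 x \<noteq> swap (2 * l) x}"
    using H_swap[of "2 * l"] l l2 by auto
  define P where "P = q l \<circ> (q 0 \<circ> (q (2 * l) \<circ> q l))"
  have PH: "P \<in> H" unfolding P_def by (intro H_comp qH)
  have inj: "inj (q l)" "inj (q (2 * l) \<circ> q l)" "inj (q 0 \<circ> (q (2 * l) \<circ> q l))"
    by (intro bij_is_inj H_bij H_comp qH)+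
  have "finite {x. P x \<noteq> T l (T 0 (T (2 * l) (T l x)))}"
    unfolding P_def o_def
    by (intro finite_support_comp[OF _ qT] qT inj[unfolded o_def])
  then have "finite {x. P x \<noteq> swap (2 * l) x}" using swap_double[OF l(1,2)] by (simp add: T_def)
  then have "P = p2"
    by (intro H_eqI PH p2(1) finite_support_trans[OF _ finite_support_sym[OF p2(2)]])
  \<comment> \<open>The factors \<open>q l\<close> fix \<open>l\<close> because \<open>p\<close>
    fixes 0, and \<open>q 0\<close> does because \<open>p\<close> fixes the midpoint. For
    \<open>q (2 * l)\<close> the point lies off the swapped intervals since
    \<open>4 * l < 1\<close>.\<close>
  moreover have "P (circle_of l) = circle_of l"
  proof -
    have 1: "q l (circle_of l) = circle_of l" using fx by (simp add: q_def)
    have 2: "q 0 (circle_of l) = circle_of l" using pl by (simp add: q_def circle_of_0)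
    have e: "circle_of l - circle_of (2 * l) = circle_of (1 - l)"
    proof -
      have "circle_of (l - 2 * l) = circle_of (1 - l)" by (simp add: circle_of_eq_iff)
      then show ?thesis by (simp only: circle_of_diff[of l "2 * l"])
    qed
    have "p (circle_of (1 - l)) = swap l (circle_of (1 - l))"
      using ne[of 0 "1 - l"] ne[of l "1 - l"] ne[of "2 * l" "1 - l"] l by (intro off) (auto simp: circle_of_0)
    also have "\<dots> = circle_of (1 - l)" using swap_circle_of[of "1 - l" l] l by simp
    finally have p3: "p (circle_of (1 - l)) = circle_of (1 - l)" .
    have "q (2 * l) (circle_of l) = p (circle_of (1 - l)) + circle_of (2 * l)"
      unfolding q_def e ..
    also have "\<dots> = (circle_of l - circle_of (2 * l)) + circle_of (2 * l)"
      unfolding e p3 ..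
    also have "\<dots> = circle_of l" by simp
    finally have 3: "q (2 * l) (circle_of l) = circle_of l" .
    show ?thesis by (simp add: P_def 1 2 3)
  qed
  \<comment> \<open>For the doubled swap \<open>l\<close> is neither an end nor the midpoint, so the
    value of its lift there is forced.\<close>
  moreover have "p2 (circle_of l) = swap (2 * l) (circle_of l)"
    using ne[of 0 l] ne[of l "2 * l"] ne[of l "2 * (2 * l)"] l
    by (intro swap_lift_off_endpoints[OF _ _ p2]) (auto simp: circle_of_0)
  moreover have "swap (2 * l) (circle_of l) = circle_of (3 * l)"
    using swap_circle_of[of l "2 * l"] l by simp
  ultimately show False using ne[of l "3 * l"] l by simp
qed

text \<open>If on both sides all sufficiently short supports issuing from 0 fixed 0, the lift of a
  short swap would fix both ends of its support. The sign found at 0 serves all of \<open>L\<close>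
  by rotation; off \<open>L\<close> the two limits agree and either sign works.\<close>

theorem one_sided_continuous:
  "\<exists>e. \<bar>e\<bar> = 1 \<and> (\<forall>k\<in>H. \<forall>x. germ e k x (k x))"
proof -
  define Q where "Q e \<longleftrightarrow> (\<forall>c>0. \<exists>l q. 0 < l \<and> l < c \<and> q \<in> H \<and> supp_on q (sarc e 0 l) \<and> q 0 \<noteq> 0)" for e
  have "Q 1 \<or> Q (-1)"
  proof (rule ccontr)
    assume "\<not> ?thesis"
    then obtain c1 c2 where c: "0 < c1" "0 < c2"
      "\<And>l q. 0 < l \<Longrightarrow> l < c1 \<Longrightarrow> q \<in> H \<Longrightarrow> supp_on q (sarc 1 0 l) \<Longrightarrow> q 0 = 0"
      "\<And>l q. 0 < l \<Longrightarrow> l < c2 \<Longrightarrow> q \<in> H \<Longrightarrow> supp_on q (sarc (-1) 0 l) \<Longrightarrow> q 0 = 0"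
      unfolding Q_def by metis
    \<comment> \<open>The halves of \<open>c1\<close> and \<open>c2\<close> appear because the
      support has length \<open>2 * l\<close>; \<open>1/4\<close> is the bound required by
      \<open>swap_lift_moves_endpoint\<close>.\<close>
    obtain l where l: "0 < l" "l < min (1/4) (min (c1/2) (c2/2))" "circle_of l \<in> L"
      using L_small[of "min (1/4) (min (c1/2) (c2/2))"] c by auto
    obtain p where p: "p \<in> H" "finite {x. p x \<noteq> swap l x}" using H_swap[of l] l by auto
    have sp: "supp_on p (sarc 1 0 (2 * l))" using swap_supp_on p l by simp
    have l2: "circle_of (2 * l) \<in> L" using L_int_multiple[OF l(3), of 2] by simp
    have "p 0 = 0" using c(3)[OF _ _ p(1) sp] l by simp
    \<comment> \<open>This rotation brings the right end \<open>2 * l\<close> of the support to 0,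
      so the same arc issues from 0 on the left.\<close>
    define q where "q = (\<lambda>y. p (y - (- circle_of (2 * l))) + (- circle_of (2 * l)))"
    have "q \<in> H" unfolding q_def by (rule rotated_in_H[OF p(1) L_minus[OF l2]])
    moreover have "supp_on q (sarc (-1) 0 (2 * l))"
      using rotated_supp_on[OF sp, of "- circle_of (2 * l)"] by (simp add: q_def sarc_left_eq)
    ultimately have "q 0 = 0" using c(4)[of "2 * l" q] l by simp
    then have "p (circle_of (2 * l)) = circle_of (2 * l)" by (simp add: q_def)
    with \<open>p 0 = 0\<close> show False using swap_lift_moves_endpoint[OF l(1) _ l(3) p] l by auto
  qed
  then obtain e where e: "\<bar>e\<bar> = 1" "Q e" by (metis abs_1 abs_minus_cancel)
  have "germ e k x (k x)" if k: "k \<in> H" for k x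
  proof -
    obtain w1 w2 where w: "germ 1 k x w1" "germ (-1) k x w2" using H_germ[OF k, of 1 x] H_germ[OF k, of "-1" x] by auto
    show ?thesis
    proof (cases "x \<in> L")
      case True
      obtain w where w: "germ e k x w" using H_germ[OF k e(1), of x] by blast
      have "k x = w" using endpoint_value[OF k w e(1) True] e(2) unfolding Q_def by blast
      then show ?thesis using w by simp
    next
      case False
      then have eq: "w2 = w1" using H_cont[OF k False w] by simp
      then have "k x = w1" using continuity_point_value[OF k w(1)] w by simp
      then show ?thesis using w e(1) eq by (cases "e = 1") (auto simp: abs_if split: if_splits)
    qed
  qed
  then show ?thesis using e by blast
qed

end

section \<open>Rigidity of lifts of the rotations\<close>

lemma int_step_constant:
  fixes G :: "int \<Rightarrow> 'a"
  assumes "\<And>m. G (m + 1) = G m"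
  shows "G m = G 0"
proof (induction m rule: int_induct[of _ 0])
  case (step2 i)
  then show ?case using assms[of "i - 1"] by simp
qed (use assms in auto)

text \<open>Rows and columns that miss the box are constant, and each such row crosses each such
  column, so everything outside is joined to the corner \<open>(N, N)\<close>. With
  \<open>N = 0\<close> this gives constancy everywhere.\<close>

lemma constant_outside_box:
  fixes F :: "int \<Rightarrow> int \<Rightarrow> 'a"
  assumes "\<And>m n. F (m + 1) n \<noteq> F m n \<Longrightarrow> \<bar>m\<bar> < N \<and> \<bar>n\<bar> < N"
    and "\<And>m n. F m (n + 1) \<noteq> F m n \<Longrightarrow> \<bar>m\<bar> < N \<and> \<bar>n\<bar> < N"
    and "0 \<le> N" "N \<le> \<bar>m\<bar> \<or> N \<le> \<bar>n\<bar>"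
  shows "F m n = F N N"
proof -
  have row: "F m n = F m' n" if "N \<le> \<bar>n\<bar>" for m m' n
    using int_step_constant[of "\<lambda>m. F m n" m] int_step_constant[of "\<lambda>m. F m n" m'] assms(1) that
    by (metis not_le)
  have col: "F m n = F m n'" if "N \<le> \<bar>m\<bar>" for m n n'
    using int_step_constant[of "F m" n] int_step_constant[of "F m" n'] assms(2) that
    by (metis not_le)
  show ?thesis using assms(3,4) row[of n m N] col[of N n N] col[of m n N] row[of N m N] by auto
qed

lemma finite_int_pairs_bounded:
  fixes S :: "(int \<times> int) set"
  assumes "finite S"
  shows "\<exists>N\<ge>0. \<forall>m n. (m, n) \<in> S \<longrightarrow> \<bar>m\<bar> < N \<and> \<bar>n\<bar> < N"
  using assms
proof (induction S rule: finite_induct)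
  case (insert p S)
  then obtain N where N: "N \<ge> 0" "\<And>m n. (m, n) \<in> S \<Longrightarrow> \<bar>m\<bar> < N \<and> \<bar>n\<bar> < N" by blast
  show ?case
    by (rule exI[of _ "N + \<bar>fst p\<bar> + \<bar>snd p\<bar> + 1"]) (use N in fastforce)
qed auto

text \<open>This expresses that \<open>\<int>\<^sup>2\<close> has one end.\<close>

lemma almost_invariant_almost_constant:
  fixes F :: "int \<Rightarrow> int \<Rightarrow> 'a"
  assumes "finite {(m, n). F (m + 1) n \<noteq> F m n}" "finite {(m, n). F m (n + 1) \<noteq> F m n}"
  shows "\<exists>c. finite {(m, n). F m n \<noteq> c}"
proof -
  obtain N where N: "N \<ge> 0" "\<And>m n. (m, n) \<in> {(m, n). F (m + 1) n \<noteq> F m n} \<union> {(m, n). F m (n + 1) \<noteq> F m n} \<Longrightarrow>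
      \<bar>m\<bar> < N \<and> \<bar>n\<bar> < N"
    using finite_int_pairs_bounded[OF finite_UnI[OF assms]] by blast
  have c: "F m n = F N N" if "N \<le> \<bar>m\<bar> \<or> N \<le> \<bar>n\<bar>" for m n
    by (rule constant_outside_box) (use N that in auto)
  have "{(m, n). F m n \<noteq> F N N} \<subseteq> {-N..N} \<times> {-N..N}"
  proof clarify
    fix m n assume "F m n \<noteq> F N N"
    then have "\<not> (N \<le> \<bar>m\<bar> \<or> N \<le> \<bar>n\<bar>)" using c by blast
    then show "m \<in> {-N..N} \<and> n \<in> {-N..N}" by auto
  qed
  then have "finite {(m, n). F m n \<noteq> F N N}" by (rule finite_subset) simp
  then show ?thesis by blast
qed

lemma exists_int_pair_avoiding:
  fixes A B :: "(int \<times> int) set"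
  assumes "finite A" "finite B"
  obtains m n where "(m, n) \<notin> A" "(m, n) \<notin> B"
proof -
  have "infinite (UNIV :: (int \<times> int) set)" by (simp add: infinite_UNIV_int finite_prod)
  then have "\<not> UNIV \<subseteq> A \<union> B" using assms by (meson finite_UnI finite_subset)
  then show ?thesis using that by auto
qed

lemma bij_of_inj_finite_support:
  assumes "inj f" "finite {x. f x \<noteq> x}"
  shows "bij f"
proof -
  let ?S = "{x. f x \<noteq> x}"
  have "f ` ?S \<subseteq> ?S" using assms(1) by (auto simp: inj_eq)
  then have "f ` ?S = ?S"
    using assms by (intro card_subset_eq) (auto simp: card_image inj_on_subset)
  then have "surj f" by (metis (mono_tags, lifting) imageE mem_Collect_eq surjI surj_def)
  then show ?thesis using assms(1) by (simp add: bij_def)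
qed

context permutation_lift
begin

text \<open>Conjugates the lift of the rotations to the rotations themselves: the lift \<open>b\<close> acts almost
  like the rotations, so \<open>b (- a) (x + a)\<close> is an almost invariant function of \<open>a\<close> in a copy of
  \<open>\<int>\<^sup>2\<close>, and its almost constant value defines the conjugating permutation.\<close>

lemma rotations_rigid:
  obtains h where "bij h" "finite {x. h x \<noteq> x}"
    "\<And>a f. a \<in> L \<Longrightarrow> f \<in> H \<Longrightarrow> finite {x. f x \<noteq> x + a} \<Longrightarrow> (\<forall>x. h (x + a) = f (h x))"
proof -
  define b where "b a = (SOME f. f \<in> H \<and> finite {x. f x \<noteq> x + a})" for a
  have b: "b a \<in> H" "finite {x. b a x \<noteq> x + a}" if "a \<in> L" for a
  proof -
    have "\<exists>f. f \<in> H \<and> finite {x. f x \<noteq> x + a}" using H_rot[OF that] by blast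
    then have "b a \<in> H \<and> finite {x. b a x \<noteq> x + a}" unfolding b_def by (rule someI_ex)
    then show "b a \<in> H" "finite {x. b a x \<noteq> x + a}" by auto
  qed
  have b_unique: "f = b a" if "a \<in> L" "f \<in> H" "finite {x. f x \<noteq> x + a}" for f a
    by (rule H_eqI[OF that(2) b(1)[OF that(1)]]) (rule finite_support_trans[OF that(3) finite_support_sym[OF b(2)[OF that(1)]]])
  \<comment> \<open>Both sides lift the same rotation, and such a lift is unique. The lifts
    therefore form a genuine action of \<open>L\<close>, not merely an action up to finite
    sets.\<close>
  have b_add: "b (a + c) x = b a (b c x)" if ac: "a \<in> L" "c \<in> L" for a c x
  proof -
    have "finite {x. b a (b c x) \<noteq> (x + c) + a}"
      by (rule finite_support_comp[OF b(2)[OF ac(2)] b(2)[OF ac(1)] bij_is_inj[OF H_bij[OF b(1)[OF ac(2)]]]])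
    moreover have "(x + c) + a = x + (a + c)" for x by (simp only: add.assoc add.commute[of c a])
    ultimately have "finite {x. (b a \<circ> b c) x \<noteq> x + (a + c)}" by (simp only: comp_apply)
    then have "b a \<circ> b c = b (a + c)"
      by (rule b_unique[OF L_add[OF ac] H_comp[OF b(1)[OF ac(1)] b(1)[OF ac(2)]]])
    then show ?thesis by (metis comp_apply)
  qed
  have b_fin: "finite {y. b (- a) (y + a) \<noteq> y}" if a: "a \<in> L" for a
  proof -
    have "finite ((\<lambda>y. y + a) -` {x. b (- a) x \<noteq> x + (- a)})"
      by (rule finite_vimageI[OF b(2)[OF L_minus[OF a]]]) (auto intro: injI)
    moreover have "(\<lambda>y. y + a) -` {x. b (- a) x \<noteq> x + (- a)} = {y. b (- a) (y + a) \<noteq> y}" by auto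
    ultimately show ?thesis by simp
  qed
  obtain p q where pq: "circle_of p \<in> L" "circle_of q \<in> L"
    "\<And>m n. of_int m * p + of_int n * q \<in> \<int> \<Longrightarrow> m = 0 \<and> n = (0::int)"
    using L_indep unfolding independent_mod_1_def by blast
  define e where "e m n = circle_of (of_int m * p + of_int n * q)" for m n :: int
  have eL: "e m n \<in> L" for m n
    using L_add[OF L_int_multiple[OF pq(1)] L_int_multiple[OF pq(2)]] by (simp add: e_def circle_of_add)
  have e_add: "e (m + m') (n + n') = e m n + e m' n'" for m m' n n'
    unfolding e_def circle_of_add[symmetric]
    by (rule arg_cong[of _ _ circle_of]) (simp add: algebra_simps)
  have e1: "e (m + 1) n = circle_of p + e m n" "e m (n + 1) = circle_of q + e m n" for m n
    using e_add[of m 1 n 0] e_add[of m 0 n 1] by (simp_all add: e_def add.commute)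
  have e_inj: "m = m' \<and> n = n'" if "e m n = e m' n'" for m n m' n'
  proof -
    have "of_int (m - m') * p + of_int (n - n') * q \<in> \<int>"
      using that by (simp add: e_def circle_of_eq_iff left_diff_distrib) (simp add: algebra_simps)
    then show ?thesis using pq(3)[of "m - m'" "n - n'"] by simp
  qed
  have fin_e: "finite {(m, n). x + e m n \<in> E}" if "finite E" for x E
  proof (rule finite_imageD)
    show "finite ((\<lambda>(m, n). x + e m n) ` {(m, n). x + e m n \<in> E})"
      by (rule finite_subset[OF _ that]) auto
    show "inj_on (\<lambda>(m, n). x + e m n) {(m, n). x + e m n \<in> E}"
      by (rule inj_onI) (use e_inj in auto)
  qed
  \<comment> \<open>A rotation by \<open>e m n\<close> undone by the lift: if the lifts were the
    rotations themselves, \<open>F x\<close> would be constantly \<open>x\<close>.\<close>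
  define F where "F x m n = b (- e m n) (x + e m n)" for x m n
  define Eu where "Eu = {y. b (- circle_of p) (y + circle_of p) \<noteq> y} \<union> {y. b (- circle_of q) (y + circle_of q) \<noteq> y}"
  have Eu: "finite Eu" unfolding Eu_def using b_fin pq by simp
  \<comment> \<open>A cocycle identity: adding a generator changes \<open>F x\<close> only if
    \<open>x + e m n\<close> lies in the finite set \<open>Eu\<close>. As Z^2 acts freely, this
    affects finitely many edges for each \<open>x\<close>.\<close>
  have step: "b (- (c + e m n)) (x + (c + e m n)) = b (- e m n) (b (- c) ((x + e m n) + c))" if "c \<in> L" for c x m n
    using b_add[OF L_minus[OF eL] L_minus[OF that], of m n "x + (c + e m n)"] by (simp add: add_ac)
  have h_edge: "F x (m + 1) n = F x m n" if "x + e m n \<notin> Eu" for x m n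
    unfolding F_def e1 step[OF pq(1)] using that by (simp add: Eu_def)
  have v_edge: "F x m (n + 1) = F x m n" if "x + e m n \<notin> Eu" for x m n
    unfolding F_def e1 step[OF pq(2)] using that by (simp add: Eu_def)
  have edge: "x + e m n \<in> Eu" if "F x (m + 1) n \<noteq> F x m n \<or> F x m (n + 1) \<noteq> F x m n" for x m n
    using that h_edge v_edge by blast
  define h where "h x = (SOME c. finite {(m, n). F x m n \<noteq> c})" for x
  have h: "finite {(m, n). F x m n \<noteq> h x}" for x
    unfolding h_def
  proof (rule someI_ex, rule almost_invariant_almost_constant)
    show "finite {(m, n). F x (m + 1) n \<noteq> F x m n}" "finite {(m, n). F x m (n + 1) \<noteq> F x m n}"
      by (rule finite_subset[OF _ fin_e[OF Eu, of x]]; use edge in auto)+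
  qed
  have h_eqI: "h x = c" if "finite {(m, n). F x m n \<noteq> c}" for x c
    using exists_int_pair_avoiding[OF h[of x] that] by auto
  \<comment> \<open>Except at the finitely many pairs where \<open>b a\<close> is not the rotation
    at \<open>x + e m n\<close>, commutativity of \<open>L\<close> lets \<open>b a\<close> be pulled
    out of \<open>F\<close>.\<close>
  have equi: "h (x + a) = b a (h x)" if a: "a \<in> L" for x a
  proof (rule h_eqI)
    have "F (x + a) m n = b a (h x)" if "x + e m n \<notin> {y. b a y \<noteq> y + a}" "F x m n = h x" for m n
    proof -
      have s: "(x + a) + e m n = (x + e m n) + a" by (simp only: add.assoc add.commute[of a])
      have "F (x + a) m n = b (- e m n) (b a (x + e m n))" unfolding F_def s using that(1) by simp
      also have "\<dots> = b (- e m n + a) (x + e m n)" by (rule b_add[OF L_minus[OF eL] a, symmetric])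
      also have "- e m n + a = a + - e m n" by (rule add.commute)
      also have "b (a + - e m n) (x + e m n) = b a (b (- e m n) (x + e m n))" by (rule b_add[OF a L_minus[OF eL]])
      finally show ?thesis using that(2) by (simp add: F_def)
    qed
    then show "finite {(m, n). F (x + a) m n \<noteq> b a (h x)}"
      by (intro finite_subset[OF _ finite_UnI[OF fin_e[OF b(2)[OF a], of x] h[of x]]]) auto
  qed
  \<comment> \<open>If the Z^2 orbit of \<open>x\<close> misses \<open>Eu\<close>, then
    \<open>F x\<close> is constant with value \<open>F x 0 0 = x\<close>. Otherwise \<open>x\<close>
    is on the orbit of one of the finitely many \<open>y\<close> in \<open>Eu\<close>, and by
    equivariance \<open>h x \<noteq> x\<close> corresponds to one of the finitely many exceptional
    pairs of \<open>y\<close>.\<close>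
  have fin_h: "finite {x. h x \<noteq> x}"
  proof (rule finite_subset)
    let ?B = "\<lambda>y. (\<lambda>(m, n). y - e m n) ` {(m, n). F y (- m) (- n) \<noteq> h y}"
    show "{x. h x \<noteq> x} \<subseteq> (\<Union>y\<in>Eu. ?B y)"
    proof
      fix x assume x: "x \<in> {x. h x \<noteq> x}"
      have F0: "F x 0 0 = x"
      proof -
        have "b 0 = id"
        proof (rule b_unique[symmetric, OF L_0])
          have "b 0 \<circ> finv (b 0) \<in> H" by (intro H_comp H_inv b L_0)
          moreover have "b 0 \<circ> finv (b 0) = id"
            using H_bij[OF b(1)[OF L_0]] by (simp add: bij_is_surj surj_iff[symmetric])
          ultimately show "id \<in> H" by simp
        qed simp
        then show ?thesis by (simp add: F_def e_def circle_of_0)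
      qed
      have "\<exists>m n. x + e m n \<in> Eu"
      proof (rule ccontr)
        assume "\<not> ?thesis"
        then have c: "F x (m + 1) n = F x m n" "F x m (n + 1) = F x m n" for m n using h_edge v_edge by blast+
        have "F x m n = F x 0 0" for m n by (rule constant_outside_box) (use c in auto)
        then have "h x = x" using F0 by (intro h_eqI) simp
        then show False using x by simp
      qed
      then obtain m n where mn: "x + e m n \<in> Eu" by blast
      define y where "y = x + e m n"
      have xe: "x = y - e m n" by (simp add: y_def)
      have neg: "e (- m) (- n) = - e m n" by (simp add: e_def circle_of_minus[symmetric])
      have "F y (- m) (- n) \<noteq> h y"
      proof
        assume "F y (- m) (- n) = h y"
        moreover have "F y (- m) (- n) = b (- (- e m n)) (y + (- e m n))" unfolding F_def neg ..
        moreover have "y + (- e m n) = x" by (simp add: y_def)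
        moreover have "h y = b (e m n) (h x)" unfolding y_def by (rule equi[OF eL])
        ultimately have "b (e m n) x = b (e m n) (h x)" by (simp only: minus_minus)
        then have "x = h x" by (rule injD[OF bij_is_inj[OF H_bij[OF b(1)[OF eL]]]])
        then show False using x by simp
      qed
      then have "x \<in> ?B y" using xe by (intro image_eqI[of _ _ "(m, n)"]) auto
      moreover have "y \<in> Eu" unfolding y_def by (rule mn)
      ultimately show "x \<in> (\<Union>y\<in>Eu. ?B y)" by (rule UN_I[rotated])
    qed
    have "finite {(m, n). F y (- m) (- n) \<noteq> h y}" for y
    proof (rule finite_imageD)
      show "finite ((\<lambda>(m, n). (- m, - n)) ` {(m, n). F y (- m) (- n) \<noteq> h y})"
        by (rule finite_subset[OF _ h[of y]]) auto
      show "inj_on (\<lambda>(m, n). (- m, - n)) {(m, n). F y (- m) (- n) \<noteq> h y}"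
        by (rule inj_onI) auto
    qed
    then show "finite (\<Union>y\<in>Eu. ?B y)" using Eu by simp
  qed
  \<comment> \<open>At a pair that is generic for both points, both values of \<open>h\<close> come
    from the same injective map: a rotation followed by \<open>b (- e m n)\<close>.\<close>
  have inj_h: "inj h"
  proof (rule injI)
    fix x y assume "h x = h y"
    obtain m n where "F x m n = h x" "F y m n = h y"
      using exists_int_pair_avoiding[OF h[of x] h[of y]] by auto
    then have "F x m n = F y m n" using \<open>h x = h y\<close> by (simp only:)
    then have "x + e m n = y + e m n"
      unfolding F_def by (rule injD[OF bij_is_inj[OF H_bij[OF b(1)[OF L_minus[OF eL]]]]])
    then show "x = y" by simp
  qed
  show ?thesis
  proof (rule that[of h])
    show "bij h" by (rule bij_of_inj_finite_support[OF inj_h fin_h])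
    show "\<forall>x. h (x + a) = f (h x)" if "a \<in> L" "f \<in> H" "finite {x. f x \<noteq> x + a}" for a f
      using equi[OF that(1)] b_unique[OF that] by simp
  qed (fact fin_h)
qed

end

lemma conj_finite_change:
  assumes "bij h" "finite {x. h x \<noteq> x}" "bij k"
  shows "finite {x. (finv h \<circ> k \<circ> h) x \<noteq> k x}"
proof -
  have "finite {x. finv h x \<noteq> finv id x}"
    using assms by (intro finite_support_inv) auto
  then have 1: "finite {x. finv h x \<noteq> id x}" by (simp add: inv_id)
  have "finite {x. k (h x) \<noteq> k (id x)}"
    using assms by (intro finite_support_comp[of h id k k]) (auto simp: bij_is_inj)
  then have "finite {x. finv h (k (h x)) \<noteq> id (k (id x))}"
    using bij_comp[OF assms(1,3)]
    by (intro finite_support_comp[of "\<lambda>x. k (h x)" "\<lambda>x. k (id x)" "finv h" id] 1) (simp_all add: bij_is_inj o_def)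
  then show ?thesis by simp
qed

text \<open>Conjugation by \<open>h\<close> alters each element at finitely many points only, so
  germs and classes persist while the lifts of the rotations become exact.\<close>

lemma (in permutation_lift) conj_one_sided_continuous:
  assumes swap: "\<And>l. 0 < l \<Longrightarrow> 2 * l < 1 \<Longrightarrow> circle_of l \<in> L \<Longrightarrow> \<exists>f\<in>H. finite {x. f x \<noteq> swap l x}"
  obtains h e where "bij h" "finite {x. h x \<noteq> x}" "\<bar>e\<bar> = 1"
    "\<And>k x. k \<in> H \<Longrightarrow> germ e (finv h \<circ> k \<circ> h) x ((finv h \<circ> k \<circ> h) x)"
proof -
  obtain h where h: "bij h" "finite {x. h x \<noteq> x}"
    "\<And>a f. a \<in> L \<Longrightarrow> f \<in> H \<Longrightarrow> finite {x. f x \<noteq> x + a} \<Longrightarrow> (\<forall>x. h (x + a) = f (h x))"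
    using rotations_rigid by blast
  define c where "c k = finv h \<circ> k \<circ> h" for k
  define K where "K = c ` H"
  have fin: "finite {x. c k x \<noteq> k x}" if "k \<in> H" for k
    unfolding c_def by (rule conj_finite_change[OF h(1,2) H_bij[OF that]])
  have hh: "h (finv h x) = x" "finv h (h x) = x" for x
    using h(1) by (simp_all add: bij_is_inj bij_is_surj surj_f_inv_f)
  have c_comp: "c k \<circ> c k' = c (k \<circ> k')" for k k' by (simp add: c_def fun_eq_iff hh)
  have c_bij: "bij (c k)" if "k \<in> H" for k
    unfolding c_def by (intro bij_comp h bij_imp_bij_inv H_bij that)
  have c_inv: "finv (c k) = c (finv k)" if "k \<in> H" for k
  proof (rule inv_unique_comp)
    have "k (finv k x) = x" "finv k (k x) = x" for x
      using H_bij[OF that] by (simp_all add: bij_is_inj bij_is_surj surj_f_inv_f)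
    then show "c k \<circ> c (finv k) = id" "c (finv k) \<circ> c k = id"
      by (simp_all add: c_def fun_eq_iff hh)
  qed
  have K_E: "\<exists>k. k \<in> H \<and> f = c k" if "f \<in> K" for f using that by (auto simp: K_def)
  have K_I: "c k \<in> K" if "k \<in> H" for k using that by (simp add: K_def)
  have near: "\<exists>f\<in>K. finite {x. f x \<noteq> g x}" if k: "k \<in> H" "finite {x. k x \<noteq> g x}" for k g
    using finite_support_trans[OF fin[OF k(1)] k(2)] K_I[OF k(1)] by blast
  interpret K: swap_lift K L
  proof unfold_locales
    fix f assume "f \<in> K"
    then obtain k where k: "k \<in> H" "f = c k" using K_E by blast
    then show "bij f" using c_bij by simp
    show "finv f \<in> K" using K_I[OF H_inv[OF k(1)]] k c_inv by simp
    show "f \<circ> g \<in> K" if g: "g \<in> K" for g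
    proof -
      obtain k' where k': "k' \<in> H" "g = c k'" using K_E[OF g] by blast
      then show ?thesis using K_I[OF H_comp[OF k(1) k'(1)]] k c_comp by simp
    qed
    show "f = g" if g: "g \<in> K" "finite {x. f x \<noteq> g x}" for g
    proof -
      obtain k' where k': "k' \<in> H" "g = c k'" using K_E[OF g(1)] by blast
      have "finite {x. k x \<noteq> k' x}"
        by (rule finite_support_trans[OF finite_support_sym[OF fin[OF k(1)]]],
            rule finite_support_trans[OF _ fin[OF k'(1)]]) (use g k k' in simp)
      then show ?thesis using H_eqI[OF k(1) k'(1)] k k' by simp
    qed
    show "\<exists>w. germ e f x w" if e: "\<bar>e\<bar> = 1" for e x
    proof -
      obtain w where "germ e k x w" using H_germ[OF k(1) e] by blast
      then have "germ e (c k) x w" using germ_cong[OF finite_support_sym[OF fin[OF k(1)]] _ e] by blast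
      then show ?thesis using k by blast
    qed
    show "w = w'" if x: "x \<notin> L" "germ 1 f x w" "germ (-1) f x w'" for x w w'
    proof -
      have "germ 1 k x w" "germ (-1) k x w'"
        using germ_cong[OF fin[OF k(1)]] x k by auto
      then show ?thesis using H_cont[OF k(1) x(1)] by blast
    qed
  next
    fix a assume a: "a \<in> L"
    show "\<exists>f\<in>K. finite {x. f x \<noteq> x + a}"
    proof -
      obtain k where "k \<in> H" "finite {x. k x \<noteq> x + a}" using H_rot[OF a] by blast
      then show ?thesis by (rule near)
    qed
    show "(\<lambda>x. x + a) \<in> K"
    proof -
      obtain k where k: "k \<in> H" "finite {x. k x \<noteq> x + a}" using H_rot[OF a] by blast
      then have hk: "h (x + a) = k (h x)" for x using h(3)[OF a] by blast
      have "c k = (\<lambda>x. x + a)"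
      proof
        fix x show "c k x = x + a" using hh(2)[of "x + a"] by (simp add: c_def hk)
      qed
      then show ?thesis using K_I[OF k(1)] by simp
    qed
    show "- a \<in> L" by (rule L_minus[OF a])
    show "a + b \<in> L" if "b \<in> L" for b by (rule L_add[OF a that])
  next
    show "\<exists>p q. circle_of p \<in> L \<and> circle_of q \<in> L \<and>
      independent_mod_1 p q" by (rule L_indep)
    show "\<exists>f\<in>K. finite {x. f x \<noteq> swap l x}" if l: "0 < l" "2 * l < 1" "circle_of l \<in> L" for l
    proof -
      obtain k where "k \<in> H" "finite {x. k x \<noteq> swap l x}" using swap[OF l] by blast
      then show ?thesis by (rule near)
    qed
  qed
  obtain e where e: "\<bar>e\<bar> = 1" "\<And>k x. k \<in> K \<Longrightarrow> germ e k x (k x)" using K.one_sided_continuous by blast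
  show ?thesis
  proof (rule that[OF h(1,2) e(1)])
    fix k x assume "k \<in> H"
    then have "c k \<in> K" by (rule K_I)
    then show "germ e (finv h \<circ> k \<circ> h) x ((finv h \<circ> k \<circ> h) x)" using e(2) unfolding c_def by blast
  qed
qed

section \<open>Subgroups of rank at least two\<close>

text \<open>For fixed \<open>p\<close>, the numbers \<open>q\<close> that satisfy a relation with
  \<open>n \<noteq> 0\<close> are countably many. Applied to 0 this yields an irrational
  \<open>p\<close>, and applied to that \<open>p\<close> it yields \<open>q\<close>.\<close>

lemma independent_pair_exists: "\<exists>p q. independent_mod_1 p q"
proof -
  have ex: "\<exists>q::real. \<forall>m n k :: int. n \<noteq> 0 \<longrightarrow> of_int m * p + of_int n * q \<noteq> of_int k" for p :: real
  proof -
    define f where "f = (\<lambda>(m :: int, n :: int, k :: int). (of_int k - of_int m * p) / of_int n :: real)"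
    have "countable (range f)" by auto
    then have "range f \<noteq> UNIV" using uncountable_UNIV_real by metis
    then obtain q where q: "q \<notin> range f" by blast
    have "of_int m * p + of_int n * q \<noteq> of_int k" if "n \<noteq> 0" for m n k :: int
    proof
      assume "of_int m * p + of_int n * q = of_int k"
      then have "q = f (m, n, k)" using that by (simp add: f_def field_simps)
      then show False using q by blast
    qed
    then show ?thesis by blast
  qed
  obtain p :: real where p: "\<And>m n k :: int. n \<noteq> 0 \<Longrightarrow> of_int m * 0 + of_int n * p \<noteq> of_int k" using ex[of 0] by blast
  obtain q :: real where q: "\<And>m n k :: int. n \<noteq> 0 \<Longrightarrow> of_int m * p + of_int n * q \<noteq> of_int k" using ex[of p] by blast
  have "m = 0 \<and> n = 0" if mn: "of_int m * p + of_int n * q \<in> \<int>" for m n :: int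
  proof -
    obtain k :: int where k: "of_int m * p + of_int n * q = of_int k" using mn by (auto elim: Ints_cases)
    then have "n = 0" using q by blast
    then have "of_int 0 * 0 + of_int m * p = of_int k" using k by simp
    then have "m = 0" using p by blast
    with \<open>n = 0\<close> show ?thesis by simp
  qed
  then show ?thesis unfolding independent_mod_1_def by blast
qed

section \<open>Rational rank through the tensor product\<close>

lemma circle_group_comm: "comm_group circle_group"
proof (rule comm_groupI)
  show "\<exists>y\<in>carrier circle_group. y \<otimes>\<^bsub>circle_group\<^esub> x = \<one>\<^bsub>circle_group\<^esub>" if "x \<in> carrier circle_group" for x
    by (rule bexI[of _ "- x"]) (auto simp: circle_group_def)
qed (auto simp: circle_group_def add_ac)

lemma circle_subgroup:
  assumes "subgroup L circle_group"
  shows "0 \<in> L" "\<And>a b. a \<in> L \<Longrightarrow> b \<in> L \<Longrightarrow> a + b \<in> L" "\<And>a. a \<in> L \<Longrightarrow> - a \<in> L"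
    "comm_group (circle_group\<lparr>carrier := L\<rparr>)"
proof -
  interpret C: comm_group circle_group by (rule circle_group_comm)
  have inv: "inv\<^bsub>circle_group\<^esub> a = - a" for a
    by (rule C.inv_equality) (auto simp: circle_group_def)
  show 0: "0 \<in> L" using subgroup.one_closed[OF assms] by (simp add: circle_group_def)
  show add: "a + b \<in> L" if "a \<in> L" "b \<in> L" for a b
    using subgroup.m_closed[OF assms that] by (simp add: circle_group_def)
  show minus: "- a \<in> L" if "a \<in> L" for a using subgroup.m_inv_closed[OF assms that] by (simp add: inv)
  show "comm_group (circle_group\<lparr>carrier := L\<rparr>)"
  proof (rule comm_groupI)
    show "\<exists>y\<in>carrier (circle_group\<lparr>carrier := L\<rparr>). y \<otimes>\<^bsub>circle_group\<lparr>carrier := L\<rparr>\<^esub> x = \<one>\<^bsub>circle_group\<lparr>carrier := L\<rparr>\<^esub>"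
      if "x \<in> carrier (circle_group\<lparr>carrier := L\<rparr>)" for x
      by (rule bexI[of _ "- x"]) (use that minus in \<open>auto simp: circle_group_def\<close>)
  qed (use 0 add in \<open>auto simp: circle_group_def add_ac\<close>)
qed

text \<open>If every element of \<open>L\<close> is a rational multiple of \<open>u\<close> modulo torsion, then \<open>u \<otimes> 1\<close> spans
  \<open>L \<otimes> \<rat>\<close>, since \<open>v \<otimes> q = n v \<otimes> (q / n)\<close>.\<close>

lemma rat_rank_le_1:
  assumes sub: "subgroup L circle_group" and u: "circle_of u \<in> L"
    and dep: "\<And>v. circle_of v \<in> L \<Longrightarrow> \<exists>m n :: int. n \<noteq> 0 \<and> circle_of (of_int n * v) = circle_of (of_int m * u)"
  shows "rat_rank (circle_group\<lparr>carrier := L\<rparr>) \<le> 1"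
proof -
  define A where "A = circle_group\<lparr>carrier := L\<rparr>"
  have LA: "carrier A = L" "mult A = (+)" by (simp_all add: A_def circle_group_def)
  note L = circle_subgroup(1,2,3)[OF sub]
  have A: "comm_group A" unfolding A_def by (rule circle_subgroup[OF sub])
  interpret V: vectorspace rat_field "tensor_rat A" by (rule vectorspace_tensor_rat[OF A])
  define G where "G = free_Abelian_group (L \<times> (UNIV :: rat set))"
  define N where "N = tensor_kernel A"
  interpret G: comm_group G unfolding G_def by (rule abelian_free_Abelian_group)
  have Gs: "carrier G = {c. Poly_Mapping.keys c \<subseteq> L \<times> UNIV}" "mult G = (+)" "one G = 0"
    by (auto simp: G_def free_Abelian_group_def)
  have R: "tensor_relations A \<subseteq> carrier G"
    unfolding G_def LA(1)[symmetric] by (rule tensor_relations_carrier) (use A in \<open>simp add: comm_group_def group_def\<close>)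
  have N: "subgroup N G"
    unfolding N_def tensor_kernel_def LA(1) G_def[symmetric] by (rule G.generate_is_subgroup[OF R])
  interpret N: normal N G by (rule G.subgroup_imp_normal[OF N])
  define cl where "cl x = N #>\<^bsub>G\<^esub> x" for x
  have carV: "carrier (tensor_rat A) = cl ` carrier G"
    by (auto simp: tensor_rat_def Let_def FactGroup_def RCOSETS_def cl_def G_def N_def LA)
  have addV: "cl x \<oplus>\<^bsub>tensor_rat A\<^esub> cl y = cl (x + y)" if "x \<in> carrier G" "y \<in> carrier G" for x y
    using N.rcos_sum[OF that] by (simp add: tensor_rat_def Let_def FactGroup_def cl_def Gs(2) LA G_def[symmetric] N_def[symmetric])
  have cl_self: "x \<in> cl x" if "x \<in> carrier G" for x
    using G.rcos_self[OF that N] by (simp add: cl_def)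
  have cl_eqI: "cl y = cl x" if "y \<in> cl x" "x \<in> carrier G" for x y
    using G.repr_independence[OF _ that(2) N] that(1) by (simp add: cl_def)
  have cl_rel: "cl x = cl y" if "x - y \<in> tensor_relations A" "y \<in> carrier G" for x y
  proof -
    have "x - y \<in> N" using that(1) unfolding N_def tensor_kernel_def by (rule generate.incl)
    then have "(x - y) + y \<in> cl y" unfolding cl_def r_coset_def Gs(2) by blast
    then show ?thesis using cl_eqI that(2) by simp
  qed
  \<comment> \<open>The pure tensor of \<open>a\<close> and \<open>q\<close>, as a coset.\<close>
  define T where "T a q = cl (frag_of (a, q))" for a :: circle and q :: rat
  have fr: "frag_of (a, q) \<in> carrier G" if "a \<in> L" for a q
    using that by (simp add: Gs)
  have fr2: "frag_of (a, q) + frag_of (b, r) \<in> carrier G" if "a \<in> L" "b \<in> L" for a b q r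
    using G.m_closed[OF fr[OF that(1)] fr[OF that(2)]] by (simp add: Gs(2))
  have T_car: "T a q \<in> carrier (tensor_rat A)" if "a \<in> L" for a q
    using fr[OF that] by (auto simp: carV T_def)
  have T_add1: "T (a + b) q = T a q \<oplus>\<^bsub>tensor_rat A\<^esub> T b q" if ab: "a \<in> L" "b \<in> L" for a b q
  proof -
    have "frag_of (a + b, q) - (frag_of (a, q) + frag_of (b, q)) \<in> tensor_relations A"
      unfolding tensor_relations_def LA diff_diff_eq[symmetric] using ab by blast
    then show ?thesis unfolding T_def addV[OF fr[OF ab(1)] fr[OF ab(2)]] by (rule cl_rel[OF _ fr2[OF ab]])
  qed
  have T_add2: "T a (q + r) = T a q \<oplus>\<^bsub>tensor_rat A\<^esub> T a r" if a: "a \<in> L" for a q r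
  proof -
    have "frag_of (a, q + r) - (frag_of (a, q) + frag_of (a, r)) \<in> tensor_relations A"
      unfolding tensor_relations_def LA diff_diff_eq[symmetric] using a by blast
    then show ?thesis unfolding T_def addV[OF fr[OF a] fr[OF a]] by (rule cl_rel[OF _ fr2[OF a a]])
  qed
  have T0: "T 0 q = \<zero>\<^bsub>tensor_rat A\<^esub>" for q
    using T_add1[OF L(1) L(1), of q] T_car[OF L(1), of q] V.add.r_cancel_one' by simp
  have T0': "T a 0 = \<zero>\<^bsub>tensor_rat A\<^esub>" if "a \<in> L" for a
    using T_add2[OF that, of 0 0] T_car[OF that, of 0] V.add.r_cancel_one' by simp
  have T_int: "T (circle_of (of_int n * v)) q = T (circle_of v) (of_int n * q)" if v: "circle_of v \<in> L" for v n q
  proof (induction n rule: int_induct[of _ 0])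
    case base then show ?case using T0 T0' v by (simp add: circle_of_0)
  next
    case (step1 i)
    have iv: "circle_of (of_int i * v) \<in> L" by (rule subgroup_int_multiple[OF L v])
    have "T (circle_of (of_int (i + 1) * v)) q = T (circle_of (of_int i * v) + circle_of v) q"
      by (simp add: distrib_right circle_of_add)
    also have "\<dots> = T (circle_of v) (of_int i * q) \<oplus>\<^bsub>tensor_rat A\<^esub> T (circle_of v) q"
      unfolding T_add1[OF iv v] step1 ..
    also have "\<dots> = T (circle_of v) (of_int (i + 1) * q)"
      unfolding T_add2[OF v, symmetric] by (simp add: distrib_right)
    finally show ?case .
  next
    case (step2 i)
    have iv: "circle_of (of_int (i - 1) * v) \<in> L" by (rule subgroup_int_multiple[OF L v])
    have "T (circle_of (of_int (i - 1) * v)) q \<oplus>\<^bsub>tensor_rat A\<^esub> T (circle_of v) q = T (circle_of (of_int (i - 1) * v) + circle_of v) q"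
      by (rule T_add1[OF iv v, symmetric])
    also have "circle_of (of_int (i - 1) * v) + circle_of v = circle_of (of_int i * v)"
      unfolding circle_of_add[symmetric] by (simp add: algebra_simps)
    also have "T (circle_of (of_int i * v)) q = T (circle_of v) (of_int (i - 1) * q + q)"
      unfolding step2 by (simp add: algebra_simps)
    also have "\<dots> = T (circle_of v) (of_int (i - 1) * q) \<oplus>\<^bsub>tensor_rat A\<^esub> T (circle_of v) q"
      by (rule T_add2[OF v])
    finally show ?case using V.add.right_cancel T_car[OF iv] T_car[OF v] by blast
  qed
  have T_u: "\<exists>r. T a q = T (circle_of u) r" if a: "a \<in> L" for a q
  proof -
    obtain v where v: "a = circle_of v" using circle_of_surj by blast
    obtain m n :: int where mn: "n \<noteq> 0" "circle_of (of_int n * v) = circle_of (of_int m * u)"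
      using dep a v by blast
    have "T a q = T (circle_of v) (of_int n * (q / of_int n))" using mn(1) v by simp
    also have "\<dots> = T (circle_of (of_int n * v)) (q / of_int n)" using T_int a v by simp
    also have "\<dots> = T (circle_of u) (of_int m * (q / of_int n))" using T_int[OF u] mn(2) by simp
    finally show ?thesis by blast
  qed
  have all_u: "c \<in> carrier G \<and> (\<exists>r. cl c = T (circle_of u) r)" if c: "Poly_Mapping.keys c \<subseteq> L \<times> UNIV" for c
    using c
  proof (induct c rule: frag_induction)
    case zero
    have "cl 0 = \<zero>\<^bsub>tensor_rat A\<^esub>"
      by (simp add: tensor_rat_def Let_def FactGroup_def cl_def LA G_def[symmetric] N_def[symmetric] flip: Gs(3))
        (rule G.coset_mult_one[OF N.subset])
    moreover have "0 \<in> carrier G" using G.one_closed by (simp only: Gs(3))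
    ultimately show ?case using T0'[OF u] by metis
  next
    case (one x)
    then show ?case using T_u fr by (cases x) (auto simp: T_def)
  next
    case (diff a b)
    then obtain r s where rs: "cl a = T (circle_of u) r" "cl b = T (circle_of u) s" by blast
    have ab: "a - b \<in> carrier G" "b \<in> carrier G"
      using diff keys_diff[of a b] by (auto simp: Gs)
    have "cl (a - b) \<oplus>\<^bsub>tensor_rat A\<^esub> T (circle_of u) s = T (circle_of u) (r - s) \<oplus>\<^bsub>tensor_rat A\<^esub> T (circle_of u) s"
      using addV[OF ab] rs T_add2[OF u, of "r - s" s] by simp
    moreover have "cl (a - b) \<in> carrier (tensor_rat A)" using ab by (auto simp: carV)
    ultimately have "cl (a - b) = T (circle_of u) (r - s)" using V.add.right_cancel T_car[OF u] by blast
    then show ?case using ab(1) by blast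
  qed
  have scale: "T (circle_of u) r = r \<odot>\<^bsub>tensor_rat A\<^esub> T (circle_of u) 1" for r
  proof -
    let ?X = "r \<odot>\<^bsub>tensor_rat A\<^esub> T (circle_of u) 1"
    have "?X \<in> carrier (tensor_rat A)"
      using V.smult_closed[of r, OF _ T_car[OF u]] by (simp add: rat_field_def)
    then obtain z where z: "z \<in> carrier G" "?X = cl z" by (auto simp: carV)
    \<comment> \<open>Scalar multiplication is a union over all representatives. A single
      representative identifies it, because the result is known to be a coset and cosets that meet
      are equal.\<close>
    have sm: "r \<odot>\<^bsub>tensor_rat A\<^esub> X = (\<Union>x\<in>X. N #>\<^bsub>G\<^esub> tensor_scale r x)" for X
      by (simp add: tensor_rat_def Let_def G_def N_def LA)
    have "frag_of (circle_of u, 1) \<in> T (circle_of u) 1" unfolding T_def by (rule cl_self[OF fr[OF u]])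
    then have "N #>\<^bsub>G\<^esub> tensor_scale r (frag_of (circle_of u, 1)) \<subseteq> ?X" unfolding sm by blast
    then have "T (circle_of u) r \<subseteq> ?X" by (simp add: T_def cl_def tensor_scale_def)
    moreover have "frag_of (circle_of u, r) \<in> T (circle_of u) r" unfolding T_def by (rule cl_self[OF fr[OF u]])
    ultimately have "frag_of (circle_of u, r) \<in> cl z" using z by blast
    then have "T (circle_of u) r = cl z" unfolding T_def by (rule cl_eqI[OF _ z(1)])
    then show ?thesis using z(2) by (simp only:)
  qed
  define t where "t = T (circle_of u) 1"
  have t: "{t} \<subseteq> carrier (tensor_rat A)" using T_car[OF u] by (simp add: t_def)
  interpret S: submodule rat_field "V.span {t}" "tensor_rat A" by (rule V.span_is_submodule[OF t])
  have "x \<in> V.span {t}" if x: "x \<in> carrier (tensor_rat A)" for x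
  proof -
    obtain c where c: "x = cl c" "Poly_Mapping.keys c \<subseteq> L \<times> UNIV" using x by (auto simp: carV Gs)
    then obtain r where r: "x = T (circle_of u) r" using all_u by metis
    have "r \<in> carrier rat_field" by (simp add: rat_field_def)
    moreover have "t \<in> V.span {t}" using V.in_own_span[OF t] by simp
    ultimately have "r \<odot>\<^bsub>tensor_rat A\<^esub> t \<in> V.span {t}" by (rule S.smult_closed)
    then show ?thesis unfolding r scale[of r] t_def .
  qed
  then have gen: "V.span {t} = carrier (tensor_rat A)" using V.span_is_subset2[OF t] by blast
  have "V.dim \<le> card {t}" by (rule V.gen_ge_dim[OF _ t gen]) simp
  moreover have "V.fin_dim" unfolding V.fin_dim_def using gen t by (intro exI[of _ "{t}"]) simp
  ultimately show ?thesis unfolding rat_rank_def A_def[symmetric] by (simp add: one_enat_def)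
qed

text \<open>By contraposition: suppose no two elements are independent. A \<open>u\<close> of
  infinite order is then related to every \<open>v\<close> with a nonzero coefficient of
  \<open>v\<close>, since otherwise \<open>u\<close> would be torsion; if all elements are torsion,
  \<open>u = 0\<close> serves. Either way the rank is at most 1.\<close>

lemma rat_rank_ge_2_independent:
  assumes sub: "subgroup L circle_group" and rank: "rat_rank (circle_group\<lparr>carrier := L\<rparr>) \<ge> 2"
  shows "\<exists>p q. circle_of p \<in> L \<and> circle_of q \<in> L \<and> independent_mod_1 p q"
proof (rule ccontr)
  assume "\<not> ?thesis"
  then have dep: "\<exists>m n :: int. of_int m * p + of_int n * q \<in> \<int> \<and> (m \<noteq> 0 \<or> n \<noteq> 0)"
    if "circle_of p \<in> L" "circle_of q \<in> L" for p q
    using that unfolding independent_mod_1_def by blast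
  have "\<exists>u. circle_of u \<in> L \<and> (\<forall>v. circle_of v \<in> L \<longrightarrow> (\<exists>m n :: int. n \<noteq> 0 \<and> of_int m * u + of_int n * v \<in> \<int>))"
  proof (cases "\<forall>v. circle_of v \<in> L \<longrightarrow> (\<exists>n :: int. n \<noteq> 0 \<and> of_int n * v \<in> \<int>)")
    case True
    then show ?thesis using circle_subgroup(1)[OF sub]
      by (intro exI[of _ 0]) (auto simp: circle_of_0)
  next
    case False
    then obtain u where u: "circle_of u \<in> L" "\<And>n :: int. of_int n * u \<in> \<int> \<Longrightarrow> n = 0" by blast
    have "\<exists>m n :: int. n \<noteq> 0 \<and> of_int m * u + of_int n * v \<in> \<int>" if v: "circle_of v \<in> L" for v
    proof -
      obtain m n :: int where mn: "of_int m * u + of_int n * v \<in> \<int>" "m \<noteq> 0 \<or> n \<noteq> 0" using dep[OF u(1) v] by blast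
      have "n \<noteq> 0"
      proof
        assume "n = 0"
        then have "of_int m * u \<in> \<int>" using mn(1) by simp
        then show False using u(2) mn(2) \<open>n = 0\<close> by blast
      qed
      then show ?thesis using mn by blast
    qed
    then show ?thesis using u by blast
  qed
  then obtain u where u: "circle_of u \<in> L"
    "\<And>v. circle_of v \<in> L \<Longrightarrow> \<exists>m n :: int. n \<noteq> 0 \<and> of_int m * u + of_int n * v \<in> \<int>" by blast
  have "rat_rank (circle_group\<lparr>carrier := L\<rparr>) \<le> 1"
  proof (rule rat_rank_le_1[OF sub u(1)])
    fix v assume "circle_of v \<in> L"
    then obtain m n :: int where mn: "n \<noteq> 0" "of_int m * u + of_int n * v \<in> \<int>" using u(2) by blast
    then have "circle_of (of_int n * v) = circle_of (of_int (- m) * u)"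
      by (simp add: circle_of_eq_iff add.commute)
    then show "\<exists>m n :: int. n \<noteq> 0 \<and> circle_of (of_int n * v) = circle_of (of_int m * u)" using mn(1) by blast
  qed
  then have "(2::enat) \<le> 1" using rank by (rule order_trans[rotated])
  then show False by (simp add: numeral_eq_enat one_enat_def)
qed

section \<open>One-sided continuous representatives\<close>

text \<open>For maps with germs everywhere this is the representative of the class of
  \<open>f\<close> that is continuous from side \<open>e\<close>; elsewhere \<open>THE\<close> has
  no content.\<close>

definition sval :: "real \<Rightarrow> (circle \<Rightarrow> circle) \<Rightarrow> circle \<Rightarrow> circle" where
  "sval e f x = (THE w. germ e f x w)"

lemma sval_eqI: "germ e f x w \<Longrightarrow> sval e f x = w"
  unfolding sval_def by (rule the_equality) (auto intro: germ_unique)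

text \<open>Germs are required at every point, without an exceptional set, so they can be composed
  and inverted pointwise and are unaffected by finite changes.\<close>

definition regular :: "(circle \<Rightarrow> circle) \<Rightarrow> bool" where
  "regular f \<longleftrightarrow> f \<in> carrier PC_hat \<and> (\<forall>x e. \<bar>e\<bar> = 1 \<longrightarrow> (\<exists>w. germ e f x w))"

lemma regular_germ:
  assumes "regular f" "\<bar>e\<bar> = 1"
  shows "germ e f x (sval e f x)"
proof -
  obtain w where "germ e f x w" using assms unfolding regular_def by blast
  then show ?thesis using sval_eqI by metis
qed

text \<open>Two points with the same one-sided limit would give the inverse of \<open>f\<close> two
  germs there, so \<open>sval e f\<close> is injective. It differs from \<open>f\<close> at finitely
  many points only, and a finitely supported injection is surjective.\<close>

lemma regular_sval:
  assumes f: "regular f" and e: "\<bar>e\<bar> = 1"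
  shows "finite {x. f x \<noteq> sval e f x}" "bij (sval e f)" "sval e f \<in> carrier PC_hat"
    "germ e (sval e f) x (sval e f x)"
proof -
  have fP: "f \<in> carrier PC_hat" and b: "bij f" using f by (auto simp: regular_def PC_hat_simps)
  obtain F where F: "finite F" "\<And>x. x \<notin> F \<Longrightarrow> isCont f x" using fP by (auto simp: PC_hat_simps)
  have "f x = sval e f x" if "x \<notin> F" for x
    using germ_isCont[OF F(2)[OF that] regular_germ[OF f e]] by simp
  then show fin: "finite {x. f x \<noteq> sval e f x}" using F(1) by (rule_tac finite_subset[of _ F]) auto
  have inj: "inj (sval e f)"
  proof (rule injI)
    fix x y assume eq: "sval e f x = sval e f y"
    have "germ e (finv f) (sval e f x) x" "germ e (finv f) (sval e f x) y"
      using germ_inverse[OF b regular_germ[OF f e, of x]] germ_inverse[OF b regular_germ[OF f e, of y]] eq by simp_all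
    then show "x = y" by (rule germ_unique)
  qed
  have "bij (finv f \<circ> sval e f)"
  proof (rule bij_of_inj_finite_support)
    show "inj (finv f \<circ> sval e f)" by (intro inj_compose inj bij_is_inj bij_imp_bij_inv b)
    have "{x. (finv f \<circ> sval e f) x \<noteq> x} \<subseteq> {x. f x \<noteq> sval e f x}"
    proof
      fix x assume "x \<in> {x. (finv f \<circ> sval e f) x \<noteq> x}"
      then have "finv f (sval e f x) \<noteq> x" by simp
      then have "f x \<noteq> sval e f x" using b by (metis bij_is_inj inv_f_f)
      then show "x \<in> {x. f x \<noteq> sval e f x}" by simp
    qed
    then show "finite {x. (finv f \<circ> sval e f) x \<noteq> x}" using fin finite_subset by blast
  qed
  then have "bij (f \<circ> (finv f \<circ> sval e f))" using b by (rule bij_comp)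
  moreover have "f \<circ> (finv f \<circ> sval e f) = sval e f"
    using b by (simp add: fun_eq_iff bij_is_surj surj_f_inv_f)
  ultimately show bs: "bij (sval e f)" by simp
  show "sval e f \<in> carrier PC_hat" by (rule PC_hat_cong[OF fP bs fin])
  show "germ e (sval e f) x (sval e f x)" by (rule germ_cong[OF fin regular_germ[OF f e] e])
qed

text \<open>Where both one-sided limits equal \<open>f x\<close>, the inverse germs both lead to
  \<open>x\<close> and make \<open>finv f\<close> continuous at \<open>f x\<close>. Finitely many
  points remain.\<close>

lemma regular_inverse_PC_hat:
  assumes f: "regular f"
  shows "finv f \<in> carrier PC_hat"
proof -
  have b: "bij f" using f by (auto simp: regular_def PC_hat_simps)
  let ?E = "{x. f x \<noteq> sval 1 f x} \<union> {x. f x \<noteq> sval (-1) f x}"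
  have E: "finite ?E" using regular_sval(1)[OF f] by simp
  have "isCont (finv f) y" if y: "y \<notin> f ` ?E" for y
  proof -
    define x where "x = finv f y"
    have fx: "f x = y" using b by (simp add: x_def bij_is_surj surj_f_inv_f)
    have "x \<notin> ?E" using y fx by blast
    then have "sval 1 f x = y" "sval (-1) f x = y" using fx by simp_all
    then have "germ 1 f x y" "germ (-1) f x y"
      using regular_germ[OF f, of 1 x] regular_germ[OF f, of "-1" x] by simp_all
    then have "germ 1 (finv f) y x" "germ (-1) (finv f) y x" using germ_inverse[OF b] by blast+
    then show ?thesis unfolding x_def by (rule isCont_germ)
  qed
  then show ?thesis using b E finite_imageI[OF E, of f]
    unfolding PC_hat_simps by (intro conjI exI[of _ "f ` ?E"]) (auto simp: bij_imp_bij_inv)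
qed

section \<open>One-sided representatives as lifts, and the abstract classification\<close>

definition one_sided_reps :: "real \<Rightarrow> (circle \<Rightarrow> circle) set set \<Rightarrow> (circle \<Rightarrow> circle) set" where
  "one_sided_reps e \<Gamma> = {f \<in> carrier PC_hat. (\<forall>x. germ e f x (f x)) \<and> PC_proj f \<in> \<Gamma>}"

lemma one_sided_reps_eqI:
  assumes "f \<in> one_sided_reps e \<Gamma>" "g \<in> one_sided_reps e \<Gamma>" "finite {x. f x \<noteq> g x}" "\<bar>e\<bar> = 1"
  shows "f = g"
proof
  fix x
  have "germ e g x (f x)" using assms by (intro germ_cong[OF assms(3) _ assms(4)]) (simp add: one_sided_reps_def)
  moreover have "germ e g x (g x)" using assms by (simp add: one_sided_reps_def)
  ultimately show "f x = g x" by (rule germ_unique)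
qed

lemma Sym_fin_conj_finite:
  assumes "\<sigma> \<in> Sym_fin" "bij k"
  shows "finite {x. (\<sigma> \<circ> k \<circ> finv \<sigma>) x \<noteq> k x}"
proof -
  have s: "bij \<sigma>" "finite {x. \<sigma> x \<noteq> x}" using assms(1) by (auto simp: Sym_fin_def)
  have "finite {x. finv \<sigma> x \<noteq> finv id x}" using s by (intro finite_support_inv) auto
  then have "finite {x. finv \<sigma> x \<noteq> x}" by (simp add: inv_id)
  then show ?thesis
    using conj_finite_change[OF bij_imp_bij_inv[OF s(1)] _ assms(2)] inv_inv_eq[OF s(1)] by simp
qed

text \<open>Closure is demanded on representatives instead of in \<open>PC\<close>, so that
  \<open>IET_plus_on L\<close>, given as a set of classes, fits on the same footing as subgroups of
  \<open>PC\<close>.\<close>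

locale regular_classes =
  fixes \<Gamma> :: "(circle \<Rightarrow> circle) set set"
  assumes \<Gamma>_subset: "\<Gamma> \<subseteq> PC_proj ` carrier PC_hat"
    and \<Gamma>_regular: "f \<in> carrier PC_hat \<Longrightarrow> PC_proj f \<in> \<Gamma> \<Longrightarrow> regular f"
    and \<Gamma>_id: "PC_proj id \<in> \<Gamma>"
    and \<Gamma>_comp: "f \<in> carrier PC_hat \<Longrightarrow> g \<in> carrier PC_hat \<Longrightarrow> PC_proj f \<in> \<Gamma> \<Longrightarrow> PC_proj g \<in> \<Gamma> \<Longrightarrow>
      PC_proj (f \<circ> g) \<in> \<Gamma>"
    and \<Gamma>_inv: "f \<in> carrier PC_hat \<Longrightarrow> PC_proj f \<in> \<Gamma> \<Longrightarrow> PC_proj (finv f) \<in> \<Gamma>"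
begin

text \<open>\<open>left_continuous\<close> asserts only convergence. Regularity provides a germ, and
  uniqueness of limits identifies its target with \<open>f x\<close>.\<close>

lemma left_reps_eq: "left_reps \<Gamma> = one_sided_reps (-1) \<Gamma>"
proof -
  have "left_continuous f \<longleftrightarrow> (\<forall>x. germ (-1) f x (f x))" if "f \<in> carrier PC_hat" "PC_proj f \<in> \<Gamma>" for f
  proof
    assume l: "left_continuous f"
    show "\<forall>x. germ (-1) f x (f x)"
    proof
      fix x
      have g: "germ (-1) f x (sval (-1) f x)" by (rule regular_germ[OF \<Gamma>_regular[OF that]]) simp
      have "((\<lambda>s. f (x + circle_of (-1 * s))) \<longlongrightarrow> f x) (at_right 0)" using l left_continuous_tendsto by blast
      then have "f x = sval (-1) f x" using germ_tendsto[OF g] by (rule tendsto_unique[rotated]) simp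
      then show "germ (-1) f x (f x)" using g by simp
    qed
  qed (use left_continuous_tendsto germ_tendsto in blast)
  then show ?thesis unfolding left_reps_def one_sided_reps_def by blast
qed

lemma right_reps_eq: "right_reps \<Gamma> = one_sided_reps 1 \<Gamma>"
proof -
  have "right_continuous f \<longleftrightarrow> (\<forall>x. germ 1 f x (f x))" if "f \<in> carrier PC_hat" "PC_proj f \<in> \<Gamma>" for f
  proof
    assume l: "right_continuous f"
    show "\<forall>x. germ 1 f x (f x)"
    proof
      fix x
      have g: "germ 1 f x (sval 1 f x)" by (rule regular_germ[OF \<Gamma>_regular[OF that]]) simp
      have "((\<lambda>s. f (x + circle_of (1 * s))) \<longlongrightarrow> f x) (at_right 0)" using l right_continuous_tendsto by blast
      then have "f x = sval 1 f x" using germ_tendsto[OF g] by (rule tendsto_unique[rotated]) simp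
      then show "germ 1 f x (f x)" using g by simp
    qed
  qed (use right_continuous_tendsto germ_tendsto in blast)
  then show ?thesis unfolding right_reps_def one_sided_reps_def by blast
qed

text \<open>The inverse in \<open>PC_hat\<close> is the functional inverse here because the elements
  of \<open>H\<close> represent classes in \<open>\<Gamma>\<close> and are therefore
  regular.\<close>

lemma lifts_iff:
  "lifts H \<Gamma> \<longleftrightarrow> H \<subseteq> carrier PC_hat \<and> id \<in> H \<and> (\<forall>f\<in>H. \<forall>g\<in>H. f \<circ> g \<in> H) \<and> (\<forall>f\<in>H. finv f \<in> H) \<and>
    (\<forall>f\<in>H. \<forall>g\<in>H. finite {x. f x \<noteq> g x} \<longrightarrow> f = g) \<and> PC_proj ` H = \<Gamma>" (is "_ \<longleftrightarrow> ?R")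
proof -
  have inv: "inv\<^bsub>PC_hat\<^esub> f = finv f" if "H \<subseteq> carrier PC_hat" "PC_proj ` H = \<Gamma>" "f \<in> H" for f
  proof -
    have "f \<in> carrier PC_hat" "PC_proj f \<in> \<Gamma>" using that by auto
    then show ?thesis using PC_hat_inv regular_inverse_PC_hat[OF \<Gamma>_regular] by blast
  qed
  have inj: "inj_on PC_proj H \<longleftrightarrow> (\<forall>f\<in>H. \<forall>g\<in>H. finite {x. f x \<noteq> g x} \<longrightarrow> f = g)" if "H \<subseteq> carrier PC_hat"
  proof -
    have "PC_proj f = PC_proj g \<longleftrightarrow> finite {x. f x \<noteq> g x}" if "f \<in> H" "g \<in> H" for f g
      using PC_proj_eq_iff that \<open>H \<subseteq> carrier PC_hat\<close> PC_hat_bij by blast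
    then show ?thesis unfolding inj_on_def by blast
  qed
  show ?thesis
  proof
    assume l: "lifts H \<Gamma>"
    then have s: "subgroup H PC_hat" and b: "inj_on PC_proj H" "PC_proj ` H = \<Gamma>"
      unfolding lifts_def bij_betw_def by blast+
    have "H \<subseteq> carrier PC_hat" using s by (rule subgroup.subset)
    moreover have "id \<in> H" using subgroup.one_closed[OF s] by (simp add: PC_hat_simps(3))
    moreover have "f \<circ> g \<in> H" if "f \<in> H" "g \<in> H" for f g
      using subgroup.m_closed[OF s that] by (simp add: PC_hat_simps(2))
    moreover have "finv f \<in> H" if "f \<in> H" for f
      using subgroup.m_inv_closed[OF s that] inv[OF \<open>H \<subseteq> carrier PC_hat\<close> b(2) that] by (simp only:)
    moreover have "\<forall>f\<in>H. \<forall>g\<in>H. finite {x. f x \<noteq> g x} \<longrightarrow> f = g"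
      using inj[OF \<open>H \<subseteq> carrier PC_hat\<close>] b(1) by (simp only:)
    ultimately show ?R using b(2) by (intro conjI ballI) (blast | assumption)+
  next
    assume r: ?R
    then have H: "H \<subseteq> carrier PC_hat" "PC_proj ` H = \<Gamma>" by blast+
    have cl: "id \<in> H" "\<And>x y. x \<in> H \<Longrightarrow> y \<in> H \<Longrightarrow> x \<circ> y \<in> H" "\<And>x. x \<in> H \<Longrightarrow> finv x \<in> H"
      using r by blast+
    have "subgroup H PC_hat"
    proof (rule subgroup.intro)
      show "H \<subseteq> carrier PC_hat" by (rule H)
      show "\<one>\<^bsub>PC_hat\<^esub> \<in> H" using cl(1) by (simp only: PC_hat_simps(3))
      show "x \<otimes>\<^bsub>PC_hat\<^esub> y \<in> H" if "x \<in> H" "y \<in> H" for x y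
        using cl(2)[OF that] by (simp only: PC_hat_simps(2))
      show "inv\<^bsub>PC_hat\<^esub> x \<in> H" if "x \<in> H" for x using cl(3)[OF that] inv[OF H that] by (simp only:)
    qed
    moreover have "inj_on PC_proj H" unfolding inj[OF H(1)] using r by (elim conjE)
    ultimately show "lifts H \<Gamma>" unfolding lifts_def bij_betw_def using H(2) by (intro conjI)
  qed
qed

lemma lifts_one_sided_reps:
  assumes e: "\<bar>e\<bar> = 1"
  shows "lifts (one_sided_reps e \<Gamma>) \<Gamma>"
  unfolding lifts_iff
proof (intro conjI ballI impI)
  show "one_sided_reps e \<Gamma> \<subseteq> carrier PC_hat" by (auto simp: one_sided_reps_def)
  show "id \<in> one_sided_reps e \<Gamma>"
    using germ_id[of e] \<Gamma>_id id_in_PC_hat by (simp add: one_sided_reps_def)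
  show "PC_proj ` one_sided_reps e \<Gamma> = \<Gamma>"
  proof (intro equalityI subsetI)
    fix \<phi> assume "\<phi> \<in> \<Gamma>"
    then obtain f where f: "f \<in> carrier PC_hat" "\<phi> = PC_proj f" "PC_proj f \<in> \<Gamma>" using \<Gamma>_subset by blast
    have r: "regular f" using \<Gamma>_regular f by blast
    have "PC_proj (sval e f) = PC_proj f"
      using PC_proj_eq_iff[OF regular_sval(2)[OF r e] PC_hat_bij[OF f(1)]] finite_support_sym[OF regular_sval(1)[OF r e]] by blast
    moreover from this have "sval e f \<in> one_sided_reps e \<Gamma>"
      using regular_sval(3,4)[OF r e] f(3) by (simp add: one_sided_reps_def)
    ultimately show "\<phi> \<in> PC_proj ` one_sided_reps e \<Gamma>" using f(2) by (metis imageI)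
  qed (auto simp: one_sided_reps_def)
next
  fix f g assume "f \<in> one_sided_reps e \<Gamma>" "g \<in> one_sided_reps e \<Gamma>"
  then have f: "f \<in> carrier PC_hat" "PC_proj f \<in> \<Gamma>" "\<And>x. germ e f x (f x)"
    and g: "g \<in> carrier PC_hat" "PC_proj g \<in> \<Gamma>" "\<And>x. germ e g x (g x)"
    by (auto simp: one_sided_reps_def)
  have "germ e (f \<circ> g) x ((f \<circ> g) x)" for x using germ_comp[OF g(3) f(3)] by simp
  then show "f \<circ> g \<in> one_sided_reps e \<Gamma>"
    using PC_hat_comp[OF g(1) f(1)] \<Gamma>_comp[OF f(1) g(1) f(2) g(2)] by (simp add: one_sided_reps_def)
next
  fix f assume "f \<in> one_sided_reps e \<Gamma>"
  then have f: "f \<in> carrier PC_hat" "PC_proj f \<in> \<Gamma>" "\<And>x. germ e f x (f x)"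
    by (auto simp: one_sided_reps_def)
  have b: "bij f" by (rule PC_hat_bij[OF f(1)])
  have "germ e (finv f) y (finv f y)" for y
  proof -
    have "germ e f (finv f y) y" using f(3)[of "finv f y"] b by (simp add: bij_is_surj surj_f_inv_f)
    then show ?thesis by (rule germ_inverse[OF b])
  qed
  then show "finv f \<in> one_sided_reps e \<Gamma>"
    using regular_inverse_PC_hat[OF \<Gamma>_regular[OF f(1,2)]] \<Gamma>_inv[OF f(1,2)] by (simp add: one_sided_reps_def)
next
  fix f g assume "f \<in> one_sided_reps e \<Gamma>" "g \<in> one_sided_reps e \<Gamma>" "finite {x. f x \<noteq> g x}"
  then show "f = g" using e by (rule one_sided_reps_eqI)
qed

lemma lifts_conj_by:
  assumes l: "lifts H \<Gamma>" and s: "\<sigma> \<in> Sym_fin"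
  shows "lifts (conj_by \<sigma> H) \<Gamma>"
proof -
  define c where "c k = \<sigma> \<circ> k \<circ> finv \<sigma>" for k
  have b: "bij \<sigma>" using s by (simp add: Sym_fin_def)
  have hh: "\<sigma> (finv \<sigma> x) = x" "finv \<sigma> (\<sigma> x) = x" for x
    using b by (simp_all add: bij_is_inj bij_is_surj surj_f_inv_f)
  have H: "H \<subseteq> carrier PC_hat" "id \<in> H" "\<And>f g. f \<in> H \<Longrightarrow> g \<in> H \<Longrightarrow> f \<circ> g \<in> H" "\<And>f. f \<in> H \<Longrightarrow> finv f \<in> H"
    "\<And>f g. f \<in> H \<Longrightarrow> g \<in> H \<Longrightarrow> finite {x. f x \<noteq> g x} \<Longrightarrow> f = g" "PC_proj ` H = \<Gamma>"
    using l unfolding lifts_iff by blast+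
  have Hb: "bij f" if "f \<in> H" for f using H(1) that PC_hat_bij by blast
  have c_bij: "bij (c k)" if "k \<in> H" for k
    unfolding c_def by (intro bij_comp b bij_imp_bij_inv Hb that)
  have fin: "finite {x. c k x \<noteq> k x}" if "k \<in> H" for k
    unfolding c_def by (rule Sym_fin_conj_finite[OF s Hb[OF that]])
  have c_proj: "PC_proj (c k) = PC_proj k" if "k \<in> H" for k
    using PC_proj_eq_iff[OF c_bij Hb] fin that by blast
  have c_inv: "finv (c k) = c (finv k)" if "k \<in> H" for k
  proof (rule inv_unique_comp)
    have "k (finv k x) = x" "finv k (k x) = x" for x
      using Hb[OF that] by (simp_all add: bij_is_inj bij_is_surj surj_f_inv_f)
    then show "c k \<circ> c (finv k) = id" "c (finv k) \<circ> c k = id"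
      by (simp_all add: c_def fun_eq_iff hh)
  qed
  have cH: "conj_by \<sigma> H = c ` H" by (simp add: conj_by_def c_def)
  show ?thesis unfolding lifts_iff cH
  proof (intro conjI)
    show "c ` H \<subseteq> carrier PC_hat"
    proof
      fix f assume "f \<in> c ` H"
      then obtain k where k: "k \<in> H" "f = c k" by blast
      then show "f \<in> carrier PC_hat"
        using PC_hat_cong[OF subsetD[OF H(1) k(1)] c_bij[OF k(1)] finite_support_sym[OF fin[OF k(1)]]] by simp
    qed
    have "c id = id" by (simp add: c_def fun_eq_iff hh)
    then show "id \<in> c ` H" using H(2) by (metis imageI)
    have "c f \<circ> c g = c (f \<circ> g)" for f g by (simp add: c_def fun_eq_iff hh)
    then show "\<forall>f\<in>c ` H. \<forall>g\<in>c ` H. f \<circ> g \<in> c ` H" using H(3) by auto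
    show "\<forall>f\<in>c ` H. finv f \<in> c ` H" using H(4) c_inv by auto
    have "c f = c g" if fg: "f \<in> H" "g \<in> H" "finite {x. c f x \<noteq> c g x}" for f g
    proof -
      have "finite {x. f x \<noteq> g x}"
        by (rule finite_support_trans[OF finite_support_sym[OF fin[OF fg(1)]]
              finite_support_trans[OF fg(3) fin[OF fg(2)]]])
      then have "f = g" using H(5) fg by blast
      then show ?thesis by simp
    qed
    then show "\<forall>f\<in>c ` H. \<forall>g\<in>c ` H. finite {x. f x \<noteq> g x} \<longrightarrow> f = g" by blast
    show "PC_proj ` c ` H = \<Gamma>" unfolding H(6)[symmetric] image_image
      by (rule image_cong[OF refl c_proj])
  qed
qed

end

locale rich_classes = regular_classes +
  fixes L :: "circle set"
  assumes L_add: "a \<in> L \<Longrightarrow> b \<in> L \<Longrightarrow> a + b \<in> L"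
    and L_minus: "a \<in> L \<Longrightarrow> - a \<in> L"
    and L_indep: "\<exists>p q. circle_of p \<in> L \<and> circle_of q \<in> L \<and>
      independent_mod_1 p q"
    and \<Gamma>_rot: "a \<in> L \<Longrightarrow> PC_proj (\<lambda>x. x + a) \<in> \<Gamma>"
    and \<Gamma>_swap: "0 < l \<Longrightarrow> 2 * l < 1 \<Longrightarrow> circle_of l \<in> L \<Longrightarrow> PC_proj (swap l) \<in> \<Gamma>"
    and \<Gamma>_cont: "f \<in> carrier PC_hat \<Longrightarrow> PC_proj f \<in> \<Gamma> \<Longrightarrow> x \<notin> L \<Longrightarrow> germ 1 f x w \<Longrightarrow> germ (-1) f x w' \<Longrightarrow> w = w'"
begin

lemma lift_is_conj_one_sided:
  assumes l: "lifts H \<Gamma>"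
  shows "\<exists>\<sigma>\<in>Sym_fin. \<exists>e. \<bar>e\<bar> = 1 \<and> H = conj_by \<sigma> (one_sided_reps e \<Gamma>)"
proof -
  have H: "H \<subseteq> carrier PC_hat" "id \<in> H" "\<And>f g. f \<in> H \<Longrightarrow> g \<in> H \<Longrightarrow> f \<circ> g \<in> H" "\<And>f. f \<in> H \<Longrightarrow> finv f \<in> H"
    "\<And>f g. f \<in> H \<Longrightarrow> g \<in> H \<Longrightarrow> finite {x. f x \<noteq> g x} \<Longrightarrow> f = g" "PC_proj ` H = \<Gamma>"
    using l unfolding lifts_iff by blast+
  have Hb: "bij f" if "f \<in> H" for f using H(1) that PC_hat_bij by blast
  have HP: "f \<in> carrier PC_hat" "PC_proj f \<in> \<Gamma>" if "f \<in> H" for f using H(1,6) that by auto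
  have lift: "\<exists>f\<in>H. finite {x. f x \<noteq> g x}" if g: "bij g" "PC_proj g \<in> \<Gamma>" for g
  proof -
    obtain f where f: "f \<in> H" "PC_proj f = PC_proj g" using g(2) unfolding H(6)[symmetric] by (metis imageE)
    then have "finite {x. f x \<noteq> g x}" using PC_proj_eq_iff[OF Hb[OF f(1)] g(1)] by blast
    then show ?thesis using f(1) by blast
  qed
  have rot_bij: "bij (\<lambda>x. x + a)" for a :: circle by (rule bij_betwI[of _ _ _ "\<lambda>y. y - a"]) auto
  interpret permutation_lift H L
  proof unfold_locales
    show "\<exists>w. germ e f x w" if "f \<in> H" "\<bar>e\<bar> = 1" for f e x
      using \<Gamma>_regular[OF HP[OF that(1)]] that(2) unfolding regular_def by blast
    show "\<exists>p q. circle_of p \<in> L \<and> circle_of q \<in> L \<and>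
      independent_mod_1 p q" by (rule L_indep)
    show "w = w'" if "f \<in> H" "x \<notin> L" "germ 1 f x w" "germ (-1) f x w'" for f x w w'
      by (rule \<Gamma>_cont[OF HP[OF that(1)] that(2-4)])
    show "\<exists>f\<in>H. finite {x. f x \<noteq> x + a}" if "a \<in> L" for a
      by (rule lift[OF rot_bij \<Gamma>_rot[OF that]])
  qed (fact Hb H L_add L_minus)+
  have swap: "\<exists>f\<in>H. finite {x. f x \<noteq> swap l x}" if "0 < l" "2 * l < 1" "circle_of l \<in> L" for l
    using lift[OF swap_bij \<Gamma>_swap[OF that]] that by simp
  obtain h e where h: "bij h" "finite {x. h x \<noteq> x}" "\<bar>e\<bar> = 1"
    "\<And>k x. k \<in> H \<Longrightarrow> germ e (finv h \<circ> k \<circ> h) x ((finv h \<circ> k \<circ> h) x)"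
    using conj_one_sided_continuous[OF swap] by blast
  have hh: "h (finv h x) = x" "finv h (h x) = x" for x
    using h(1) by (simp_all add: bij_is_inj bij_is_surj surj_f_inv_f)
  have fin: "finite {x. (finv h \<circ> k \<circ> h) x \<noteq> k x}" if "k \<in> H" for k
    by (rule conj_finite_change[OF h(1,2) Hb[OF that]])
  have rep: "finv h \<circ> k \<circ> h \<in> one_sided_reps e \<Gamma>" if k: "k \<in> H" for k
  proof -
    have b: "bij (finv h \<circ> k \<circ> h)" by (intro bij_comp h bij_imp_bij_inv Hb k)
    have p: "PC_proj (finv h \<circ> k \<circ> h) = PC_proj k" using PC_proj_eq_iff[OF b Hb[OF k]] fin[OF k] by blast
    have c: "finv h \<circ> k \<circ> h \<in> carrier PC_hat"
      by (rule PC_hat_cong[OF HP(1)[OF k] b finite_support_sym[OF fin[OF k]]])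
    show ?thesis unfolding one_sided_reps_def
      by (intro CollectI conjI allI c h(4)[OF k]) (simp only: p HP(2)[OF k])
  qed
  have "H = conj_by h (one_sided_reps e \<Gamma>)"
  proof (intro equalityI subsetI)
    fix k assume k: "k \<in> H"
    have "k = h \<circ> (finv h \<circ> k \<circ> h) \<circ> finv h" by (simp add: fun_eq_iff hh)
    then show "k \<in> conj_by h (one_sided_reps e \<Gamma>)" unfolding conj_by_def using rep[OF k] by (rule image_eqI)
  next
    fix k assume "k \<in> conj_by h (one_sided_reps e \<Gamma>)"
    then obtain f where f: "f \<in> one_sided_reps e \<Gamma>" "k = h \<circ> f \<circ> finv h" unfolding conj_by_def by blast
    then have fP: "f \<in> carrier PC_hat" "PC_proj f \<in> \<Gamma>" by (auto simp: one_sided_reps_def)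
    \<comment> \<open>Conjugated back by \<open>h\<close>, the lift \<open>k'\<close> of the class
      of \<open>f\<close> is a one-sided representative of that class, hence equal to
      \<open>f\<close>.\<close>
    obtain k' where k': "k' \<in> H" "finite {x. k' x \<noteq> f x}" using lift[OF PC_hat_bij fP(2)] fP(1) by blast
    have "finv h \<circ> k' \<circ> h = f"
      by (rule one_sided_reps_eqI[OF rep[OF k'(1)] f(1) finite_support_trans[OF fin[OF k'(1)] k'(2)] h(3)])
    then have "k = h \<circ> (finv h \<circ> k' \<circ> h) \<circ> finv h" unfolding f(2) by (simp only:)
    also have "\<dots> = k'" by (simp add: fun_eq_iff hh)
    finally have "k = k'" .
    then show "k \<in> H" using k' by simp
  qed
  moreover have "h \<in> Sym_fin" using h by (simp add: Sym_fin_def)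
  ultimately show ?thesis using h(3) by blast
qed

theorem lifts_classification:
  "lifts H \<Gamma> \<longleftrightarrow> (\<exists>\<sigma>\<in>Sym_fin. H = conj_by \<sigma> (left_reps \<Gamma>) \<or> H = conj_by \<sigma> (right_reps \<Gamma>))"
proof
  assume "lifts H \<Gamma>"
  then obtain \<sigma> e where s: "\<sigma> \<in> Sym_fin" "\<bar>e\<bar> = 1" "H = conj_by \<sigma> (one_sided_reps e \<Gamma>)"
    using lift_is_conj_one_sided by blast
  have "e = 1 \<or> e = -1" using s(2) by linarith
  then have "H = conj_by \<sigma> (left_reps \<Gamma>) \<or> H = conj_by \<sigma> (right_reps \<Gamma>)"
    unfolding left_reps_eq right_reps_eq using s(3) by (elim disjE) (simp_all only: simp_thms)
  then show "\<exists>\<sigma>\<in>Sym_fin. H = conj_by \<sigma> (left_reps \<Gamma>) \<or> H = conj_by \<sigma> (right_reps \<Gamma>)"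
    using s(1) by (rule bexI)
next
  assume "\<exists>\<sigma>\<in>Sym_fin. H = conj_by \<sigma> (left_reps \<Gamma>) \<or> H = conj_by \<sigma> (right_reps \<Gamma>)"
  then obtain \<sigma> where s: "\<sigma> \<in> Sym_fin"
    "H = conj_by \<sigma> (one_sided_reps (-1) \<Gamma>) \<or> H = conj_by \<sigma> (one_sided_reps 1 \<Gamma>)"
    unfolding left_reps_eq right_reps_eq by (elim bexE)
  have "lifts (conj_by \<sigma> (one_sided_reps e \<Gamma>)) \<Gamma>" if "\<bar>e\<bar> = 1" for e
    by (rule lifts_conj_by[OF lifts_one_sided_reps[OF that] s(1)])
  from s(2) this[of "-1"] this[of 1] show "lifts H \<Gamma>" by (elim disjE) simp_all
qed

end

section \<open>Interval exchanges\<close>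

text \<open>A germ that is a translation. It records the displacement \<open>c\<close>, which
  \<open>IET_plus_on\<close> restricts, instead of the limit.\<close>

definition tgerm :: "real \<Rightarrow> (circle \<Rightarrow> circle) \<Rightarrow> circle \<Rightarrow> circle \<Rightarrow> bool" where
  "tgerm e f x c \<longleftrightarrow> (\<exists>d>0. \<forall>s. 0 < s \<and> s < d \<longrightarrow> f (x + circle_of (e * s)) = x + c + circle_of (e * s))"

lemma tgerm_germ:
  assumes "tgerm e f x c"
  shows "germ e f x (x + c)"
proof -
  obtain d where d: "0 < d" "\<And>s. 0 < s \<Longrightarrow> s < d \<Longrightarrow> f (x + circle_of (e * s)) = x + c + circle_of (e * s)"
    using assms unfolding tgerm_def by blast
  show ?thesis by (rule germ_translation[of "d/2"]) (use d in auto)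
qed

lemma tgerm_comp:
  assumes "tgerm e f x c" "tgerm e h (x + c) c'"
  shows "tgerm e (h \<circ> f) x (c + c')"
proof -
  obtain d where d: "0 < d" "\<And>s. 0 < s \<Longrightarrow> s < d \<Longrightarrow> f (x + circle_of (e * s)) = x + c + circle_of (e * s)"
    using assms(1) unfolding tgerm_def by blast
  obtain d' where d': "0 < d'" "\<And>s. 0 < s \<Longrightarrow> s < d' \<Longrightarrow> h (x + c + circle_of (e * s)) = x + c + c' + circle_of (e * s)"
    using assms(2) unfolding tgerm_def by blast
  show ?thesis unfolding tgerm_def
    by (rule exI[of _ "min d d'"]) (use d d' in \<open>simp add: add.assoc\<close>)
qed

lemma tgerm_inverse:
  assumes "bij f" "tgerm e f x c"
  shows "tgerm e (finv f) (x + c) (- c)"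
proof -
  obtain d where d: "0 < d" "\<And>s. 0 < s \<Longrightarrow> s < d \<Longrightarrow> f (x + circle_of (e * s)) = x + c + circle_of (e * s)"
    using assms(2) unfolding tgerm_def by blast
  have "finv f (x + c + circle_of (e * s)) = x + c + - c + circle_of (e * s)" if "0 < s" "s < d" for s
  proof -
    have "finv f (f (x + circle_of (e * s))) = x + circle_of (e * s)" using assms(1) by (simp add: bij_is_inj)
    then show ?thesis unfolding d(2)[OF that] by simp
  qed
  then show ?thesis using d(1) unfolding tgerm_def by blast
qed

lemma tgerm_cong:
  assumes "finite {y. f y \<noteq> h y}" "tgerm e f x c" "\<bar>e\<bar> = 1"
  shows "tgerm e h x c"
proof -
  obtain d where d: "0 < d" "\<And>s. 0 < s \<Longrightarrow> s < d \<Longrightarrow> f (x + circle_of (e * s)) = x + c + circle_of (e * s)"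
    using assms(2) unfolding tgerm_def by blast
  obtain d' where d': "0 < d'" "\<And>s. s \<noteq> 0 \<Longrightarrow> \<bar>s\<bar> < d' \<Longrightarrow> x + circle_of s \<notin> {y. f y \<noteq> h y}"
    using finite_circle_avoid[OF assms(1)] by blast
  have "h (x + circle_of (e * s)) = x + c + circle_of (e * s)" if s: "0 < s" "s < min d d'" for s
  proof -
    have "e * s \<noteq> 0" "\<bar>e * s\<bar> < d'" using s assms(3) by (auto simp: abs_mult)
    then have "f (x + circle_of (e * s)) = h (x + circle_of (e * s))" using d'(2) by blast
    then show ?thesis using d(2)[of s] s by simp
  qed
  then show ?thesis unfolding tgerm_def using d(1) d'(1) by (intro exI[of _ "min d d'"]) simp
qed

text \<open>One-sided description of the representatives of elements of \<open>IET_plus_on L\<close>.\<close>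

definition exchange :: "circle set \<Rightarrow> (circle \<Rightarrow> circle) \<Rightarrow> bool" where
  "exchange L f \<longleftrightarrow> f \<in> carrier PC_hat \<and> (\<forall>x e. \<bar>e\<bar> = 1 \<longrightarrow> (\<exists>c\<in>L. tgerm e f x c)) \<and>
     (\<forall>x w w'. x \<notin> L \<longrightarrow> germ 1 f x w \<longrightarrow> germ (-1) f x w' \<longrightarrow> w = w')"

lemma exchange_regular: "exchange L f \<Longrightarrow> regular f"
  unfolding exchange_def regular_def using tgerm_germ by blast

text \<open>The displacement \<open>f y - y\<close> is locally constant on a one-sided open arc that
  avoids the exceptional set, hence constant there by connectedness.\<close>

lemma piecewise_translation_tgerm:
  assumes f: "piecewise_translation_by L f" and e: "\<bar>e\<bar> = 1"
  shows "\<exists>c\<in>L. tgerm e f x c"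
proof -
  obtain F where F: "finite F" "\<And>x. x \<notin> F \<Longrightarrow> \<exists>c\<in>L. \<forall>\<^sub>F y in nhds x. f y = y + c"
    using f unfolding piecewise_translation_by_def by blast
  obtain d where d: "0 < d" "\<And>s. s \<noteq> 0 \<Longrightarrow> \<bar>s\<bar> < d \<Longrightarrow> x + circle_of s \<notin> F"
    using finite_circle_avoid[OF F(1)] by blast
  define u where "u s = f (x + circle_of (e * s)) - (x + circle_of (e * s))" for s
  have loc: "\<exists>c\<in>L. \<exists>h>0. \<forall>r. \<bar>r - s\<bar> < h \<longrightarrow> u r = c" if s: "0 < s" "s < d" for s
  proof -
    have "e * s \<noteq> 0" "\<bar>e * s\<bar> < d" using s e by (auto simp: abs_mult)
    then obtain c where c: "c \<in> L" "\<forall>\<^sub>F y in nhds (x + circle_of (e * s)). f y = y + c" using F(2) d(2) by blast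
    then obtain h where h: "0 < h" "\<And>t. \<bar>t\<bar> < h \<Longrightarrow> f (x + circle_of (e * s) + circle_of t) = x + circle_of (e * s) + circle_of t + c"
      unfolding eventually_nhds_circle by blast
    have "u r = c" if r: "\<bar>r - s\<bar> < h" for r
    proof -
      have "\<bar>e * (r - s)\<bar> < h" using r e by (simp add: abs_mult)
      moreover have "x + circle_of (e * s) + circle_of (e * (r - s)) = x + circle_of (e * r)"
        by (simp add: right_diff_distrib circle_of_diff)
      ultimately have "f (x + circle_of (e * r)) = x + circle_of (e * r) + c" using h(2) by metis
      then show ?thesis by (simp add: u_def)
    qed
    then show ?thesis using c(1) h(1) by blast
  qed
  have const: "u a = u b" if ab: "0 < a" "a \<le> b" "b < d" for a b
    using ab(2)
  proof (induction rule: Bolzano)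
    case (local s)
    then have "0 < s" "s < d" using ab by auto
    then obtain c h where h: "0 < h" "\<And>r. \<bar>r - s\<bar> < h \<Longrightarrow> u r = c" using loc by metis
    have "u a' = u b'" if "a' \<le> s \<and> s \<le> b' \<and> b' - a' < h" for a' b' using h(2)[of a'] h(2)[of b'] that by auto
    then show ?case using h(1) by blast
  qed simp
  have d2: "0 < d / 2" "d / 2 < d" using d by auto
  obtain c where c: "c \<in> L" "u (d/2) = c" using loc[OF d2] by (metis abs_zero cancel_comm_monoid_add_class.diff_cancel)
  have "u s = c" if "0 < s" "s < d" for s
    using const[of s "d/2"] const[of "d/2" s] that d2 c(2) by (cases "s \<le> d/2") auto
  then have "f (x + circle_of (e * s)) = x + c + circle_of (e * s)" if "0 < s" "s < d" for s
    using that unfolding u_def by (simp add: diff_eq_eq add_ac)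
  then show ?thesis using c(1) d(1) unfolding tgerm_def by blast
qed

text \<open>The conditions of \<open>IET_plus_on\<close> refer to different representatives of the
  class; germs do not depend on that choice. Conversely, at a continuity point of \<open>f\<close>
  both one-sided displacements equal \<open>f x - x\<close>, so the translations on the two sides
  fit together.\<close>

lemma exchange_iff:
  assumes f: "f \<in> carrier PC_hat"
  shows "PC_proj f \<in> IET_plus_on L \<longleftrightarrow> exchange L f"
proof
  have fb: "bij f" by (rule PC_hat_bij[OF f])
  assume "PC_proj f \<in> IET_plus_on L"
  then have disc: "\<And>x. x \<notin> L \<Longrightarrow> \<exists>g\<in>PC_proj f. isCont g x" and "\<exists>g\<in>PC_proj f. piecewise_translation_by L g"
    unfolding IET_plus_on_def discontinuity_def by blast+
  then obtain g where "g \<in> PC_proj f" and g: "piecewise_translation_by L g" by blast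
  then have fg: "finite {x. f x \<noteq> g x}" using fb by (simp add: PC_proj_eq)
  have "\<exists>c\<in>L. tgerm e f x c" if "\<bar>e\<bar> = 1" for e x
    using piecewise_translation_tgerm[OF g that] tgerm_cong[OF finite_support_sym[OF fg] _ that] by blast
  moreover have "w = w'" if w: "x \<notin> L" "germ 1 f x w" "germ (-1) f x w'" for x w w'
  proof -
    obtain k where k: "k \<in> PC_proj f" "isCont k x" using disc[OF w(1)] by blast
    then have fk: "finite {x. f x \<noteq> k x}" using fb by (simp add: PC_proj_eq)
    have "w = k x" by (rule germ_isCont[OF k(2) germ_cong[OF fk w(2)]]) simp
    moreover have "w' = k x" by (rule germ_isCont[OF k(2) germ_cong[OF fk w(3)]]) simp
    ultimately show ?thesis by simp
  qed
  ultimately show "exchange L f" unfolding exchange_def using f by blast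
next
  assume ex: "exchange L f"
  have fb: "bij f" by (rule PC_hat_bij[OF f])
  have reg: "regular f" by (rule exchange_regular[OF ex])
  obtain F where F: "finite F" "\<And>x. x \<notin> F \<Longrightarrow> isCont f x" using f by (auto simp: PC_hat_simps)
  have "\<exists>c\<in>L. \<forall>\<^sub>F y in nhds x. f y = y + c" if x: "x \<notin> F" for x
  proof -
    obtain c where c: "c \<in> L" "tgerm 1 f x c" using ex unfolding exchange_def by (metis abs_1)
    obtain c' where c': "c' \<in> L" "tgerm (-1) f x c'" using ex unfolding exchange_def by (metis abs_1 abs_minus_cancel)
    have fx: "x + c = f x" "x + c' = f x"
      using germ_isCont[OF F(2)[OF x] tgerm_germ[OF c(2)]] germ_isCont[OF F(2)[OF x] tgerm_germ[OF c'(2)]] by auto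
    then have "c' = c" by (metis add_left_cancel)
    obtain d where d: "0 < d" "\<And>s. 0 < s \<Longrightarrow> s < d \<Longrightarrow> f (x + circle_of (1 * s)) = x + c + circle_of (1 * s)"
      using c(2) unfolding tgerm_def by blast
    obtain d' where d': "0 < d'" "\<And>s. 0 < s \<Longrightarrow> s < d' \<Longrightarrow> f (x + circle_of (-1 * s)) = x + c + circle_of (-1 * s)"
      using c'(2) unfolding tgerm_def \<open>c' = c\<close> by blast
    have "f (x + circle_of s) = x + circle_of s + c" if "\<bar>s\<bar> < min d d'" for s
    proof -
      consider "s = 0" | "0 < s" | "s < 0" by linarith
      then have "f (x + circle_of s) = x + c + circle_of s"
      proof cases
        case 1 then show ?thesis using fx by (simp add: circle_of_0)
      next
        case 2 then show ?thesis using d(2)[of s] that by simp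
      next
        case 3 then show ?thesis using d'(2)[of "- s"] that by simp
      qed
      then show ?thesis by (simp add: add_ac)
    qed
    then show ?thesis using c(1) d(1) d'(1) unfolding eventually_nhds_circle
      by (intro bexI[of _ c] exI[of _ "min d d'"]) auto
  qed
  then have pt: "piecewise_translation_by L f" unfolding piecewise_translation_by_def using F(1) by blast
  have "PC_proj f \<in> IET_plus" unfolding IET_plus_def
  proof (rule imageI, intro CollectI conjI f)
    show "piecewise_translation_by UNIV f" using pt unfolding piecewise_translation_by_def by blast
  qed
  moreover have "f \<in> PC_proj f" using fb by (simp add: PC_proj_eq)
  moreover have "x \<in> L" if "discontinuity (PC_proj f) x" for x
  proof (rule ccontr)
    assume x: "x \<notin> L"
    have g: "germ 1 f x (sval 1 f x)" "germ (-1) f x (sval (-1) f x)" by (rule regular_germ[OF reg], simp)+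
    then have "sval 1 f x = sval (-1) f x" using ex x unfolding exchange_def by blast
    then have g2: "germ (-1) f x (sval 1 f x)" using g(2) by simp
    have fin: "finite {x. f x \<noteq> sval 1 f x}" and b: "bij (sval 1 f)" using regular_sval[OF reg, of 1] by simp_all
    \<comment> \<open>Outside \<open>L\<close> both limits agree, so the right-continuous
      representative is continuous at \<open>x\<close>.\<close>
    have "isCont (sval 1 f) x"
      by (rule isCont_germ[OF germ_cong[OF fin g(1)] germ_cong[OF fin g2]]) simp_all
    moreover have "sval 1 f \<in> PC_proj f" using fin b fb by (simp add: PC_proj_eq)
    ultimately show False using that unfolding discontinuity_def by blast
  qed
  ultimately show "PC_proj f \<in> IET_plus_on L" unfolding IET_plus_on_def using pt by blast
qed

lemma exchange_value:
  assumes "exchange L f" "\<bar>e\<bar> = 1" "germ e f x w"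
  obtains c where "c \<in> L" "tgerm e f x c" "w = x + c"
proof -
  obtain c where c: "c \<in> L" "tgerm e f x c" using assms(1,2) unfolding exchange_def by blast
  then show ?thesis using that germ_unique[OF assms(3) tgerm_germ[OF c(2)]] by blast
qed

lemma translated_in_iff:
  fixes L :: "circle set"
  assumes "\<And>a b. a \<in> L \<Longrightarrow> b \<in> L \<Longrightarrow> a + b \<in> L" "\<And>a. a \<in> L \<Longrightarrow> - a \<in> L" "c \<in> L"
  shows "x + c \<in> L \<longleftrightarrow> x \<in> L"
  using assms(1)[of "x + c" "- c"] assms(1)[of x c] assms(2)[OF assms(3)] assms(3) by auto

text \<open>Displacements lie in \<open>L\<close>, so a point outside \<open>L\<close> is carried to
  a point outside \<open>L\<close>, where \<open>h\<close> has no jump either.\<close>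

lemma exchange_comp:
  assumes L: "\<And>a b. a \<in> L \<Longrightarrow> b \<in> L \<Longrightarrow> a + b \<in> L" "\<And>a. a \<in> L \<Longrightarrow> - a \<in> L"
    and f: "exchange L f" and h: "exchange L h"
  shows "exchange L (h \<circ> f)"
  unfolding exchange_def
proof (intro conjI allI impI)
  show "h \<circ> f \<in> carrier PC_hat" using f h by (simp add: exchange_def PC_hat_comp)
  show "\<exists>c\<in>L. tgerm e (h \<circ> f) x c" if e: "\<bar>e\<bar> = 1" for e x
  proof -
    obtain c where c: "c \<in> L" "tgerm e f x c" using f e unfolding exchange_def by blast
    obtain c' where c': "c' \<in> L" "tgerm e h (x + c) c'" using h e unfolding exchange_def by blast
    show ?thesis using tgerm_comp[OF c(2) c'(2)] L(1)[OF c(1) c'(1)] by blast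
  qed
  fix x w w' assume x: "x \<notin> L" and w: "germ 1 (h \<circ> f) x w" "germ (-1) (h \<circ> f) x w'"
  obtain c where c: "c \<in> L" "tgerm 1 f x c" using f unfolding exchange_def by (metis abs_1)
  obtain c' where c': "c' \<in> L" "tgerm (-1) f x c'" using f unfolding exchange_def by (metis abs_1 abs_minus_cancel)
  have "x + c = x + c'" using f x tgerm_germ[OF c(2)] tgerm_germ[OF c'(2)] unfolding exchange_def by blast
  then have "c' = c" by simp
  then have g: "germ 1 f x (x + c)" "germ (-1) f x (x + c)" using tgerm_germ[OF c(2)] tgerm_germ[OF c'(2)] by simp_all
  have xc: "x + c \<notin> L" using translated_in_iff[OF L c(1)] x by blast
  have r: "regular h" by (rule exchange_regular[OF h])
  have h1: "germ 1 h (x + c) (sval 1 h (x + c))" "germ (-1) h (x + c) (sval (-1) h (x + c))"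
    by (rule regular_germ[OF r], simp)+
  then have "sval 1 h (x + c) = sval (-1) h (x + c)" using h xc unfolding exchange_def by blast
  moreover have "w = sval 1 h (x + c)" by (rule germ_unique[OF w(1) germ_comp[OF g(1) h1(1)]])
  moreover have "w' = sval (-1) h (x + c)" by (rule germ_unique[OF w(2) germ_comp[OF g(2) h1(2)]])
  ultimately show "w = w'" by simp
qed

text \<open>As \<open>sval e f\<close> is onto, every \<open>y\<close> is a limit of
  \<open>f\<close> on side \<open>e\<close>, which gives the translations of the inverse. A jump of
  the inverse at a \<open>y\<close> outside \<open>L\<close> would make the injective map
  \<open>sval (-1) f\<close> take the value \<open>y\<close> twice.\<close>

lemma exchange_inverse:
  assumes L: "\<And>a b. a \<in> L \<Longrightarrow> b \<in> L \<Longrightarrow> a + b \<in> L" "\<And>a. a \<in> L \<Longrightarrow> - a \<in> L"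
    and f: "exchange L f"
  shows "exchange L (finv f)"
proof -
  have r: "regular f" by (rule exchange_regular[OF f])
  have b: "bij f" using f by (simp add: exchange_def PC_hat_bij)
  have pre: "\<exists>x c. y = x + c \<and> c \<in> L \<and> tgerm e f x c" if e: "\<bar>e\<bar> = 1" for e y
  proof -
    define x where "x = finv (sval e f) y"
    have "sval e f x = y" using regular_sval(2)[OF r e] by (simp add: x_def bij_is_surj surj_f_inv_f)
    then have "germ e f x y" using regular_germ[OF r e, of x] by simp
    then show ?thesis using exchange_value[OF f e] by metis
  qed
  have inv_germ: "\<exists>x c. y = x + c \<and> c \<in> L \<and> tgerm e f x c \<and> w = x" if e: "\<bar>e\<bar> = 1" and w: "germ e (finv f) y w" for e y w
  proof -
    obtain x c where x: "y = x + c" "c \<in> L" "tgerm e f x c" using pre[OF e] by blast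
    have "germ e f x y" using tgerm_germ[OF x(3)] x(1) by simp
    then have "w = x" using germ_unique[OF w germ_inverse[OF b]] by blast
    then show ?thesis using x by blast
  qed
  show ?thesis unfolding exchange_def
  proof (intro conjI allI impI)
    show "finv f \<in> carrier PC_hat" by (rule regular_inverse_PC_hat[OF r])
    show "\<exists>c\<in>L. tgerm e (finv f) y c" if e: "\<bar>e\<bar> = 1" for e y
    proof -
      obtain x c where "y = x + c" "c \<in> L" "tgerm e f x c" using pre[OF e] by blast
      then show ?thesis using tgerm_inverse[OF b] L(2) by blast
    qed
    fix y w w' assume y: "y \<notin> L" and w: "germ 1 (finv f) y w" "germ (-1) (finv f) y w'"
    obtain c where c: "y = w + c" "c \<in> L" "tgerm 1 f w c" using inv_germ[OF _ w(1)] by auto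
    obtain c' where c': "y = w' + c'" "c' \<in> L" "tgerm (-1) f w' c'" using inv_germ[OF _ w(2)] by auto
    have wL: "w \<notin> L" using translated_in_iff[OF L c(2), of w] y c(1) by blast
    have gw: "germ 1 f w y" using tgerm_germ[OF c(3)] c(1) by simp
    have gw': "germ (-1) f w (sval (-1) f w)" by (rule regular_germ[OF r]) simp
    have "sval (-1) f w = y" using f wL gw gw' unfolding exchange_def by blast
    moreover have "sval (-1) f w' = y" using sval_eqI[OF tgerm_germ[OF c'(3)]] c'(1) by simp
    ultimately have "sval (-1) f w = sval (-1) f w'" by simp
    moreover have "inj (sval (-1) f)" by (intro bij_is_inj regular_sval(2)[OF r]) simp
    ultimately show "w = w'" by (rule injD[rotated])
  qed
qed

lemma translation_exchange:
  assumes "a \<in> L"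
  shows "exchange L (\<lambda>x. x + a)"
proof -
  have t: "tgerm e (\<lambda>x. x + a) x a" for e x
    unfolding tgerm_def by (intro exI[of _ 1]) (simp add: add.assoc add.commute[of a])
  have "isCont (\<lambda>x. x + a) x" for x
    by (rule isCont_germ) (rule tgerm_germ[OF t])+
  moreover have "bij (\<lambda>x. x + a)" by (rule bij_betwI[of _ _ _ "\<lambda>y. y - a"]) auto
  ultimately have P: "(\<lambda>x. x + a) \<in> carrier PC_hat"
    unfolding PC_hat_simps by (intro conjI exI[of _ "{}"] allI impI) simp_all
  show ?thesis unfolding exchange_def
  proof (intro conjI allI impI)
    show "\<exists>c\<in>L. tgerm e (\<lambda>x. x + a) x c" for e x using t assms by (rule bexI)
    fix x w w' assume w: "germ 1 (\<lambda>x. x + a) x w" "germ (-1) (\<lambda>x. x + a) x w'"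
    have "w = x + a" by (rule germ_unique[OF w(1) tgerm_germ[OF t]])
    moreover have "w' = x + a" by (rule germ_unique[OF w(2) tgerm_germ[OF t]])
    ultimately show "w = w'" by simp
  qed (rule P)
qed

lemma swap_in_IET_plus_on:
  assumes l: "0 < l" "2 * l < 1" and L: "0 \<in> L" "circle_of l \<in> L" "circle_of (2 * l) \<in> L" "- circle_of l \<in> L"
  shows "PC_proj (swap l) \<in> IET_plus_on L"
proof -
  let ?F = "{0, circle_of l, circle_of (2 * l)}"
  have b: "bij (swap l)" using swap_bij l by simp
  have cont: "isCont (swap l) x" if "x \<notin> ?F" for x
    using swap_germ[OF l, of x] that by (intro isCont_germ) auto
  then have P: "swap l \<in> carrier PC_hat" unfolding PC_hat_simps using b by (intro conjI exI[of _ ?F]) auto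
  have "\<exists>c\<in>L. \<forall>\<^sub>F y in nhds x. swap l y = y + c" if "x \<notin> ?F" for x
  proof -
    obtain c d where "c \<in> {0, circle_of l, - circle_of l}" "0 < d"
      "\<And>t. \<bar>t\<bar> < d \<Longrightarrow> swap l (x + circle_of t) = x + circle_of t + c"
      using swap_local_translation[OF l, of x] \<open>x \<notin> ?F\<close> by blast
    then show ?thesis using L unfolding eventually_nhds_circle by blast
  qed
  then have pt: "piecewise_translation_by L (swap l)" unfolding piecewise_translation_by_def
    by (intro exI[of _ ?F]) auto
  then have "piecewise_translation_by UNIV (swap l)" unfolding piecewise_translation_by_def by blast
  then have "PC_proj (swap l) \<in> IET_plus" unfolding IET_plus_def using P by blast
  moreover have s: "swap l \<in> PC_proj (swap l)" using b by (simp add: PC_proj_eq)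
  moreover have "x \<in> L" if "discontinuity (PC_proj (swap l)) x" for x
  proof (rule ccontr)
    assume "x \<notin> L"
    then have "x \<notin> ?F" using L by blast
    then show False using that s cont unfolding discontinuity_def by blast
  qed
  ultimately show ?thesis unfolding IET_plus_on_def using pt by blast
qed

lemma IET_plus_on_UNIV: "IET_plus_on UNIV = IET_plus"
proof -
  have "\<exists>f\<in>\<phi>. piecewise_translation_by UNIV f" if \<phi>: "\<phi> \<in> IET_plus" for \<phi>
  proof -
    obtain f where f: "f \<in> carrier PC_hat" "piecewise_translation_by UNIV f" "\<phi> = PC_proj f"
      using \<phi> unfolding IET_plus_def by blast
    have "f \<in> PC_proj f" using PC_hat_bij[OF f(1)] by (simp add: PC_proj_eq)
    then show ?thesis using f by blast
  qed
  then show ?thesis unfolding IET_plus_on_def by blast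
qed

section \<open>The three families satisfy the abstract hypotheses\<close>

lemma PC_plus_regular:
  assumes f: "f \<in> carrier PC_hat" "PC_proj f \<in> PC_plus"
  shows "regular f"
proof -
  obtain g F where g: "g \<in> carrier PC_hat" "finite F" "\<And>x. x \<notin> F \<Longrightarrow> orientation_preserving_at g x" "PC_proj f = PC_proj g"
    using f(2) unfolding PC_plus_def by blast
  have fin: "finite {x. g x \<noteq> f x}"
    using PC_proj_eq_iff[OF PC_hat_bij[OF f(1)] PC_hat_bij[OF g(1)]] g(4) finite_support_sym by blast
  have "\<exists>w. germ e f x w" if e: "\<bar>e\<bar> = 1" for e x
    using germ_exists[OF bij_is_inj[OF PC_hat_bij[OF g(1)]] g(2,3) e] germ_cong[OF fin _ e] by blast
  then show ?thesis unfolding regular_def using f(1) by blast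
qed

lemma IET_plus_on_regular_classes:
  assumes L: "0 \<in> L" "\<And>a b. a \<in> L \<Longrightarrow> b \<in> L \<Longrightarrow> a + b \<in> L" "\<And>a. a \<in> L \<Longrightarrow> - a \<in> L"
  shows "regular_classes (IET_plus_on L)"
proof (rule regular_classes.intro)
  show "IET_plus_on L \<subseteq> PC_proj ` carrier PC_hat" unfolding IET_plus_on_def IET_plus_def by blast
  show "regular f" if "f \<in> carrier PC_hat" "PC_proj f \<in> IET_plus_on L" for f
    using exchange_iff[OF that(1)] that(2) exchange_regular by blast
  have "exchange L id" using translation_exchange[OF L(1)] by (simp add: id_def)
  then show "PC_proj id \<in> IET_plus_on L" using exchange_iff[OF id_in_PC_hat] by blast
  show "PC_proj (f \<circ> g) \<in> IET_plus_on L"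
    if fg: "f \<in> carrier PC_hat" "g \<in> carrier PC_hat" "PC_proj f \<in> IET_plus_on L" "PC_proj g \<in> IET_plus_on L" for f g
  proof -
    have "exchange L f" "exchange L g" using fg exchange_iff by blast+
    then have "exchange L (f \<circ> g)" using exchange_comp[OF L(2,3)] by blast
    then show ?thesis using exchange_iff[OF PC_hat_comp[OF fg(2,1)]] by blast
  qed
  show "PC_proj (finv f) \<in> IET_plus_on L" if f: "f \<in> carrier PC_hat" "PC_proj f \<in> IET_plus_on L" for f
  proof -
    have "exchange L f" using f exchange_iff by blast
    then have ex: "exchange L (finv f)" using exchange_inverse[OF L(2,3)] by blast
    then have "finv f \<in> carrier PC_hat" unfolding exchange_def by (elim conjE)
    then show ?thesis using exchange_iff ex by blast
  qed
qed

lemma subgroup_regular_classes: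
  assumes s: "subgroup \<Gamma> PC" and p: "\<Gamma> \<subseteq> PC_plus"
  shows "regular_classes \<Gamma>"
proof (rule regular_classes.intro)
  show "\<Gamma> \<subseteq> PC_proj ` carrier PC_hat" using subgroup.subset[OF s] unfolding carrier_PC .
  show r: "regular f" if "f \<in> carrier PC_hat" "PC_proj f \<in> \<Gamma>" for f
    using PC_plus_regular that p by blast
  show "PC_proj id \<in> \<Gamma>" using subgroup.one_closed[OF s] unfolding PC_one .
  show "PC_proj (f \<circ> g) \<in> \<Gamma>"
    if "f \<in> carrier PC_hat" "g \<in> carrier PC_hat" "PC_proj f \<in> \<Gamma>" "PC_proj g \<in> \<Gamma>" for f g
    using subgroup.m_closed[OF s that(3,4)] unfolding PC_mult[OF PC_hat_bij[OF that(1)] PC_hat_bij[OF that(2)]] .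
  show "PC_proj (finv f) \<in> \<Gamma>" if f: "f \<in> carrier PC_hat" "PC_proj f \<in> \<Gamma>" for f
    using subgroup.m_inv_closed[OF s f(2)] unfolding PC_inv[OF f(1) regular_inverse_PC_hat[OF r[OF f]]] .
qed

lemma rich_classesI:
  assumes \<Gamma>: "regular_classes \<Gamma>" "IET_plus_on L \<subseteq> \<Gamma>"
    and L: "0 \<in> L" "\<And>a b. a \<in> L \<Longrightarrow> b \<in> L \<Longrightarrow> a + b \<in> L" "\<And>a. a \<in> L \<Longrightarrow> - a \<in> L"
    and indep: "\<exists>p q. circle_of p \<in> L \<and> circle_of q \<in> L \<and> independent_mod_1 p q"
    and cont: "\<And>f x w w'. f \<in> carrier PC_hat \<Longrightarrow> PC_proj f \<in> \<Gamma> \<Longrightarrow> x \<notin> L \<Longrightarrow> germ 1 f x w \<Longrightarrow> germ (-1) f x w' \<Longrightarrow> w = w'"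
  shows "rich_classes \<Gamma> L"
proof (intro rich_classes.intro[OF \<Gamma>(1)] rich_classes_axioms.intro)
  show "\<exists>p q. circle_of p \<in> L \<and> circle_of q \<in> L \<and>
      independent_mod_1 p q"
    by (rule indep)
  show "PC_proj (\<lambda>x. x + a) \<in> \<Gamma>" if "a \<in> L" for a
  proof -
    have e: "exchange L (\<lambda>x. x + a)" by (rule translation_exchange[OF that])
    then have P: "(\<lambda>x. x + a) \<in> carrier PC_hat" unfolding exchange_def by (elim conjE)
    show ?thesis by (rule subsetD[OF \<Gamma>(2)]) (use exchange_iff[OF P] e in \<open>simp only:\<close>)
  qed
  show "PC_proj (swap l) \<in> \<Gamma>" if l: "0 < l" "2 * l < 1" "circle_of l \<in> L" for l
  proof -
    have "circle_of (2 * l) \<in> L" using subgroup_int_multiple[OF L l(3), of 2] by simp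
    then show ?thesis using swap_in_IET_plus_on[OF l(1,2) L(1) l(3) _ L(3)[OF l(3)]] \<Gamma>(2) by blast
  qed
qed (fact L cont)+

theorem theorem1p9:
  fixes \<Gamma> :: "(circle \<Rightarrow> circle) set set"
  assumes "\<Gamma> = IET_plus
    \<or> (subgroup \<Gamma> PC \<and> \<Gamma> \<subseteq> PC_plus \<and> IET_plus \<subseteq> \<Gamma>)
    \<or> (\<exists>\<Lambda>. subgroup \<Lambda> circle_group \<and> rat_rank (circle_group\<lparr>carrier := \<Lambda>\<rparr>) \<ge> 2
         \<and> \<Gamma> = IET_plus_on \<Lambda>)"
  shows "\<forall>H. lifts H \<Gamma> \<longleftrightarrow>
    (\<exists>\<sigma>\<in>Sym_fin. H = conj_by \<sigma> (left_reps \<Gamma>) \<or> H = conj_by \<sigma> (right_reps \<Gamma>))"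
proof -
  \<comment> \<open>\<open>L\<close> is the whole circle in the first two cases, where countability
    provides independent rotations, and the given subgroup in the third, where the rank provides
    them.\<close>
  have "\<exists>L. rich_classes \<Gamma> L"
    using assms
  proof (elim disjE exE conjE)
    assume "\<Gamma> = IET_plus"
    then have "rich_classes \<Gamma> UNIV"
      using independent_pair_exists IET_plus_on_regular_classes[of UNIV]
      by (intro rich_classesI) (simp_all add: IET_plus_on_UNIV)
    then show ?thesis by blast
  next
    assume "subgroup \<Gamma> PC" "\<Gamma> \<subseteq> PC_plus" "IET_plus \<subseteq> \<Gamma>"
    then have "rich_classes \<Gamma> UNIV"
      using independent_pair_exists
      by (intro rich_classesI subgroup_regular_classes) (simp_all add: IET_plus_on_UNIV)
    then show ?thesis by blast
  next
    fix L assume L: "subgroup L circle_group" "rat_rank (circle_group\<lparr>carrier := L\<rparr>) \<ge> 2" "\<Gamma> = IET_plus_on L"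
    have "rich_classes (IET_plus_on L) L"
    proof (rule rich_classesI[OF IET_plus_on_regular_classes[OF circle_subgroup(1-3)[OF L(1)]] subset_refl
          circle_subgroup(1-3)[OF L(1)] rat_rank_ge_2_independent[OF L(1,2)]])
      show "w = w'" if "f \<in> carrier PC_hat" "PC_proj f \<in> IET_plus_on L" "x \<notin> L" "germ 1 f x w" "germ (-1) f x w'" for f x w w'
        using exchange_iff[OF that(1)] that(2-5) unfolding exchange_def by blast
    qed
    then show ?thesis using L(3) by blast
  qed
  then obtain L where "rich_classes \<Gamma> L" by blast
  then show ?thesis using rich_classes.lifts_classification by blast
qed

end
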